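(* Let $\Gamma$ be a metrized graph of total length $\ell(\Gamma)=\int_\Gamma dx=1$, and let $\mu$ be a real-valued signed Borel measure on $\Gamma$ with $|\mu|(\Gamma)<\infty$ and total mass $\mu(\Gamma)=1$. Then $$\mathrm{Tr}(\varphi_\mu)=\mathrm{Tr}(\varphi_{dx})+\langle dx-\mu,\,dx-\mu\rangle\ \ge\ \mathrm{Tr}(\varphi_{dx}),$$ with equality if and only if $\mu=dx$.
   Context: A metrized graph $\Gamma$ is a compact connected metric space such that for each $p\in\Gamma$ there are a radius $r_p>0$ and an integer $n_p\ge 1$ such that $p$ has a neighborhood isometric to the star $\{te^{2\pi i k/n_p}\in\mathbb{C}: 0\le t<r_p,\ k\in\mathbb{Z}\}$ with the path metric. $\mathrm{Vec}(p)$ is the set of $n_p$ formal unit vectors at $p$ (one for each ray of the star); $p+t\vec v$ is the point at distance $t$ from $p$ in direction $\vec v$ (small $t\ge0$), and $d_{\vec v}f(p)=\lim_{t\to0^+}(f(p+t\vec v)-f(p))/t$. $dx$ is arc-length measure. Kernel $g_\mu$ (for $\mu$ a bounded real signed Borel measure of total mass $1$): $\mathrm{CPA}(\Gamma)$ is the space of continuous piecewise affine functions $f:\Gamma\to\mathbb{C}$; for such $f$, $\Delta f=-\sum_{p}\big(\sum_{\vec v\in\mathrm{Vec}(p)}d_{\vec v}f(p)\big)\delta_p$. For $\zeta,y\in\Gamma$, $x\mapsto j_\zeta(x,y)$ is the unique function in $\mathrm{CPA}(\Gamma)$ with $\Delta_x j_\zeta(x,y)=\delta_y-\delta_\zeta$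 and $j_\zeta(\zeta,y)=0$; it is jointly continuous in $(\zeta,x,y)$ and symmetric in $x,y$. Put $j_\mu(x,y)=\int_\Gamma j_\zeta(x,y)\,d\mu(\zeta)$; $c_\mu=\int_\Gamma j_\mu(x,y)\,d\mu(x)$ does not depend on $y$, and $g_\mu(x,y)=j_\mu(x,y)-c_\mu$. $\varphi_\mu$ is the integral operator $\varphi_\mu(f)(x)=\int_\Gamma g_\mu(x,y)f(y)\,dy$ on $L^2(\Gamma,dx)$; its trace is $\mathrm{Tr}(\varphi_\mu)=\int_\Gamma g_\mu(x,x)\,dx$ (which equals the sum of its nonzero eigenvalues with multiplicity). For bounded Borel measures $\nu,\omega$ on $\Gamma$ with $\nu(\Gamma)=\omega(\Gamma)=0$, the energy pairing is $\langle\nu,\omega\rangle=\iint_{\Gamma\times\Gamma}g_{\mu'}(x,y)\,d\nu(x)\,\overline{d\omega(y)}$, which is independent of the choice of the bounded real signed Borel measure $\mu'$ of total mass $1$. *)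

theory Defs
  imports "HOL-Analysis.Analysis"
begin

section \<open>Stars and their path metric\<close>

definition star_set :: "real \<Rightarrow> nat \<Rightarrow> complex set" where
  "star_set r n = {of_real t * cis (2 * pi * of_int k / of_nat n) | t k. 0 \<le> t \<and> t < r}"

definition curve_length :: "(real \<Rightarrow> 'a::metric_space) \<Rightarrow> ennreal" where
  "curve_length g =
     (SUP (m, t) \<in> {(m :: nat, t :: nat \<Rightarrow> real). mono t \<and> range t \<subseteq> {0..1}}.
        ennreal (\<Sum>i<m. dist (g (t i)) (g (t (Suc i)))))"

definition path_dist :: "'a::metric_space set \<Rightarrow> 'a \<Rightarrow> 'a \<Rightarrow> ennreal" where
  "path_dist S x y =
     (INF g \<in> {g. path g \<and> path_image g \<subseteq> S \<and> pathstart g = x \<and> pathfinish g = y}. curve_length g)"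

section \<open>Metrized graphs\<close>

text \<open>Metric spaces are given as subsets of an ambient metric space, with the induced metric.
  The induced metric on a metrized graph is isometric to path metrics of stars only locally; it
  need not itself be a path metric.\<close>

definition star_chart :: "'a::metric_space set \<Rightarrow> 'a \<Rightarrow> real \<Rightarrow> nat \<Rightarrow> (complex \<Rightarrow> 'a) \<Rightarrow> bool" where
  "star_chart \<Gamma> p r n \<phi> \<longleftrightarrow>
     0 < r \<and> 1 \<le> n \<and> \<phi> 0 = p \<and> \<phi> ` star_set r n \<subseteq> \<Gamma> \<and>
     (\<exists>U. open U \<and> p \<in> U \<and> \<Gamma> \<inter> U \<subseteq> \<phi> ` star_set r n) \<and>
     (\<forall>z \<in> star_set r n. \<forall>w \<in> star_set r n.
        ennreal (dist (\<phi> z) (\<phi> w)) = path_dist (star_set r n) z w)"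

definition metrized_graph :: "'a::metric_space set \<Rightarrow> bool" where
  "metrized_graph \<Gamma> \<longleftrightarrow> \<Gamma> \<noteq> {} \<and> compact \<Gamma> \<and> connected \<Gamma> \<and>
     (\<forall>p \<in> \<Gamma>. \<exists>r n \<phi>. star_chart \<Gamma> p r n \<phi>)"

text \<open>One chart at each point is chosen in order to name the directions; the number of rays, and
  the sum of a function's directional derivatives over all directions, do not depend on it.\<close>

definition chosen_chart :: "'a::metric_space set \<Rightarrow> 'a \<Rightarrow> real \<times> nat \<times> (complex \<Rightarrow> 'a)" where
  "chosen_chart \<Gamma> p = (SOME (r, n, \<phi>). star_chart \<Gamma> p r n \<phi>)"

definition valence :: "'a::metric_space set \<Rightarrow> 'a \<Rightarrow> nat" where
  "valence \<Gamma> p = fst (snd (chosen_chart \<Gamma> p))"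

definition Vec :: "'a::metric_space set \<Rightarrow> 'a \<Rightarrow> complex set" where
  "Vec \<Gamma> p = {cis (2 * pi * of_int k / of_nat (valence \<Gamma> p)) | k. True}"

definition move :: "'a::metric_space set \<Rightarrow> 'a \<Rightarrow> complex \<Rightarrow> real \<Rightarrow> 'a" where
  "move \<Gamma> p v t = snd (snd (chosen_chart \<Gamma> p)) (of_real t * v)"

definition dir_deriv :: "'a::metric_space set \<Rightarrow> ('a \<Rightarrow> complex) \<Rightarrow> 'a \<Rightarrow> complex \<Rightarrow> complex" where
  "dir_deriv \<Gamma> f p v = Lim (at_right 0) (\<lambda>t. (f (move \<Gamma> p v t) - f p) / of_real t)"

definition segment_in :: "'a::metric_space set \<Rightarrow> real \<Rightarrow> real \<Rightarrow> (real \<Rightarrow> 'a) \<Rightarrow> bool" where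
  "segment_in \<Gamma> a b \<gamma> \<longleftrightarrow> a \<le> b \<and> \<gamma> ` {a..b} \<subseteq> \<Gamma> \<and>
     (\<forall>s \<in> {a..b}. \<forall>t \<in> {a..b}. dist (\<gamma> s) (\<gamma> t) = \<bar>s - t\<bar>)"

abbreviation borel_sets_of :: "'a::topological_space set \<Rightarrow> 'a set set" where
  "borel_sets_of \<Gamma> \<equiv> sets (restrict_space borel \<Gamma>)"

text \<open>Arc-length measure \<open>dx\<close>: the Borel measure on \<open>\<Gamma>\<close> giving every isometrically
  embedded segment its length.\<close>

definition arc_length :: "'a::metric_space set \<Rightarrow> 'a measure" where
  "arc_length \<Gamma> = (THE M. space M = \<Gamma> \<and> sets M = borel_sets_of \<Gamma> \<and>
     (\<forall>a b \<gamma>. segment_in \<Gamma> a b \<gamma> \<longrightarrow> emeasure M (\<gamma> ` {a..b}) = ennreal (b - a)))"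

section \<open>Signed and complex Borel measures\<close>

text \<open>A real or complex Borel measure on \<open>\<Gamma>\<close> is a set function, of which only the values on
  Borel subsets of \<open>\<Gamma>\<close> matter.\<close>

definition vector_borel_measure :: "'a::metric_space set \<Rightarrow> ('a set \<Rightarrow> 'b::real_normed_vector) \<Rightarrow> bool" where
  "vector_borel_measure \<Gamma> \<mu> \<longleftrightarrow> \<mu> {} = 0 \<and>
     (\<forall>A :: nat \<Rightarrow> 'a set. range A \<subseteq> borel_sets_of \<Gamma> \<longrightarrow> disjoint_family A \<longrightarrow>
        (\<lambda>n. \<mu> (A n)) sums \<mu> (\<Union>n. A n))"

definition total_variation :: "'a::metric_space set \<Rightarrow> ('a set \<Rightarrow> 'b::real_normed_vector) \<Rightarrow> 'a set \<Rightarrow> ennreal" where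
  "total_variation \<Gamma> \<mu> A =
     (SUP F \<in> {F :: nat \<Rightarrow> 'a set. range F \<subseteq> borel_sets_of \<Gamma> \<and> disjoint_family F \<and> (\<Union>n. F n) = A}.
        \<Sum>n. ennreal (norm (\<mu> (F n))))"

definition bounded_vector_measure :: "'a::metric_space set \<Rightarrow> ('a set \<Rightarrow> 'b::real_normed_vector) \<Rightarrow> bool" where
  "bounded_vector_measure \<Gamma> \<mu> \<longleftrightarrow> vector_borel_measure \<Gamma> \<mu> \<and> total_variation \<Gamma> \<mu> \<Gamma> < \<infinity>"

definition vector_measure_eq :: "'a::metric_space set \<Rightarrow> ('a set \<Rightarrow> 'b) \<Rightarrow> ('a set \<Rightarrow> 'b) \<Rightarrow> bool" where
  "vector_measure_eq \<Gamma> \<mu> \<nu> \<longleftrightarrow> (\<forall>A \<in> borel_sets_of \<Gamma>. \<mu> A = \<nu> A)"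

text \<open>Integration against a signed measure goes through its Jordan decomposition. The positive
  part of \<open>\<mu>\<close> is \<open>A \<mapsto> sup {\<mu>(B) | B \<subseteq> A}\<close>; note that
  \<open>ennreal\<close> sends negative reals to \<open>0\<close>, which is harmless here as
  \<open>B = {}\<close> is allowed.\<close>

definition pos_part :: "'a::metric_space set \<Rightarrow> ('a set \<Rightarrow> real) \<Rightarrow> 'a measure" where
  "pos_part \<Gamma> \<mu> = measure_of \<Gamma> (borel_sets_of \<Gamma>)
     (\<lambda>A. SUP B \<in> {B \<in> borel_sets_of \<Gamma>. B \<subseteq> A}. ennreal (\<mu> B))"

definition signed_integral :: "'a::metric_space set \<Rightarrow> ('a set \<Rightarrow> real) \<Rightarrow> ('a \<Rightarrow> complex) \<Rightarrow> complex" where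
  "signed_integral \<Gamma> \<mu> f =
     integral\<^sup>L (pos_part \<Gamma> \<mu>) f - integral\<^sup>L (pos_part \<Gamma> (\<lambda>A. - \<mu> A)) f"

definition complex_integral :: "'a::metric_space set \<Rightarrow> ('a set \<Rightarrow> complex) \<Rightarrow> ('a \<Rightarrow> complex) \<Rightarrow> complex" where
  "complex_integral \<Gamma> \<nu> f =
     signed_integral \<Gamma> (\<lambda>A. Re (\<nu> A)) f + \<i> * signed_integral \<Gamma> (\<lambda>A. Im (\<nu> A)) f"

definition dirac :: "'a \<Rightarrow> 'a set \<Rightarrow> complex" where
  "dirac y A = (if y \<in> A then 1 else 0)"

definition dx :: "'a::metric_space set \<Rightarrow> 'a set \<Rightarrow> real" where
  "dx \<Gamma> A = measure (arc_length \<Gamma>) A"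

definition total_length :: "'a::metric_space set \<Rightarrow> real" where
  "total_length \<Gamma> = dx \<Gamma> \<Gamma>"

section \<open>The Laplacian and the kernels\<close>

text \<open>Functions on \<open>\<Gamma>\<close> are extensional, so that they are determined by their
  values on \<open>\<Gamma>\<close>. Piecewise affine: outside a finite set of break points \<open>X\<close>, the function
  is affine in the arc-length parameter along every segment (\<open>X\<close> may be taken to contain all
  points of valence other than \<open>2\<close>).\<close>

definition CPA :: "'a::metric_space set \<Rightarrow> ('a \<Rightarrow> complex) set" where
  "CPA \<Gamma> = {f \<in> extensional \<Gamma>. continuous_on \<Gamma> f \<and>
     (\<exists>X. finite X \<and> X \<subseteq> \<Gamma> \<and>
        (\<forall>a b \<gamma>. segment_in \<Gamma> a b \<gamma> \<longrightarrow> \<gamma> ` {a<..<b} \<inter> X = {} \<longrightarrow>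
           (\<exists>\<alpha> \<beta>. \<forall>t \<in> {a..b}. f (\<gamma> t) = \<alpha> + \<beta> * of_real t)))}"

definition slope_sum :: "'a::metric_space set \<Rightarrow> ('a \<Rightarrow> complex) \<Rightarrow> 'a \<Rightarrow> complex" where
  "slope_sum \<Gamma> f p = (\<Sum>v \<in> Vec \<Gamma> p. dir_deriv \<Gamma> f p v)"

text \<open>For \<open>f\<close> in \<open>CPA \<Gamma>\<close> only finitely many points have a nonzero slope sum; the
  index set has to be cut down to these, as a sum over an infinite index set is \<open>0\<close>.\<close>

definition Laplacian :: "'a::metric_space set \<Rightarrow> ('a \<Rightarrow> complex) \<Rightarrow> 'a set \<Rightarrow> complex" where
  "Laplacian \<Gamma> f A = - (\<Sum>p | p \<in> \<Gamma> \<and> slope_sum \<Gamma> f p \<noteq> 0. slope_sum \<Gamma> f p * dirac p A)"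

text \<open>\<open>j_fun \<Gamma> \<zeta> x y\<close> is \<open>j\<^sub>\<zeta>(x, y)\<close>.\<close>

definition j_fun :: "'a::metric_space set \<Rightarrow> 'a \<Rightarrow> 'a \<Rightarrow> 'a \<Rightarrow> complex" where
  "j_fun \<Gamma> \<zeta> x y = (THE f. f \<in> CPA \<Gamma> \<and>
     vector_measure_eq \<Gamma> (Laplacian \<Gamma> f) (\<lambda>A. dirac y A - dirac \<zeta> A) \<and> f \<zeta> = 0) x"

definition j_mu :: "'a::metric_space set \<Rightarrow> ('a set \<Rightarrow> real) \<Rightarrow> 'a \<Rightarrow> 'a \<Rightarrow> complex" where
  "j_mu \<Gamma> \<mu> x y = signed_integral \<Gamma> \<mu> (\<lambda>\<zeta>. j_fun \<Gamma> \<zeta> x y)"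

definition c_mu :: "'a::metric_space set \<Rightarrow> ('a set \<Rightarrow> real) \<Rightarrow> complex" where
  "c_mu \<Gamma> \<mu> = (THE c. \<forall>y \<in> \<Gamma>. signed_integral \<Gamma> \<mu> (\<lambda>x. j_mu \<Gamma> \<mu> x y) = c)"

definition g_mu :: "'a::metric_space set \<Rightarrow> ('a set \<Rightarrow> real) \<Rightarrow> 'a \<Rightarrow> 'a \<Rightarrow> complex" where
  "g_mu \<Gamma> \<mu> x y = j_mu \<Gamma> \<mu> x y - c_mu \<Gamma> \<mu>"

text \<open>The trace of the integral operator \<open>\<phi>\<^sub>\<mu>\<close> on \<open>L\<^sup>2(\<Gamma>, dx)\<close> with kernel \<open>g\<^sub>\<mu>\<close>.\<close>

definition Tr_phi :: "'a::metric_space set \<Rightarrow> ('a set \<Rightarrow> real) \<Rightarrow> complex" where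
  "Tr_phi \<Gamma> \<mu> = (\<integral>x. g_mu \<Gamma> \<mu> x x \<partial>arc_length \<Gamma>)"

text \<open>The energy pairing of complex measures of total mass \<open>0\<close>: the common value, over all
  admissible \<open>\<mu>'\<close>, of the double integral of \<open>g_mu \<Gamma> \<mu>'\<close>. Conjugating the measure
  \<open>\<omega>\<close> itself leaves the integrand alone.\<close>

definition energy_pairing :: "'a::metric_space set \<Rightarrow> ('a set \<Rightarrow> complex) \<Rightarrow> ('a set \<Rightarrow> complex) \<Rightarrow> complex" where
  "energy_pairing \<Gamma> \<nu> \<omega> = (THE c. \<forall>\<mu>'. bounded_vector_measure \<Gamma> \<mu>' \<and> \<mu>' \<Gamma> = 1 \<longrightarrow>
     complex_integral \<Gamma> (\<lambda>A. cnj (\<omega> A)) (\<lambda>y. complex_integral \<Gamma> \<nu> (\<lambda>x. g_mu \<Gamma> \<mu>' x y)) = c)"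

end

theory Submission
  imports Defs
begin

text \<open>
Everything is expressed by one Green function. For a base vertex \<open>o\<close> let \<open>G(x, y)\<close> be symmetric, and continuous
and piecewise affine in \<open>x\<close> with Laplacian \<open>\<delta>\<^sub>y - \<delta>\<^sub>o\<close>. Then
\<open>j\<^sub>\<zeta>(x, y) = G(x, y) - G(x, \<zeta>) - G(\<zeta>, y) + G(\<zeta>, \<zeta>)\<close>, since both sides have the same Laplacian in \<open>x\<close>
and vanish at \<open>\<zeta>\<close>, and harmonic functions are constant by the maximum principle
(\<open>harmonic_constant\<close>, \<open>j_fun_eq\<close>). Write \<open>u\<^sub>\<mu>(y) = \<integral> G(x, y) d\<mu>(x)\<close> for the potential and
\<open>E(\<mu>, \<nu>) = \<integral> u\<^sub>\<mu> d\<nu>\<close> for the energy, a symmetric bilinear form. If \<open>\<mu>\<close> has total mass \<open>1\<close>, integration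
gives \<open>g\<^sub>\<mu>(x, y) = G(x, y) - u\<^sub>\<mu>(x) - u\<^sub>\<mu>(y) + E(\<mu>, \<mu>)\<close>. On a graph of length \<open>1\<close> the trace is therefore
\<open>\<integral> G(x, x) dx - 2 E(\<mu>, dx) + E(\<mu>, \<mu>)\<close>, and its excess over the case \<open>\<mu> = dx\<close> is
\<open>E(dx - \<mu>, dx - \<mu>)\<close>. Against a measure \<open>\<nu>\<close> of total mass \<open>0\<close> the terms of \<open>g\<^sub>\<mu>\<close> that depend on one variable
only integrate to \<open>0\<close>, so the energy pairing of \<open>\<nu>\<close> with itself is \<open>E(\<nu>, \<nu>)\<close> as well. This is the trace
formula (\<open>Tr_phi_eq\<close>, \<open>energy_pairing_eq\<close>, \<open>energy_diff\<close>).

Inequality and equality case say that \<open>E\<close> is positive definite, which is read off from an explicit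
formula for \<open>G\<close>. By compactness the graph consists of finitely many vertices and of edges
parametrized by arc length (\<open>network_exists\<close>). Let \<open>h\<^sub>p\<close> be the hat function of the vertex \<open>p\<close>, let \<open>J\<close> be
the inverse of the Laplace matrix of the network grounded at \<open>o\<close>, and let \<open>K\<^sub>e\<close> be the Green function of
the edge \<open>e\<close> with boundary values \<open>0\<close>. Then \<open>G = \<Sum> J\<^sub>p\<^sub>q h\<^sub>p(x) h\<^sub>q(y) + \<Sum> K\<^sub>e(x, y)\<close>, which is checked by
computing slopes (\<open>slope_sum_Gc\<close>). The matrix \<open>J\<close> is positive definite, and in the coordinates \<open>s\<close> and \<open>t\<close> on
an edge of length \<open>L\<close>
the kernel \<open>K\<^sub>e\<close> is \<open>min s t - s t / L = \<integral> (1\<^bsub>u < s\<^esub> - s / L) (1\<^bsub>u < t\<^esub> - t / L) du\<close>. Hence \<open>E(\<nu>, \<nu>)\<close> is a positive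
definite form in the numbers \<open>\<integral> h\<^sub>p d\<nu>\<close> plus integrals of squares (\<open>energy_eq\<close>). If it is \<open>0\<close>, the edges
carry no mass of \<open>\<nu>\<close>, then neither do the vertices, and \<open>\<nu> = 0\<close> (\<open>energy_definite\<close>).
\<close>

section \<open>Linear systems and isometries of the line\<close>

text \<open>Gaussian elimination: one equation expresses a pivot unknown through the others, which leaves
one equation and one unknown fewer.\<close>

lemma underdetermined_system_nontrivial_solution:
  fixes a :: "'r \<Rightarrow> 'c \<Rightarrow> real"
  assumes "finite R" "finite C" "card R < card C"
  shows "\<exists>x. (\<exists>c\<in>C. x c \<noteq> 0) \<and> (\<forall>r\<in>R. (\<Sum>c\<in>C. a r c * x c) = 0)"
  using assms
proof (induction R arbitrary: C a rule: finite_induct)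
  case empty
  then have "C \<noteq> {}" by auto
  then show ?case by (intro exI[of _ "\<lambda>_. 1"]) auto
next
  case (insert r R)
  have card: "card R < card C" using insert by simp
  show ?case
  proof (cases "\<forall>c\<in>C. a r c = 0")
    case True
    with insert.IH[OF insert.prems(1) card, of a] show ?thesis by auto
  next
    case False
    then obtain c0 where c0: "c0 \<in> C" "a r c0 \<noteq> 0" by auto
    let ?C = "C - {c0}"
    have "card R < card ?C" using insert c0 by simp
    from insert.IH[OF _ this, of "\<lambda>s c. a s c - a s c0 * a r c / a r c0"] insert.prems
    obtain x where x: "\<exists>c\<in>?C. x c \<noteq> 0"
      "\<And>s. s \<in> R \<Longrightarrow> (\<Sum>c\<in>?C. (a s c - a s c0 * a r c / a r c0) * x c) = 0"
      by auto
    define y where "y = x(c0 := - (\<Sum>c\<in>?C. a r c * x c) / a r c0)"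
    have split: "(\<Sum>c\<in>C. a s c * y c) = a s c0 * y c0 + (\<Sum>c\<in>?C. a s c * x c)" for s
      unfolding sum.remove[OF insert.prems(1) c0(1), of "\<lambda>c. a s c * y c"]
      by (auto simp: y_def intro!: sum.cong)
    have "(\<Sum>c\<in>C. a s c * y c) = 0" if "s \<in> insert r R" for s
    proof (cases "s = r")
      case True
      then show ?thesis using split[of r] c0 by (simp add: y_def)
    next
      case False
      then have "s \<in> R" using that by simp
      from x(2)[OF this]
      have "(\<Sum>c\<in>?C. a s c * x c) = (a s c0 / a r c0) * (\<Sum>c\<in>?C. a r c * x c)"
        by (simp add: left_diff_distrib sum_subtractf sum_distrib_left mult.assoc)
      then show ?thesis unfolding split by (simp add: y_def)
    qed
    moreover have "\<exists>c\<in>C. y c \<noteq> 0" using x(1) by (auto simp: y_def)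
    ultimately show ?thesis by blast
  qed
qed

text \<open>With the right-hand side appended as one more column the system has a nontrivial solution, and
injectivity forces the coefficient of that column to be nonzero, so that it can be divided out.
Unknowns are indexed by a finite set, as the vertices of a graph come without a numbering.\<close>

lemma symmetric_matrix_inverse:
  fixes a :: "'v \<Rightarrow> 'v \<Rightarrow> real"
  assumes V: "finite V" and sym: "\<And>p q. a p q = a q p"
    and inj: "\<And>w. (\<And>p. p \<in> V \<Longrightarrow> (\<Sum>q\<in>V. a p q * w q) = 0) \<Longrightarrow> (\<And>p. p \<in> V \<Longrightarrow> w p = 0)"
  obtains J where "\<And>p q. p \<in> V \<Longrightarrow> q \<in> V \<Longrightarrow> J p q = J q p"
    "\<And>p r. p \<in> V \<Longrightarrow> r \<in> V \<Longrightarrow> (\<Sum>q\<in>V. a p q * J q r) = of_bool (p = r)"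
proof -
  have "\<exists>x. \<forall>p\<in>V. (\<Sum>q\<in>V. a p q * x q) = of_bool (p = r)" for r
  proof -
    have "card V < card (insert None (Some ` V))" using V by (simp add: card_image)
    from underdetermined_system_nontrivial_solution[OF V _ this,
        of "\<lambda>p c. case c of None \<Rightarrow> - of_bool (p = r) | Some q \<Rightarrow> a p q"] V
    obtain x where nz: "\<exists>c\<in>insert None (Some ` V). x c \<noteq> 0"
      and x: "\<And>p. p \<in> V \<Longrightarrow> (\<Sum>q\<in>V. a p q * x (Some q)) = of_bool (p = r) * x None"
      by (auto simp: sum.reindex)
    have "x None \<noteq> 0"
    proof
      assume "x None = 0"
      then have "x (Some p) = 0" if "p \<in> V" for p
        using inj[of "\<lambda>q. x (Some q)"] x that by simp
      with \<open>x None = 0\<close> nz show False by auto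
    qed
    then have "\<forall>p\<in>V. (\<Sum>q\<in>V. a p q * (x (Some q) / x None)) = of_bool (p = r)"
      using x by (simp flip: sum_divide_distrib add: field_simps)
    then show ?thesis by (intro exI[of _ "\<lambda>q. x (Some q) / x None"])
  qed
  then obtain x where x: "\<And>r p. p \<in> V \<Longrightarrow> (\<Sum>q\<in>V. a p q * x r q) = of_bool (p = r)"
    by metis
  define J where "J q r = x r q" for q r
  have J: "(\<Sum>q\<in>V. a p q * J q r) = of_bool (p = r)" if "p \<in> V" for p r
    using x[OF that] by (simp add: J_def)
  have "J p r = J r p" if pr: "p \<in> V" "r \<in> V" for p r
  proof -
    have "J r p = (\<Sum>s\<in>V. J s p * (\<Sum>q\<in>V. a s q * J q r))"
      using pr V by (simp add: J of_bool_def if_distrib[of "\<lambda>x. _ * x"] cong: if_cong)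
    also have "\<dots> = (\<Sum>q\<in>V. J q r * (\<Sum>s\<in>V. a q s * J s p))"
      unfolding sum_distrib_left by (subst sum.swap) (intro sum.cong refl, simp add: sym mult_ac)
    also have "\<dots> = J p r"
      using pr V by (simp add: J of_bool_def if_distrib[of "\<lambda>x. _ * x"] cong: if_cong)
    finally show ?thesis by simp
  qed
  then show ?thesis using J that by blast
qed

text \<open>The distances to two fixed points determine a point of the line. This compares two
parametrizations by arc length on their common part, which can be an irregular set.\<close>

lemma isometry_on_real_set:
  fixes g :: "real \<Rightarrow> real"
  assumes "\<And>s t. s \<in> S \<Longrightarrow> t \<in> S \<Longrightarrow> \<bar>g s - g t\<bar> = \<bar>s - t\<bar>"
  obtains c \<epsilon> where "\<epsilon> = 1 \<or> \<epsilon> = -1" "\<And>s. s \<in> S \<Longrightarrow> g s = c + \<epsilon> * s"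
proof (cases "\<exists>a b. a \<in> S \<and> b \<in> S \<and> a < b")
  case True
  then obtain a b where ab: "a \<in> S" "b \<in> S" "a < b" by blast
  define \<epsilon> :: real where "\<epsilon> = (if g a < g b then 1 else -1)"
  have "g s = (g a - \<epsilon> * a) + \<epsilon> * s" if "s \<in> S" for s
    using assms[OF that ab(1)] assms[OF that ab(2)] assms[OF ab(1,2)] ab(3)
    unfolding \<epsilon>_def by (auto split: if_splits)
  then show ?thesis using that[of \<epsilon>] by (metis \<epsilon>_def)
next
  case False
  then have eq: "s = t" if "s \<in> S" "t \<in> S" for s t using that by (metis linorder_neqE)
  show ?thesis
  proof (cases "S = {}")
    case True then show ?thesis using that[of 1 0] by auto
  next
    case ne: False
    then obtain a where "a \<in> S" by auto
    then show ?thesis using that[of 1 "g a - a"] eq by force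
  qed
qed

section \<open>Integration against signed measures\<close>

abbreviation borel_on :: "'a::topological_space set \<Rightarrow> 'a measure" where
  "borel_on \<Gamma> \<equiv> restrict_space borel \<Gamma>"

lemma space_borel_on[simp]: "space (borel_on \<Gamma>) = \<Gamma>"
  by (simp add: space_restrict_space)

lemma carrier_in_borel_sets: "\<Gamma> \<in> borel_sets_of \<Gamma>"
  using sets.top[of "borel_on \<Gamma>"] by simp

lemma borel_sets_subset_Pow: "borel_sets_of \<Gamma> \<subseteq> Pow \<Gamma>"
  using sets.space_closed[of "borel_on \<Gamma>"] by simp

lemma sigma_algebra_borel_sets: "sigma_algebra \<Gamma> (borel_sets_of \<Gamma>)"
  using sets.sigma_algebra_axioms[of "borel_on \<Gamma>"] by simp

lemma space_eq_of_sets: "sets M = borel_sets_of \<Gamma> \<Longrightarrow> space M = \<Gamma>"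
  using sets_eq_imp_space_eq[of M "borel_on \<Gamma>"] by simp

definition bounded_borel :: "'a::topological_space set \<Rightarrow> ('a \<Rightarrow> real) \<Rightarrow> bool" where
  "bounded_borel \<Gamma> f \<longleftrightarrow> f \<in> borel_measurable (borel_on \<Gamma>) \<and> (\<exists>B. \<forall>x\<in>\<Gamma>. \<bar>f x\<bar> \<le> B)"

lemma bounded_borel_measurable: "bounded_borel \<Gamma> f \<Longrightarrow> f \<in> borel_measurable (borel_on \<Gamma>)"
  by (simp add: bounded_borel_def)

lemma bounded_borel_const: "bounded_borel \<Gamma> (\<lambda>_. c)"
  by (auto simp: bounded_borel_def)

lemma bounded_borel_add: "bounded_borel \<Gamma> f \<Longrightarrow> bounded_borel \<Gamma> g \<Longrightarrow> bounded_borel \<Gamma> (\<lambda>x. f x + g x)"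
  unfolding bounded_borel_def
  by (auto intro!: borel_measurable_add) (meson abs_triangle_ineq add_mono order_trans)

lemma bounded_borel_mult: "bounded_borel \<Gamma> f \<Longrightarrow> bounded_borel \<Gamma> g \<Longrightarrow> bounded_borel \<Gamma> (\<lambda>x. f x * g x)"
  unfolding bounded_borel_def
  by (auto intro!: borel_measurable_times simp: abs_mult) (meson abs_ge_zero mult_mono order_trans)

lemma bounded_borel_diff: "bounded_borel \<Gamma> f \<Longrightarrow> bounded_borel \<Gamma> g \<Longrightarrow> bounded_borel \<Gamma> (\<lambda>x. f x - g x)"
  using bounded_borel_add[of \<Gamma> f "\<lambda>x. (-1) * g x"] bounded_borel_mult[OF bounded_borel_const[of \<Gamma> "-1"], of g]
  by simp

lemma bounded_borel_sum: "(\<And>i. i \<in> I \<Longrightarrow> bounded_borel \<Gamma> (f i)) \<Longrightarrow> bounded_borel \<Gamma> (\<lambda>x. \<Sum>i\<in>I. f i x)"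
  by (induction I rule: infinite_finite_induct) (auto intro: bounded_borel_const bounded_borel_add)

lemma bounded_borel_cong: "(\<And>x. x \<in> \<Gamma> \<Longrightarrow> f x = g x) \<Longrightarrow> bounded_borel \<Gamma> f \<longleftrightarrow> bounded_borel \<Gamma> g"
  unfolding bounded_borel_def
  using measurable_cong[of "borel_on \<Gamma>" f g borel] by (simp add: space_restrict_space cong: ball_cong)

lemma bounded_borel_integrable:
  assumes "bounded_borel \<Gamma> f" "finite_measure M" "sets M = borel_sets_of \<Gamma>"
  shows "integrable M f"
proof -
  obtain B where B: "\<And>x. x \<in> \<Gamma> \<Longrightarrow> \<bar>f x\<bar> \<le> B" using assms(1) by (auto simp: bounded_borel_def)
  have "space M = \<Gamma>" using assms(3) by (rule space_eq_of_sets)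
  then show ?thesis
    using assms B unfolding bounded_borel_def
    by (intro finite_measure.integrable_const_bound[of M f B])
       (auto cong: measurable_cong_sets)
qed

text \<open>A linear relation between the values of finitely many measures on all Borel sets passes to step
functions and then, by dominated convergence, to bounded functions. It makes integrals against a
signed measure independent of the way in which the measure is written as a combination of
positive ones. The list holds pairs of a coefficient and a measure.\<close>

lemma integral_linear_in_measure:
  fixes L :: "(real \<times> 'a::metric_space measure) list"
  assumes L: "\<And>c M. (c, M) \<in> set L \<Longrightarrow> finite_measure M \<and> sets M = borel_sets_of \<Gamma>"
    and zero: "\<And>A. A \<in> borel_sets_of \<Gamma> \<Longrightarrow> (\<Sum>(c, M)\<leftarrow>L. c * measure M A) = 0"
    and f: "bounded_borel \<Gamma> f"
  shows "(\<Sum>(c, M)\<leftarrow>L. c * integral\<^sup>L M f) = 0"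
proof -
  have sp: "space M = \<Gamma>" if "(c, M) \<in> set L" for c M
    using L[OF that] space_eq_of_sets by blast
  have int: "integrable M g" if "(c, M) \<in> set L" "bounded_borel \<Gamma> g" for c M g
    using L[OF that(1)] that(2) by (blast intro: bounded_borel_integrable)
  have nonneg: "(\<Sum>(c, M)\<leftarrow>L. c * integral\<^sup>L M u) = 0"
    if "u \<in> borel_measurable (borel_on \<Gamma>)" "\<And>x. 0 \<le> u x" "\<exists>B. \<forall>x\<in>\<Gamma>. u x \<le> B" for u
    using that
  proof (induction rule: borel_measurable_induct_real)
    case (set A)
    have "(\<Sum>(c, M)\<leftarrow>L. c * integral\<^sup>L M (indicator A :: 'a \<Rightarrow> real)) = (\<Sum>(c, M)\<leftarrow>L. c * measure M A)"
      using set L sets.sets_into_space[OF set(1)]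
      by (intro arg_cong[of _ _ sum_list] map_cong) (auto simp: sp space_restrict_space Int_absorb2)
    then show ?case using zero set by simp
  next
    case (mult u c)
    show ?case
    proof (cases "c = 0")
      case True
      have "(\<Sum>(c, M)\<leftarrow>L. c * integral\<^sup>L M (\<lambda>x. 0 * u x)) = 0"
        by (simp add: case_prod_unfold)
      then show ?thesis using True by simp
    next
      case False
      then have "c > 0" using mult by simp
      obtain B where "\<And>x. x \<in> \<Gamma> \<Longrightarrow> c * u x \<le> B" using mult.prems by auto
      then have "\<forall>x\<in>\<Gamma>. u x \<le> B / c" using \<open>c > 0\<close> by (simp add: field_simps)
      then have "(\<Sum>(c, M)\<leftarrow>L. c * integral\<^sup>L M u) = 0" using mult.IH by blast
      then have "c * (\<Sum>(c, M)\<leftarrow>L. c * integral\<^sup>L M u) = 0" by simp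
      then show ?thesis
        by (simp add: sum_list_const_mult[symmetric] case_prod_unfold mult.left_commute)
    qed
  next
    case (add u v)
    obtain B where B: "\<And>x. x \<in> \<Gamma> \<Longrightarrow> v x + u x \<le> B" using add.prems by auto
    have uv: "0 \<le> u x" "0 \<le> v x" for x using add.hyps by auto
    have bu: "u x \<le> B" and bv: "v x \<le> B" if "x \<in> \<Gamma>" for x
      using B[OF that] uv[of x] by linarith+
    have "bounded_borel \<Gamma> u" "bounded_borel \<Gamma> v"
      using add.hyps uv bu bv unfolding bounded_borel_def by (auto intro!: exI[of _ B])
    then have "(\<Sum>(c, M)\<leftarrow>L. c * (\<integral>x. v x + u x \<partial>M))
        = (\<Sum>(c, M)\<leftarrow>L. c * integral\<^sup>L M v + c * integral\<^sup>L M u)"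
      using int by (intro arg_cong[of _ _ sum_list] map_cong) (auto simp: algebra_simps)
    also have "\<dots> = (\<Sum>(c, M)\<leftarrow>L. c * integral\<^sup>L M v) + (\<Sum>(c, M)\<leftarrow>L. c * integral\<^sup>L M u)"
      by (simp add: case_prod_unfold sum_list_addf)
    also have "\<dots> = 0" using add.IH bu bv by fastforce
    finally show ?case .
  next
    case (seq U)
    obtain B where B: "\<And>x. x \<in> \<Gamma> \<Longrightarrow> u x \<le> B" using seq.prems by auto
    have U_le: "U i x \<le> u x" if "x \<in> \<Gamma>" for i x
      using seq that by (intro incseq_le) (auto simp: incseq_def le_fun_def space_restrict_space)
    then have UB: "U i x \<le> B" if "x \<in> \<Gamma>" for i x using B that order_trans by blast
    have lim: "(\<lambda>i. integral\<^sup>L M (U i)) \<longlonglongrightarrow> integral\<^sup>L M u" if "(c, M) \<in> set L" for c M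
    proof (rule integral_dominated_convergence[where w = "\<lambda>_. B"])
      interpret finite_measure M using L that by simp
      show "integrable M (\<lambda>_. B)" by simp
      have Um: "U i \<in> borel_measurable M" for i
        using seq(1) L[OF that] by (simp cong: measurable_cong_sets)
      then show "\<And>i. U i \<in> borel_measurable M" .
      show "u \<in> borel_measurable M"
        by (rule borel_measurable_LIMSEQ_real[OF _ Um])
          (use seq(4) in \<open>simp add: sp[OF that] space_restrict_space\<close>)
      show "AE x in M. (\<lambda>i. U i x) \<longlonglongrightarrow> u x" 
        using seq(4) by (intro AE_I2) (simp add: sp[OF that] space_restrict_space)
      show "\<And>i. AE x in M. norm (U i x) \<le> B"
        using UB seq(2) by (intro AE_I2) (simp add: sp[OF that] space_restrict_space)
    qed
    have "(\<lambda>i. \<Sum>(c, M)\<leftarrow>L. c * integral\<^sup>L M (U i)) \<longlonglongrightarrow> (\<Sum>(c, M)\<leftarrow>L. c * integral\<^sup>L M u)"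
      using lim by (induction L) (auto intro!: tendsto_intros)
    moreover have z: "(\<Sum>(c, M)\<leftarrow>L. c * integral\<^sup>L M (U i)) = 0" for i
      by (rule seq.IH) (use UB in blast)
    ultimately show ?case unfolding z using LIMSEQ_unique tendsto_const by blast
  qed
  obtain B where B: "\<And>x. x \<in> \<Gamma> \<Longrightarrow> \<bar>f x\<bar> \<le> B" using f by (auto simp: bounded_borel_def)
  define P where "P = (\<lambda>x. max 0 (f x))"
  define N where "N = (\<lambda>x. max 0 (- f x))"
  have m: "f \<in> borel_measurable (borel_on \<Gamma>)" using f by (simp add: bounded_borel_def)
  have "P \<in> borel_measurable (borel_on \<Gamma>)" "N \<in> borel_measurable (borel_on \<Gamma>)"
    unfolding P_def N_def using m by measurable
  moreover have "\<forall>x\<in>\<Gamma>. P x \<le> \<bar>B\<bar>" "\<forall>x\<in>\<Gamma>. N x \<le> \<bar>B\<bar>" "P x \<ge> 0" "N x \<ge> 0" for x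
    using B by (auto simp: P_def N_def abs_le_iff max_def) (smt (verit))+
  ultimately have z: "(\<Sum>(c, M)\<leftarrow>L. c * integral\<^sup>L M P) = 0" "(\<Sum>(c, M)\<leftarrow>L. c * integral\<^sup>L M N) = 0"
    and bb: "bounded_borel \<Gamma> P" "bounded_borel \<Gamma> N"
    using nonneg unfolding bounded_borel_def by (blast, blast, auto)
  have fPN: "f = (\<lambda>x. P x - N x)" by (auto simp: P_def N_def)
  have "(\<Sum>(c, M)\<leftarrow>L. c * integral\<^sup>L M f) = (\<Sum>(c, M)\<leftarrow>L. c * integral\<^sup>L M P - c * integral\<^sup>L M N)"
    unfolding fPN using int bb by (intro arg_cong[of _ _ sum_list] map_cong) (auto simp: algebra_simps)
  also have "\<dots> = (\<Sum>(c, M)\<leftarrow>L. c * integral\<^sup>L M P) - (\<Sum>(c, M)\<leftarrow>L. c * integral\<^sup>L M N)"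
    by (simp add: case_prod_unfold sum_list_subtractf)
  finally show ?thesis using z by simp
qed

text \<open>Boundedness replaces finite total variation because it passes to differences by the triangle
inequality.\<close>

definition bounded_signed :: "'a::metric_space set \<Rightarrow> ('a set \<Rightarrow> real) \<Rightarrow> bool" where
  "bounded_signed \<Gamma> \<mu> \<longleftrightarrow> vector_borel_measure \<Gamma> \<mu> \<and> (\<exists>B. \<forall>A\<in>borel_sets_of \<Gamma>. \<bar>\<mu> A\<bar> \<le> B)"

lemma vector_borel_measure_Un:
  assumes "vector_borel_measure \<Gamma> \<mu>" "A \<in> borel_sets_of \<Gamma>" "B \<in> borel_sets_of \<Gamma>" "A \<inter> B = {}"
  shows "\<mu> (A \<union> B) = \<mu> A + \<mu> B"
proof -
  have "range (binaryset A B) \<subseteq> borel_sets_of \<Gamma>" using assms by (simp add: range_binaryset_eq)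
  moreover have "disjoint_family (binaryset A B)"
    using assms by (auto simp: disjoint_family_on_def binaryset_def)
  ultimately have "(\<lambda>n. \<mu> (binaryset A B n)) sums \<mu> (A \<union> B)"
    using assms(1) unfolding vector_borel_measure_def UN_binaryset_eq[symmetric, of A B] by blast
  moreover have "(\<lambda>n. \<mu> (binaryset A B n)) sums (\<Sum>n<2. \<mu> (binaryset A B n))"
    using assms(1) by (intro sums_finite) (auto simp: binaryset_def vector_borel_measure_def)
  ultimately have "\<mu> (A \<union> B) = (\<Sum>n<2. \<mu> (binaryset A B n))" by (rule sums_unique2)
  then show ?thesis by (simp add: binaryset_def numeral_2_eq_2)
qed

lemma bounded_signedI_total_variation:
  assumes "vector_borel_measure \<Gamma> \<mu>" "total_variation \<Gamma> \<mu> \<Gamma> < \<infinity>"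
  shows "bounded_signed \<Gamma> \<mu>"
proof -
  obtain T where T: "total_variation \<Gamma> \<mu> \<Gamma> = ennreal T" "T \<ge> 0"
    using assms(2) by (cases "total_variation \<Gamma> \<mu> \<Gamma>") auto
  have "\<bar>\<mu> A\<bar> \<le> T" if A: "A \<in> borel_sets_of \<Gamma>" for A
  proof -
    let ?F = "binaryset A (\<Gamma> - A)"
    have "\<Gamma> \<in> borel_sets_of \<Gamma>" by (rule carrier_in_borel_sets)
    moreover have "A \<subseteq> \<Gamma>" using sets.sets_into_space[OF A] by (simp add: space_restrict_space)
    ultimately have F: "range ?F \<subseteq> borel_sets_of \<Gamma> \<and> disjoint_family ?F \<and> (\<Union>n. ?F n) = \<Gamma>"
      using A unfolding UN_binaryset_eq range_binaryset_eq
      by (auto simp: disjoint_family_on_def binaryset_def)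
    have "ennreal \<bar>\<mu> A\<bar> = (\<Sum>n<1. ennreal (norm (\<mu> (?F n))))" by (simp add: binaryset_def)
    also have "\<dots> \<le> (\<Sum>n. ennreal (norm (\<mu> (?F n))))" by (rule sum_le_suminf) auto
    also have "\<dots> \<le> total_variation \<Gamma> \<mu> \<Gamma>"
      unfolding total_variation_def using F by (intro SUP_upper) simp
    finally show ?thesis using T by simp
  qed
  then show ?thesis using assms(1) by (auto simp: bounded_signed_def)
qed

lemma vector_borel_measure_diff:
  "vector_borel_measure \<Gamma> \<mu> \<Longrightarrow> vector_borel_measure \<Gamma> \<nu> \<Longrightarrow> vector_borel_measure \<Gamma> (\<lambda>A. \<mu> A - \<nu> A)"
  unfolding vector_borel_measure_def by (auto intro!: sums_diff)

lemma vector_borel_measure_uminus: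
  "vector_borel_measure \<Gamma> \<mu> \<Longrightarrow> vector_borel_measure \<Gamma> (\<lambda>A. - \<mu> A)"
  unfolding vector_borel_measure_def by (auto intro!: sums_minus)

lemma bounded_signed_diff:
  "bounded_signed \<Gamma> \<mu> \<Longrightarrow> bounded_signed \<Gamma> \<nu> \<Longrightarrow> bounded_signed \<Gamma> (\<lambda>A. \<mu> A - \<nu> A)"
  unfolding bounded_signed_def
  by (auto intro!: vector_borel_measure_diff) (meson abs_triangle_ineq4 add_mono order_trans)

lemma bounded_signed_uminus:
  "bounded_signed \<Gamma> \<mu> \<Longrightarrow> bounded_signed \<Gamma> (\<lambda>A. - \<mu> A)"
  unfolding bounded_signed_def by (auto intro!: vector_borel_measure_uminus)

lemma finite_measure_bounded_signed:
  assumes "finite_measure M" "sets M = borel_sets_of \<Gamma>"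
  shows "bounded_signed \<Gamma> (measure M)"
proof -
  interpret finite_measure M by fact
  show ?thesis unfolding bounded_signed_def vector_borel_measure_def
    using assms(2) finite_measure_UNION by (auto intro!: exI[of _ "measure M (space M)"] bounded_measure)
qed

lemma sets_pos_part[simp]: "sets (pos_part \<Gamma> \<mu>) = borel_sets_of \<Gamma>"
  and space_pos_part[simp]: "space (pos_part \<Gamma> \<mu>) = \<Gamma>"
proof -
  note sub = borel_sets_subset_Pow[of \<Gamma>]
  show "space (pos_part \<Gamma> \<mu>) = \<Gamma>" unfolding pos_part_def using sub by (rule space_measure_of)
  have "sigma_sets \<Gamma> (borel_sets_of \<Gamma>) = borel_sets_of \<Gamma>"
    using sets.sigma_sets_eq[of "borel_on \<Gamma>"] by (simp add: space_restrict_space)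
  then show "sets (pos_part \<Gamma> \<mu>) = borel_sets_of \<Gamma>" unfolding pos_part_def using sub by simp
qed

text \<open>Subsets of disjoint sets can be chosen independently, so the supremum is superadditive. It is
countably subadditive since a subset of a union splits into subsets of the members.\<close>

lemma emeasure_pos_part:
  assumes \<mu>: "vector_borel_measure \<Gamma> \<mu>" and A: "A \<in> borel_sets_of \<Gamma>"
  shows "emeasure (pos_part \<Gamma> \<mu>) A = (SUP B \<in> {B \<in> borel_sets_of \<Gamma>. B \<subseteq> A}. ennreal (\<mu> B))"
proof -
  define P where "P A = (SUP B \<in> {B \<in> borel_sets_of \<Gamma>. B \<subseteq> A}. ennreal (\<mu> B))" for A
  have P_ge: "ennreal (\<mu> B) \<le> P A" if "B \<in> borel_sets_of \<Gamma>" "B \<subseteq> A" for A B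
    unfolding P_def using that by (intro SUP_upper) auto
  have P_mono: "P A \<le> P B" if "A \<subseteq> B" for A B
    unfolding P_def using that by (intro SUP_subset_mono) auto
  have P_Un: "P A + P B \<le> P (A \<union> B)" if "A \<inter> B = {}" for A B
  proof -
    have "ennreal (\<mu> C) + ennreal (\<mu> D) \<le> P (A \<union> B)"
      if "C \<in> borel_sets_of \<Gamma>" "C \<subseteq> A" "D \<in> borel_sets_of \<Gamma>" "D \<subseteq> B" for C D
    proof -
      have "C \<inter> D = {}" using that \<open>A \<inter> B = {}\<close> by auto
      then have "\<mu> (C \<union> D) = \<mu> C + \<mu> D" using vector_borel_measure_Un[OF \<mu>] that by blast
      then have "ennreal (\<mu> C + \<mu> D) \<le> P (A \<union> B)" using P_ge[of "C \<union> D" "A \<union> B"] that by auto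
      moreover have "ennreal (\<mu> C) \<le> P (A \<union> B)" "ennreal (\<mu> D) \<le> P (A \<union> B)"
        using that by (auto intro!: P_ge)
      ultimately show ?thesis unfolding ennreal_plus_if by (simp del: ennreal_plus)
    qed
    then have "(SUP C \<in> {C \<in> borel_sets_of \<Gamma>. C \<subseteq> A}. SUP D \<in> {D \<in> borel_sets_of \<Gamma>. D \<subseteq> B}.
        ennreal (\<mu> C) + ennreal (\<mu> D)) \<le> P (A \<union> B)"
      by (intro SUP_least) auto
    moreover have "P A + P B = (SUP C \<in> {C \<in> borel_sets_of \<Gamma>. C \<subseteq> A}. SUP D \<in> {D \<in> borel_sets_of \<Gamma>. D \<subseteq> B}.
        ennreal (\<mu> C) + ennreal (\<mu> D))"
    proof -
      have ne: "{C \<in> borel_sets_of \<Gamma>. C \<subseteq> A} \<noteq> {}" for A by blast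
      show ?thesis
        unfolding P_def by (simp only: ennreal_SUP_add_left[OF ne] ennreal_SUP_add_right[OF ne, symmetric])
    qed
    ultimately show ?thesis by simp
  qed
  have ca: "countably_additive (borel_sets_of \<Gamma>) P"
    unfolding countably_additive_def
  proof (intro allI impI)
    fix A :: "nat \<Rightarrow> 'a set"
    assume A: "range A \<subseteq> borel_sets_of \<Gamma>" "disjoint_family A" "\<Union> (range A) \<in> borel_sets_of \<Gamma>"
    have "(\<Sum>i<n. P (A i)) \<le> P (\<Union>i<n. A i)" for n
    proof (induction n)
      case (Suc n)
      have "A i \<inter> A n = {}" if "i < n" for i
        using A(2) that disjoint_family_onD[of A UNIV i n] by simp
      then have "(\<Union>i<n. A i) \<inter> A n = {}" by blast
      from P_Un[OF this] Suc have "(\<Sum>i<Suc n. P (A i)) \<le> P ((\<Union>i<n. A i) \<union> A n)"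
        by (auto intro: order_trans add_right_mono)
      then show ?case by (simp add: lessThan_Suc Un_commute)
    qed simp
    then have "(\<Sum>i<n. P (A i)) \<le> P (\<Union>i. A i)" for n
      by (rule order_trans[OF _ P_mono]) auto
    then have le: "(\<Sum>i. P (A i)) \<le> P (\<Union>i. A i)" by (intro suminf_le_const) auto
    have "ennreal (\<mu> B) \<le> (\<Sum>i. P (A i))" if B: "B \<in> borel_sets_of \<Gamma>" "B \<subseteq> (\<Union>i. A i)" for B
    proof -
      have "range (\<lambda>i. B \<inter> A i) \<subseteq> borel_sets_of \<Gamma>" "disjoint_family (\<lambda>i. B \<inter> A i)"
        using A B by (auto simp: disjoint_family_on_def)
      moreover have "(\<Union>i. B \<inter> A i) = B" using B by auto
      ultimately have "(\<lambda>i. \<mu> (B \<inter> A i)) sums \<mu> B" using \<mu> unfolding vector_borel_measure_def by metis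
      then have "(\<lambda>n. ennreal (\<Sum>i<n. \<mu> (B \<inter> A i))) \<longlonglongrightarrow> ennreal (\<mu> B)"
        unfolding sums_def by (rule tendsto_ennrealI)
      moreover have "ennreal (\<Sum>i<n. \<mu> (B \<inter> A i)) \<le> (\<Sum>i. P (A i))" for n
      proof -
        have "ennreal (\<Sum>i<n. \<mu> (B \<inter> A i)) \<le> (\<Sum>i<n. ennreal (\<mu> (B \<inter> A i)))"
        proof (induction n)
          case (Suc n)
          have "ennreal (a + b) \<le> ennreal a + ennreal b" for a b
            unfolding ennreal_plus_if by (simp del: ennreal_plus add: ennreal_leI)
          from this[of "\<Sum>i<n. \<mu> (B \<inter> A i)" "\<mu> (B \<inter> A n)"] Suc show ?case
            by (auto intro: order_trans add_right_mono)
        qed simp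
        also have "\<dots> \<le> (\<Sum>i<n. P (A i))" using A B by (intro sum_mono P_ge) auto
        also have "\<dots> \<le> (\<Sum>i. P (A i))" by (intro sum_le_suminf) auto
        finally show ?thesis .
      qed
      ultimately show ?thesis by (intro LIMSEQ_le_const2) auto
    qed
    then have "P (\<Union>i. A i) \<le> (\<Sum>i. P (A i))" unfolding P_def[of "\<Union>i. A i"] by (intro SUP_least) auto
    with le show "(\<Sum>i. P (A i)) = P (\<Union> (range A))" by (rule antisym)
  qed
  have "{B \<in> borel_sets_of \<Gamma>. B \<subseteq> {}} = {{}}" by auto
  then have "P {} = 0" unfolding P_def using \<mu> by (simp add: vector_borel_measure_def)
  then have pos: "positive (borel_sets_of \<Gamma>) P" by (simp add: positive_def)
  have "pos_part \<Gamma> \<mu> = measure_of \<Gamma> (borel_sets_of \<Gamma>) P"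
    unfolding pos_part_def P_def[abs_def] ..
  then have "emeasure (pos_part \<Gamma> \<mu>) A = P A"
    using emeasure_measure_of_sigma[OF sigma_algebra_borel_sets pos ca A] by simp
  then show ?thesis by (simp add: P_def)
qed

lemma finite_measure_pos_part:
  assumes "bounded_signed \<Gamma> \<mu>" shows "finite_measure (pos_part \<Gamma> \<mu>)"
proof
  obtain B where B: "\<And>A. A \<in> borel_sets_of \<Gamma> \<Longrightarrow> \<bar>\<mu> A\<bar> \<le> B" using assms by (auto simp: bounded_signed_def)
  have "\<Gamma> \<in> borel_sets_of \<Gamma>" by (rule carrier_in_borel_sets)
  then have "emeasure (pos_part \<Gamma> \<mu>) \<Gamma> \<le> ennreal B"
    using assms B by (subst emeasure_pos_part) (auto simp: bounded_signed_def abs_le_iff intro!: SUP_least ennreal_leI)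
  then show "emeasure (pos_part \<Gamma> \<mu>) (space (pos_part \<Gamma> \<mu>)) \<noteq> \<infinity>"
    by (auto simp: top_unique)
qed

text \<open>If \<open>B \<subseteq> A\<close> has large measure, then \<open>A - B\<close> is a competitor for the negative part. The
reverse inequality is this one for \<open>- \<mu>\<close>.\<close>

lemma measure_pos_part_le:
  assumes \<mu>: "bounded_signed \<Gamma> \<mu>" and A: "A \<in> borel_sets_of \<Gamma>"
  shows "measure (pos_part \<Gamma> \<mu>) A \<le> \<mu> A + measure (pos_part \<Gamma> (\<lambda>A. - \<mu> A)) A"
proof -
  let ?N = "pos_part \<Gamma> (\<lambda>A. - \<mu> A)"
  interpret P: finite_measure "pos_part \<Gamma> \<mu>" by (rule finite_measure_pos_part[OF \<mu>])
  interpret N: finite_measure ?N by (rule finite_measure_pos_part[OF bounded_signed_uminus[OF \<mu>]])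
  have N_ge: "- \<mu> B \<le> measure ?N A" if "B \<in> borel_sets_of \<Gamma>" "B \<subseteq> A" for B
  proof -
    have "ennreal (- \<mu> B) \<le> emeasure ?N A"
      using \<mu> that A by (subst emeasure_pos_part)
        (auto simp: bounded_signed_def intro!: vector_borel_measure_uminus SUP_upper)
    then show ?thesis by (simp add: N.emeasure_eq_measure ennreal_le_iff)
  qed
  have "ennreal (\<mu> B) \<le> ennreal (\<mu> A + measure ?N A)" if B: "B \<in> borel_sets_of \<Gamma>" "B \<subseteq> A" for B
  proof -
    have "\<mu> (B \<union> (A - B)) = \<mu> B + \<mu> (A - B)"
      using \<mu> B A by (intro vector_borel_measure_Un) (auto simp: bounded_signed_def)
    moreover have "B \<union> (A - B) = A" using B by auto
    ultimately show ?thesis using N_ge[of "A - B"] A B by (intro ennreal_leI) auto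
  qed
  then have "emeasure (pos_part \<Gamma> \<mu>) A \<le> ennreal (\<mu> A + measure ?N A)"
    using \<mu> A by (subst emeasure_pos_part) (auto simp: bounded_signed_def intro!: SUP_least)
  then show ?thesis using N_ge[OF A order_refl] by (simp add: P.emeasure_eq_measure)
qed

lemma jordan_decomposition:
  assumes "bounded_signed \<Gamma> \<mu>" "A \<in> borel_sets_of \<Gamma>"
  shows "\<mu> A = measure (pos_part \<Gamma> \<mu>) A - measure (pos_part \<Gamma> (\<lambda>A. - \<mu> A)) A"
  using measure_pos_part_le[OF assms] measure_pos_part_le[OF bounded_signed_uminus[OF assms(1)] assms(2)]
  by simp

definition real_integral :: "'a::metric_space set \<Rightarrow> ('a set \<Rightarrow> real) \<Rightarrow> ('a \<Rightarrow> real) \<Rightarrow> real" where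
  "real_integral \<Gamma> \<mu> f = integral\<^sup>L (pos_part \<Gamma> \<mu>) f - integral\<^sup>L (pos_part \<Gamma> (\<lambda>A. - \<mu> A)) f"

lemma signed_integral_of_real:
  "signed_integral \<Gamma> \<mu> (\<lambda>x. of_real (f x)) = of_real (real_integral \<Gamma> \<mu> f)"
  by (simp add: signed_integral_def real_integral_def)

lemma signed_integral_cong:
  "(\<And>x. x \<in> \<Gamma> \<Longrightarrow> f x = g x) \<Longrightarrow> signed_integral \<Gamma> \<mu> f = signed_integral \<Gamma> \<mu> g"
  unfolding signed_integral_def
  by (intro arg_cong2[of _ _ _ _ "(-)"] Bochner_Integration.integral_cong refl) simp_all

lemma real_integral_cong:
  "(\<And>x. x \<in> \<Gamma> \<Longrightarrow> f x = g x) \<Longrightarrow> real_integral \<Gamma> \<mu> f = real_integral \<Gamma> \<mu> g"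
  unfolding real_integral_def
  by (intro arg_cong2[of _ _ _ _ "(-)"] Bochner_Integration.integral_cong refl) simp_all

lemma signed_integral_zero_measure: "signed_integral \<Gamma> (\<lambda>_. 0) f = 0"
  by (simp add: signed_integral_def)

lemma bounded_borel_integrable_pos_part:
  assumes "bounded_signed \<Gamma> \<mu>" "bounded_borel \<Gamma> f"
  shows "integrable (pos_part \<Gamma> \<mu>) f" "integrable (pos_part \<Gamma> (\<lambda>A. - \<mu> A)) f"
  using assms bounded_borel_integrable finite_measure_pos_part bounded_signed_uminus sets_pos_part by blast+

lemma real_integral_add:
  assumes "bounded_signed \<Gamma> \<mu>" "bounded_borel \<Gamma> f" "bounded_borel \<Gamma> g"
  shows "real_integral \<Gamma> \<mu> (\<lambda>x. f x + g x) = real_integral \<Gamma> \<mu> f + real_integral \<Gamma> \<mu> g"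
  using assms by (simp add: real_integral_def bounded_borel_integrable_pos_part)

lemma real_integral_diff:
  assumes "bounded_signed \<Gamma> \<mu>" "bounded_borel \<Gamma> f" "bounded_borel \<Gamma> g"
  shows "real_integral \<Gamma> \<mu> (\<lambda>x. f x - g x) = real_integral \<Gamma> \<mu> f - real_integral \<Gamma> \<mu> g"
  using assms by (simp add: real_integral_def bounded_borel_integrable_pos_part)

lemma real_integral_cmult:
  "real_integral \<Gamma> \<mu> (\<lambda>x. c * f x) = c * real_integral \<Gamma> \<mu> f"
  by (simp add: real_integral_def right_diff_distrib)

lemma real_integral_sum:
  assumes "bounded_signed \<Gamma> \<mu>" "\<And>i. i \<in> I \<Longrightarrow> bounded_borel \<Gamma> (f i)"
  shows "real_integral \<Gamma> \<mu> (\<lambda>x. \<Sum>i\<in>I. f i x) = (\<Sum>i\<in>I. real_integral \<Gamma> \<mu> (f i))"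
  using assms by (simp add: real_integral_def bounded_borel_integrable_pos_part sum_subtractf)

lemma real_integral_const:
  assumes "bounded_signed \<Gamma> \<mu>"
  shows "real_integral \<Gamma> \<mu> (\<lambda>_. c) = c * \<mu> \<Gamma>"
proof -
  have "\<Gamma> \<in> borel_sets_of \<Gamma>" by (rule carrier_in_borel_sets)
  from jordan_decomposition[OF assms this] show ?thesis
    by (simp add: real_integral_def right_diff_distrib mult.commute)
qed

lemma real_integral_measure:
  assumes "finite_measure M" "sets M = borel_sets_of \<Gamma>" "bounded_borel \<Gamma> f"
  shows "real_integral \<Gamma> (measure M) f = integral\<^sup>L M f"
proof -
  let ?P = "pos_part \<Gamma> (measure M)" and ?N = "pos_part \<Gamma> (\<lambda>A. - measure M A)"
  have b: "bounded_signed \<Gamma> (measure M)" using assms(1,2) by (rule finite_measure_bounded_signed)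
  have "(\<Sum>(c, M)\<leftarrow>[(1, ?P), (-1, ?N), (-1, M)]. c * integral\<^sup>L M f) = 0"
  proof (rule integral_linear_in_measure)
    fix A assume "A \<in> borel_sets_of \<Gamma>"
    from jordan_decomposition[OF b this]
    show "(\<Sum>(c, M)\<leftarrow>[(1, ?P), (-1, ?N), (-1, M)]. c * measure M A) = 0" by simp
  next
    fix c :: real and M' assume "(c, M') \<in> set [(1, ?P), (-1, ?N), (-1, M)]"
    then have "M' = ?P \<or> M' = ?N \<or> M' = M" by auto
    then show "finite_measure M' \<and> sets M' = borel_sets_of \<Gamma>"
      by (elim disjE)
         (simp_all add: finite_measure_pos_part[OF b] finite_measure_pos_part[OF bounded_signed_uminus[OF b]] assms(1,2))
  qed (rule assms(3))
  then show ?thesis by (simp add: real_integral_def)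
qed

text \<open>The positive part of a difference is not the difference of the positive parts, but the Jordan
decompositions of the three measures satisfy one linear relation.\<close>

lemma real_integral_measure_diff:
  assumes "bounded_signed \<Gamma> \<mu>" "bounded_signed \<Gamma> \<nu>" "bounded_borel \<Gamma> f"
  shows "real_integral \<Gamma> (\<lambda>A. \<mu> A - \<nu> A) f = real_integral \<Gamma> \<mu> f - real_integral \<Gamma> \<nu> f"
proof -
  let ?P = "\<lambda>\<mu>. pos_part \<Gamma> \<mu>" and ?N = "\<lambda>\<mu>. pos_part \<Gamma> (\<lambda>A. - \<mu> A)"
  let ?d = "\<lambda>A. \<mu> A - \<nu> A"
  let ?L = "[(1, ?P ?d), (-1, ?N ?d), (-1, ?P \<mu>), (1, ?N \<mu>), (1, ?P \<nu>), (-1, ?N \<nu>)]"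
  have b: "bounded_signed \<Gamma> ?d" using assms(1,2) by (rule bounded_signed_diff)
  have "(\<Sum>(c, M)\<leftarrow>?L. c * integral\<^sup>L M f) = 0"
  proof (rule integral_linear_in_measure)
    fix A assume "A \<in> borel_sets_of \<Gamma>"
    from jordan_decomposition[OF b this] jordan_decomposition[OF assms(1) this] jordan_decomposition[OF assms(2) this]
    show "(\<Sum>(c, M)\<leftarrow>?L. c * measure M A) = 0" by simp
  next
    fix c :: real and M assume "(c, M) \<in> set ?L"
    then have "M = ?P ?d \<or> M = ?N ?d \<or> M = ?P \<mu> \<or> M = ?N \<mu> \<or> M = ?P \<nu> \<or> M = ?N \<nu>" by auto
    then show "finite_measure M \<and> sets M = borel_sets_of \<Gamma>"
      using finite_measure_pos_part[OF b] finite_measure_pos_part[OF bounded_signed_uminus[OF b]]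
        finite_measure_pos_part[OF assms(1)] finite_measure_pos_part[OF bounded_signed_uminus[OF assms(1)]]
        finite_measure_pos_part[OF assms(2)] finite_measure_pos_part[OF bounded_signed_uminus[OF assms(2)]]
      by (elim disjE) (simp_all only: sets_pos_part)
  qed (rule assms(3))
  then show ?thesis by (simp add: real_integral_def)
qed

lemma real_integral_Fubini:
  assumes \<mu>: "bounded_signed \<Gamma> \<mu>" and D: "finite_measure D"
    and meas: "case_prod \<phi> \<in> borel_measurable (D \<Otimes>\<^sub>M borel_on \<Gamma>)"
    and bound: "\<And>u x. u \<in> space D \<Longrightarrow> x \<in> \<Gamma> \<Longrightarrow> \<bar>\<phi> u x\<bar> \<le> B"
  shows "real_integral \<Gamma> \<mu> (\<lambda>x. \<integral>u. \<phi> u x \<partial>D) = (\<integral>u. real_integral \<Gamma> \<mu> (\<phi> u) \<partial>D)"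
    and "integrable D (\<lambda>u. real_integral \<Gamma> \<mu> (\<phi> u))"
    and "bounded_borel \<Gamma> (\<lambda>x. \<integral>u. \<phi> u x \<partial>D)"
proof -
  interpret D: finite_measure D by fact
  have *: "(\<integral>x. (\<integral>u. \<phi> u x \<partial>D) \<partial>M) = (\<integral>u. (\<integral>x. \<phi> u x \<partial>M) \<partial>D) \<and> integrable D (\<lambda>u. \<integral>x. \<phi> u x \<partial>M)"
    if M: "finite_measure M" "sets M = borel_sets_of \<Gamma>" for M
  proof -
    interpret M: finite_measure M by fact
    interpret pair_sigma_finite D M ..
    have sp: "space M = \<Gamma>" using M(2) by (rule space_eq_of_sets)
    have "finite_measure (D \<Otimes>\<^sub>M M)" by (rule finite_measure_pair_measure) (use D M in auto)
    moreover have "case_prod \<phi> \<in> borel_measurable (D \<Otimes>\<^sub>M M)"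
      using meas by (simp add: M(2) cong: measurable_cong_sets sets_pair_measure_cong)
    ultimately have int: "integrable (D \<Otimes>\<^sub>M M) (case_prod \<phi>)"
      by (intro finite_measure.integrable_const_bound[where B = B]) (auto simp: space_pair_measure sp intro!: bound)
    from Fubini_integral[OF this] integrable_fst[OF int] show ?thesis by simp
  qed
  note P = *[OF finite_measure_pos_part[OF \<mu>] sets_pos_part]
  note N = *[OF finite_measure_pos_part[OF bounded_signed_uminus[OF \<mu>]] sets_pos_part]
  show "real_integral \<Gamma> \<mu> (\<lambda>x. \<integral>u. \<phi> u x \<partial>D) = (\<integral>u. real_integral \<Gamma> \<mu> (\<phi> u) \<partial>D)"
    and "integrable D (\<lambda>u. real_integral \<Gamma> \<mu> (\<phi> u))"
    using P N by (simp_all add: real_integral_def)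
  have sw: "(\<lambda>(x, u). \<phi> u x) \<in> borel_measurable (borel_on \<Gamma> \<Otimes>\<^sub>M D)"
    using measurable_compose[OF measurable_pair_swap' meas] by (simp add: case_prod_unfold)
  have "\<bar>\<integral>u. \<phi> u x \<partial>D\<bar> \<le> B * measure D (space D)" if x: "x \<in> \<Gamma>" for x
  proof -
    have "(\<lambda>u. \<phi> u x) \<in> borel_measurable D"
      using measurable_compose_Pair1[OF _ sw, of x] x by (simp add: space_restrict_space)
    then have "integrable D (\<lambda>u. \<phi> u x)"
      by (rule D.integrable_const_bound[rotated]) (auto intro!: bound x)
    then have "norm (\<integral>u. \<phi> u x \<partial>D) \<le> (\<integral>u. norm (\<phi> u x) \<partial>D)" by (intro integral_norm_bound)
    also have "\<dots> \<le> (\<integral>u. B \<partial>D)"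
      using \<open>integrable D (\<lambda>u. \<phi> u x)\<close> by (intro integral_mono) (auto intro!: bound x)
    finally show ?thesis by (simp add: mult.commute)
  qed
  moreover have "(\<lambda>x. \<integral>u. \<phi> u x \<partial>D) \<in> borel_measurable (borel_on \<Gamma>)"
    using D.borel_measurable_lebesgue_integral[OF sw] .
  ultimately show "bounded_borel \<Gamma> (\<lambda>x. \<integral>u. \<phi> u x \<partial>D)"
    unfolding bounded_borel_def by blast
qed

section \<open>Star neighborhoods and the maximum principle\<close>

lemma dist_le_path_dist: "ennreal (dist x y) \<le> path_dist S x y"
  unfolding path_dist_def
proof (rule INF_greatest)
  fix g :: "real \<Rightarrow> 'a"
  assume g: "g \<in> {g. path g \<and> path_image g \<subseteq> S \<and> pathstart g = x \<and> pathfinish g = y}"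
  define t where "t = (\<lambda>i::nat. if i = 0 then 0 else 1 :: real)"
  have "(1, t) \<in> {(m :: nat, t :: nat \<Rightarrow> real). mono t \<and> range t \<subseteq> {0..1}}"
    by (auto simp: t_def mono_def)
  then have "ennreal (\<Sum>i<1. dist (g (t i)) (g (t (Suc i)))) \<le> curve_length g"
    unfolding curve_length_def by (intro SUP_upper2[of "(1, t)"]) auto
  then show "ennreal (dist x y) \<le> curve_length g"
    using g by (simp add: t_def pathstart_def pathfinish_def)
qed

lemma curve_length_linepath_le:
  fixes x y :: "'a::real_normed_vector"
  shows "curve_length (linepath x y) \<le> ennreal (dist x y)"
  unfolding curve_length_def
proof (rule SUP_least, clarify)
  fix m :: nat and t :: "nat \<Rightarrow> real"
  assume t: "mono t" "range t \<subseteq> {0..1}"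
  have *: "dist (linepath x y a) (linepath x y b) = (b - a) * dist x y" if "a \<le> b" for a b
  proof -
    have "linepath x y a - linepath x y b = (b - a) *\<^sub>R (x - y)"
      by (simp add: linepath_def algebra_simps)
    then show ?thesis using that by (simp add: dist_norm)
  qed
  have "(\<Sum>i<m. dist (linepath x y (t i)) (linepath x y (t (Suc i)))) = (\<Sum>i<m. t (Suc i) - t i) * dist x y"
    using t(1) by (simp add: * mono_def sum_distrib_right)
  also have "\<dots> = (t m - t 0) * dist x y" by (simp add: sum_lessThan_telescope)
  also have "\<dots> \<le> 1 * dist x y"
    using t(2) by (intro mult_right_mono) (auto simp: subset_iff image_iff intro: diff_le_eq[THEN iffD2] add_increasing2)
  finally show "ennreal (\<Sum>i<m. dist (linepath x y (t i)) (linepath x y (t (Suc i)))) \<le> ennreal (dist x y)"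
    by (intro ennreal_leI) simp
qed

lemma star_set_ray: "0 \<le> t \<Longrightarrow> t < r \<Longrightarrow> of_real t * cis (2 * pi * of_int k / of_nat n) \<in> star_set r n"
  unfolding star_set_def by blast

text \<open>The straight segment between two points of a ray stays in the ray, and no path is shorter.\<close>

lemma path_dist_star_ray:
  fixes k :: int and n :: nat
  defines "v \<equiv> cis (2 * pi * of_int k / of_nat n)"
  assumes "0 \<le> s" "s < r" "0 \<le> t" "t < r"
  shows "path_dist (star_set r n) (of_real s * v) (of_real t * v) = ennreal \<bar>s - t\<bar>"
proof -
  have d: "dist (of_real s * v) (of_real t * v) = \<bar>s - t\<bar>"
    unfolding dist_norm left_diff_distrib[symmetric] norm_mult v_def
    by (simp flip: of_real_diff)
  have "path_image (linepath (of_real s * v) (of_real t * v)) \<subseteq> star_set r n"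
  proof
    fix z assume "z \<in> path_image (linepath (of_real s * v) (of_real t * v))"
    then obtain u where u: "0 \<le> u" "u \<le> 1" "z = linepath (of_real s * v) (of_real t * v) u"
      by (auto simp: path_image_def)
    have "z = of_real ((1 - u) * s + u * t) * v"
      unfolding u(3) linepath_def by (simp add: scaleR_conv_of_real algebra_simps)
    moreover have "(1 - u) * s + u * t < r"
      using convex_bound_lt[of s r t "1 - u" u] assms u by simp
    moreover have "0 \<le> (1 - u) * s + u * t" using u assms by simp
    ultimately show "z \<in> star_set r n" unfolding v_def by (simp only: star_set_ray)
  qed
  then have "path_dist (star_set r n) (of_real s * v) (of_real t * v)
      \<le> curve_length (linepath (of_real s * v) (of_real t * v))"
    unfolding path_dist_def by (intro INF_lower) auto
  also have "\<dots> \<le> ennreal \<bar>s - t\<bar>" using curve_length_linepath_le d by metis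
  finally show ?thesis using dist_le_path_dist[of "of_real s * v" "of_real t * v"] d by (metis antisym)
qed

text \<open>The properties of the chosen chart on which everything below rests. Points at distance less than
\<open>R\<close> lie on the rays, at the parameter given by their distance from \<open>p\<close>; a chart need not cover
a ball of its own radius, so \<open>R\<close> can be smaller than that radius. The estimate from below by the
distance in the complex plane keeps different rays apart.\<close>

definition star_neighborhood :: "'a::metric_space set \<Rightarrow> 'a \<Rightarrow> real \<Rightarrow> bool" where
  "star_neighborhood \<Gamma> p R \<longleftrightarrow> 0 < R \<and>
     (\<forall>v\<in>Vec \<Gamma> p. move \<Gamma> p v 0 = p) \<and>
     (\<forall>v\<in>Vec \<Gamma> p. \<forall>t. 0 \<le> t \<and> t < R \<longrightarrow> move \<Gamma> p v t \<in> \<Gamma>) \<and>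
     (\<forall>v\<in>Vec \<Gamma> p. \<forall>s t. 0 \<le> s \<and> s < R \<and> 0 \<le> t \<and> t < R \<longrightarrow>
        dist (move \<Gamma> p v s) (move \<Gamma> p v t) = \<bar>s - t\<bar>) \<and>
     (\<forall>v\<in>Vec \<Gamma> p. \<forall>w\<in>Vec \<Gamma> p. \<forall>s t. 0 \<le> s \<and> s < R \<and> 0 \<le> t \<and> t < R \<longrightarrow>
        cmod (of_real s * v - of_real t * w) \<le> dist (move \<Gamma> p v s) (move \<Gamma> p w t)) \<and>
     (\<forall>x\<in>\<Gamma>. dist p x < R \<longrightarrow> (\<exists>v\<in>Vec \<Gamma> p. x = move \<Gamma> p v (dist p x)))"

lemma norm_Vec: "v \<in> Vec \<Gamma> p \<Longrightarrow> norm v = 1"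
  by (auto simp: Vec_def)

lemma star_neighborhood_exists:
  assumes \<Gamma>: "metrized_graph \<Gamma>" and p: "p \<in> \<Gamma>"
  shows "finite (Vec \<Gamma> p)" and "\<exists>R. star_neighborhood \<Gamma> p R"
proof -
  obtain r n \<phi> where ch: "chosen_chart \<Gamma> p = (r, n, \<phi>)" by (cases "chosen_chart \<Gamma> p") auto
  obtain r' n' \<phi>' where "star_chart \<Gamma> p r' n' \<phi>'"
    using \<Gamma> p unfolding metrized_graph_def by blast
  then have "(\<lambda>(r, n, \<phi>). star_chart \<Gamma> p r n \<phi>) (r', n', \<phi>')" by simp
  then have "(\<lambda>(r, n, \<phi>). star_chart \<Gamma> p r n \<phi>) (chosen_chart \<Gamma> p)"
    unfolding chosen_chart_def by (rule someI)
  then have star: "star_chart \<Gamma> p r n \<phi>" by (simp add: ch)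
  have vn: "Vec \<Gamma> p = {cis (2 * pi * of_int k / of_nat n) | k. True}"
    and mv: "move \<Gamma> p v t = \<phi> (of_real t * v)" for v t
    by (simp_all add: Vec_def valence_def move_def ch)
  have n: "n \<ge> 1" and r: "r > 0" and p0: "\<phi> 0 = p" and into: "\<phi> ` star_set r n \<subseteq> \<Gamma>"
    and dd: "\<And>z w. z \<in> star_set r n \<Longrightarrow> w \<in> star_set r n \<Longrightarrow>
      ennreal (dist (\<phi> z) (\<phi> w)) = path_dist (star_set r n) z w"
    using star unfolding star_chart_def by blast+
  obtain U where U: "open U" "p \<in> U" "\<Gamma> \<inter> U \<subseteq> \<phi> ` star_set r n"
    using star unfolding star_chart_def by blast
  have "z ^ n = 1" if z: "z \<in> Vec \<Gamma> p" for z
  proof -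
    obtain k :: int where k: "z = cis (2 * pi * of_int k / of_nat n)" using z vn by auto
    have "z ^ n = cis (of_nat n * (2 * pi * of_int k / of_nat n))" unfolding k by (rule Complex.DeMoivre)
    also have "of_nat n * (2 * pi * of_int k / of_nat n) = 2 * pi * of_int k" using n by simp
    finally show ?thesis by (simp add: cis_multiple_2pi)
  qed
  then have "Vec \<Gamma> p \<subseteq> {z. z ^ n = 1}" by auto
  then show "finite (Vec \<Gamma> p)" using finite_roots_unity[OF n] finite_subset by blast
  obtain d where d: "d > 0" "ball p d \<subseteq> U" using U open_contains_ball by blast
  define R where "R = min r d"
  have ray: "of_real t * v \<in> star_set r n" if "v \<in> Vec \<Gamma> p" "0 \<le> t" "t < R" for v t
    using that unfolding vn by (auto simp: R_def intro!: star_set_ray)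
  have drr: "dist (\<phi> (of_real s * v)) (\<phi> (of_real t * v)) = \<bar>s - t\<bar>"
    if v: "v \<in> Vec \<Gamma> p" and st: "0 \<le> s" "s < r" "0 \<le> t" "t < r" for v s t
  proof -
    obtain k :: int where k: "v = cis (2 * pi * of_int k / of_nat n)" using v vn by auto
    show ?thesis
      using dd[of "of_real s * v" "of_real t * v"] path_dist_star_ray[of s r t n k] st
        star_set_ray[of _ r k n] unfolding k by (simp add: ennreal_inj)
  qed
  have "\<exists>v\<in>Vec \<Gamma> p. x = \<phi> (of_real (dist p x) * v)" if x: "x \<in> \<Gamma>" "dist p x < R" for x
  proof -
    have "x \<in> \<Gamma> \<inter> U" using x d by (auto simp: R_def)
    then obtain z where z: "z \<in> star_set r n" "x = \<phi> z" using U by auto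
    then obtain t k where t: "0 \<le> t" "t < r" "z = of_real t * cis (2 * pi * of_int k / of_nat n)"
      unfolding star_set_def by auto
    let ?v = "cis (2 * pi * of_int k / of_nat n)"
    have v: "?v \<in> Vec \<Gamma> p" unfolding vn by blast
    have "dist p x = t" using drr[OF v, of 0 t] t z p0 r by simp
    then show ?thesis using v z t by blast
  qed
  moreover have "cmod (z - w) \<le> dist (\<phi> z) (\<phi> w)" if "z \<in> star_set r n" "w \<in> star_set r n" for z w
    using dist_le_path_dist[of z w "star_set r n"] unfolding dd[OF that, symmetric] by (simp add: dist_norm)
  moreover have "R > 0" using r d by (simp add: R_def)
  ultimately have "star_neighborhood \<Gamma> p R"
    unfolding star_neighborhood_def mv using p0 into drr ray
    by (auto simp: R_def)
  then show "\<exists>R. star_neighborhood \<Gamma> p R" ..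
qed

lemma star_neighborhood_smaller:
  assumes "star_neighborhood \<Gamma> p R" "0 < r" "r \<le> R"
  shows "star_neighborhood \<Gamma> p r"
  using assms unfolding star_neighborhood_def by (meson order.strict_trans2)

lemma star_neighborhoodD:
  assumes "star_neighborhood \<Gamma> p R"
  shows "0 < R" "v \<in> Vec \<Gamma> p \<Longrightarrow> move \<Gamma> p v 0 = p"
    "v \<in> Vec \<Gamma> p \<Longrightarrow> 0 \<le> t \<Longrightarrow> t < R \<Longrightarrow> move \<Gamma> p v t \<in> \<Gamma>"
    "v \<in> Vec \<Gamma> p \<Longrightarrow> 0 \<le> s \<Longrightarrow> s < R \<Longrightarrow> 0 \<le> t \<Longrightarrow> t < R \<Longrightarrow>
       dist (move \<Gamma> p v s) (move \<Gamma> p v t) = \<bar>s - t\<bar>"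
    "v \<in> Vec \<Gamma> p \<Longrightarrow> w \<in> Vec \<Gamma> p \<Longrightarrow> 0 \<le> s \<Longrightarrow> s < R \<Longrightarrow> 0 \<le> t \<Longrightarrow> t < R \<Longrightarrow>
       cmod (of_real s * v - of_real t * w) \<le> dist (move \<Gamma> p v s) (move \<Gamma> p w t)"
    "x \<in> \<Gamma> \<Longrightarrow> dist p x < R \<Longrightarrow> \<exists>v\<in>Vec \<Gamma> p. x = move \<Gamma> p v (dist p x)"
  using assms unfolding star_neighborhood_def by blast+

lemma dist_move:
  assumes "star_neighborhood \<Gamma> p R" "v \<in> Vec \<Gamma> p" "0 \<le> t" "t < R"
  shows "dist p (move \<Gamma> p v t) = t"
  using star_neighborhoodD(4)[OF assms(1,2), of 0 t] star_neighborhoodD(1,2)[OF assms(1)] assms by simp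

text \<open>Directions at \<open>p\<close> correspond to the points of a small sphere around \<open>p\<close>. A sum over directions
thereby becomes a sum in which the chosen chart no longer occurs, and which can be computed in
any other parametrization.\<close>

lemma bij_betw_Vec_sphere:
  assumes s: "star_neighborhood \<Gamma> p R" and \<epsilon>: "0 < \<epsilon>" "\<epsilon> < R"
  shows "bij_betw (\<lambda>v. move \<Gamma> p v \<epsilon>) (Vec \<Gamma> p) {x \<in> \<Gamma>. dist p x = \<epsilon>}"
proof (rule bij_betw_imageI)
  show "inj_on (\<lambda>v. move \<Gamma> p v \<epsilon>) (Vec \<Gamma> p)"
  proof (rule inj_onI)
    fix v w assume vw: "v \<in> Vec \<Gamma> p" "w \<in> Vec \<Gamma> p" "move \<Gamma> p v \<epsilon> = move \<Gamma> p w \<epsilon>"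
    then have "of_real \<epsilon> * v - of_real \<epsilon> * w = 0"
      using star_neighborhoodD(5)[OF s vw(1,2), of \<epsilon> \<epsilon>] \<epsilon> by simp
    then show "v = w" using \<epsilon> by simp
  qed
  show "(\<lambda>v. move \<Gamma> p v \<epsilon>) ` Vec \<Gamma> p = {x \<in> \<Gamma>. dist p x = \<epsilon>}"
    using star_neighborhoodD(6)[OF s] \<epsilon> by (auto simp: dist_move[OF s] intro!: star_neighborhoodD(3)[OF s])
qed

lemma dir_deriv_affine:
  assumes "0 < r" "\<And>t. 0 < t \<Longrightarrow> t < r \<Longrightarrow> f (move \<Gamma> p v t) = f p + \<beta> * of_real t"
  shows "dir_deriv \<Gamma> f p v = \<beta>"
  unfolding dir_deriv_def
proof (rule tendsto_Lim)
  have "\<forall>\<^sub>F t in at_right 0. (f (move \<Gamma> p v t) - f p) / of_real t = \<beta>"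
    using assms by (auto simp: eventually_at_right[of 0 1] intro!: exI[of _ "r"])
  then show "((\<lambda>t. (f (move \<Gamma> p v t) - f p) / of_real t) \<longlongrightarrow> \<beta>) (at_right 0)"
    by (simp add: tendsto_eventually)
qed simp

lemma slope_sum_sphere:
  assumes s: "star_neighborhood \<Gamma> p R"
    and aff: "\<And>v. v \<in> Vec \<Gamma> p \<Longrightarrow> \<exists>\<beta>. \<forall>t. 0 \<le> t \<and> t < R \<longrightarrow> f (move \<Gamma> p v t) = f p + \<beta> * of_real t"
    and \<epsilon>: "0 < \<epsilon>" "\<epsilon> < R"
  shows "slope_sum \<Gamma> f p = (\<Sum>x\<in>{x \<in> \<Gamma>. dist p x = \<epsilon>}. (f x - f p) / of_real \<epsilon>)"
proof -
  have "dir_deriv \<Gamma> f p v = (f (move \<Gamma> p v \<epsilon>) - f p) / of_real \<epsilon>" if v: "v \<in> Vec \<Gamma> p" for v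
  proof -
    obtain \<beta> where \<beta>: "\<And>t. 0 \<le> t \<Longrightarrow> t < R \<Longrightarrow> f (move \<Gamma> p v t) = f p + \<beta> * of_real t"
      using aff[OF v] by auto
    then have "dir_deriv \<Gamma> f p v = \<beta>" 
      using star_neighborhoodD(1)[OF s] by (intro dir_deriv_affine[of R]) auto
    then show ?thesis using \<beta>[of \<epsilon>] \<epsilon> by simp
  qed
  then have "slope_sum \<Gamma> f p = (\<Sum>v\<in>Vec \<Gamma> p. (f (move \<Gamma> p v \<epsilon>) - f p) / of_real \<epsilon>)"
    unfolding slope_sum_def by simp
  also have "\<dots> = (\<Sum>x\<in>{x \<in> \<Gamma>. dist p x = \<epsilon>}. (f x - f p) / of_real \<epsilon>)"
    by (rule sum.reindex_bij_betw[OF bij_betw_Vec_sphere[OF s \<epsilon>]])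
  finally show ?thesis .
qed

text \<open>The break points other than \<open>p\<close> itself have positive distance from \<open>p\<close>.\<close>

lemma CPA_affine_near:
  assumes \<Gamma>: "metrized_graph \<Gamma>" and p: "p \<in> \<Gamma>" and f: "f \<in> CPA \<Gamma>"
  obtains R where "star_neighborhood \<Gamma> p R"
    "\<And>v. v \<in> Vec \<Gamma> p \<Longrightarrow> \<exists>\<beta>. \<forall>t. 0 \<le> t \<and> t < R \<longrightarrow> f (move \<Gamma> p v t) = f p + \<beta> * of_real t"
proof -
  obtain X where X: "finite X" "\<And>a b \<gamma>. segment_in \<Gamma> a b \<gamma> \<Longrightarrow> \<gamma> ` {a<..<b} \<inter> X = {} \<Longrightarrow>
           \<exists>\<alpha> \<beta>. \<forall>t \<in> {a..b}. f (\<gamma> t) = \<alpha> + \<beta> * of_real t"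
    using f unfolding CPA_def by blast
  obtain R0 where R0: "star_neighborhood \<Gamma> p R0" using star_neighborhood_exists(2)[OF \<Gamma> p] ..
  obtain d where d: "d > 0" "\<And>x. x \<in> X \<Longrightarrow> x \<noteq> p \<Longrightarrow> d \<le> dist p x" using finite_set_avoid[OF X(1)] by metis
  define R where "R = min (R0 / 2) d"
  have pos: "R > 0" "R < R0" using d star_neighborhoodD(1)[OF R0] by (auto simp: R_def)
  have s: "star_neighborhood \<Gamma> p R" using star_neighborhood_smaller[OF R0] pos by simp
  have "\<exists>\<beta>. \<forall>t. 0 \<le> t \<and> t < R \<longrightarrow> f (move \<Gamma> p v t) = f p + \<beta> * of_real t" if v: "v \<in> Vec \<Gamma> p" for v
  proof -
    have "segment_in \<Gamma> 0 R (move \<Gamma> p v)"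
      unfolding segment_in_def using pos star_neighborhoodD(3,4)[OF R0 v] by auto
    moreover have "move \<Gamma> p v ` {0<..<R} \<inter> X = {}"
    proof -
      have "move \<Gamma> p v t \<notin> X" if t: "0 < t" "t < R" for t
      proof
        assume "move \<Gamma> p v t \<in> X"
        moreover have "dist p (move \<Gamma> p v t) = t" using dist_move[OF s v] t by simp
        moreover from this have "move \<Gamma> p v t \<noteq> p" using t by auto
        ultimately show False using d(2)[of "move \<Gamma> p v t"] t by (auto simp: R_def)
      qed
      then show ?thesis by auto
    qed
    ultimately obtain \<alpha> \<beta> where *: "\<And>t. t \<in> {0..R} \<Longrightarrow> f (move \<Gamma> p v t) = \<alpha> + \<beta> * of_real t"
      using X(2) by metis
    then have "\<alpha> = f p" using *[of 0] star_neighborhoodD(2)[OF s v] pos by simp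
    then show ?thesis using * by auto
  qed
  with s that show ?thesis by blast
qed

lemma slope_sum_lincomb:
  assumes \<Gamma>: "metrized_graph \<Gamma>" and p: "p \<in> \<Gamma>" and f: "f \<in> CPA \<Gamma>" and g: "g \<in> CPA \<Gamma>"
    and h: "\<And>x. x \<in> \<Gamma> \<Longrightarrow> h x = a * f x + b * g x + c"
  shows "slope_sum \<Gamma> h p = a * slope_sum \<Gamma> f p + b * slope_sum \<Gamma> g p"
proof -
  obtain R1 where R1: "star_neighborhood \<Gamma> p R1"
    "\<And>v. v \<in> Vec \<Gamma> p \<Longrightarrow> \<exists>\<beta>. \<forall>t. 0 \<le> t \<and> t < R1 \<longrightarrow> f (move \<Gamma> p v t) = f p + \<beta> * of_real t"
    using CPA_affine_near[OF \<Gamma> p f] by metis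
  obtain R2 where R2: "star_neighborhood \<Gamma> p R2"
    "\<And>v. v \<in> Vec \<Gamma> p \<Longrightarrow> \<exists>\<beta>. \<forall>t. 0 \<le> t \<and> t < R2 \<longrightarrow> g (move \<Gamma> p v t) = g p + \<beta> * of_real t"
    using CPA_affine_near[OF \<Gamma> p g] by metis
  define R where "R = min R1 R2"
  have pos: "0 < R" "R \<le> R1" "R \<le> R2"
    using star_neighborhoodD(1)[OF R1(1)] star_neighborhoodD(1)[OF R2(1)] by (auto simp: R_def)
  have "dir_deriv \<Gamma> h p v = a * dir_deriv \<Gamma> f p v + b * dir_deriv \<Gamma> g p v" if v: "v \<in> Vec \<Gamma> p" for v
  proof -
    obtain \<beta> where \<beta>: "\<And>t. 0 \<le> t \<and> t < R1 \<Longrightarrow> f (move \<Gamma> p v t) = f p + \<beta> * of_real t"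
      using R1(2)[OF v] by blast
    obtain \<gamma> where \<gamma>: "\<And>t. 0 \<le> t \<and> t < R2 \<Longrightarrow> g (move \<Gamma> p v t) = g p + \<gamma> * of_real t"
      using R2(2)[OF v] by blast
    have "dir_deriv \<Gamma> f p v = \<beta>" by (rule dir_deriv_affine[OF pos(1)]) (use \<beta> pos in auto)
    moreover have "dir_deriv \<Gamma> g p v = \<gamma>" by (rule dir_deriv_affine[OF pos(1)]) (use \<gamma> pos in auto)
    moreover have "dir_deriv \<Gamma> h p v = a * \<beta> + b * \<gamma>"
    proof (rule dir_deriv_affine[OF pos(1)])
      fix t assume t: "0 < t" "t < R"
      have "move \<Gamma> p v t \<in> \<Gamma>" using star_neighborhoodD(3)[OF R1(1) v] t pos by simp
      then show "h (move \<Gamma> p v t) = h p + (a * \<beta> + b * \<gamma>) * of_real t"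
        using \<beta>[of t] \<gamma>[of t] t pos p by (simp add: h algebra_simps)
    qed
    ultimately show ?thesis by simp
  qed
  then show ?thesis by (simp add: slope_sum_def sum.distrib sum_distrib_left)
qed

lemma CPA_lincomb:
  assumes "f \<in> CPA \<Gamma>" "g \<in> CPA \<Gamma>"
  shows "(\<lambda>x\<in>\<Gamma>. a * f x + b * g x + c) \<in> CPA \<Gamma>"
proof -
  obtain X where X: "finite X" "X \<subseteq> \<Gamma>" "\<And>u v \<gamma>. segment_in \<Gamma> u v \<gamma> \<Longrightarrow> \<gamma> ` {u<..<v} \<inter> X = {} \<Longrightarrow>
           \<exists>\<alpha> \<beta>. \<forall>t \<in> {u..v}. f (\<gamma> t) = \<alpha> + \<beta> * of_real t"
    using assms(1) unfolding CPA_def by blast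
  obtain Y where Y: "finite Y" "Y \<subseteq> \<Gamma>" "\<And>u v \<gamma>. segment_in \<Gamma> u v \<gamma> \<Longrightarrow> \<gamma> ` {u<..<v} \<inter> Y = {} \<Longrightarrow>
           \<exists>\<alpha> \<beta>. \<forall>t \<in> {u..v}. g (\<gamma> t) = \<alpha> + \<beta> * of_real t"
    using assms(2) unfolding CPA_def by blast
  have "\<exists>\<alpha> \<beta>. \<forall>t \<in> {u..v}. (\<lambda>x\<in>\<Gamma>. a * f x + b * g x + c) (\<gamma> t) = \<alpha> + \<beta> * of_real t"
    if s: "segment_in \<Gamma> u v \<gamma>" and d: "\<gamma> ` {u<..<v} \<inter> (X \<union> Y) = {}" for u v \<gamma>
  proof -
    obtain \<alpha> \<beta> where f: "\<And>t. t \<in> {u..v} \<Longrightarrow> f (\<gamma> t) = \<alpha> + \<beta> * of_real t" using X(3)[OF s] d by blast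
    obtain \<alpha>' \<beta>' where g: "\<And>t. t \<in> {u..v} \<Longrightarrow> g (\<gamma> t) = \<alpha>' + \<beta>' * of_real t" using Y(3)[OF s] d by blast
    have "\<gamma> t \<in> \<Gamma>" if "t \<in> {u..v}" for t using s that unfolding segment_in_def by auto
    then have "\<forall>t \<in> {u..v}. (\<lambda>x\<in>\<Gamma>. a * f x + b * g x + c) (\<gamma> t) = (a * \<alpha> + b * \<alpha>' + c) + (a * \<beta> + b * \<beta>') * of_real t"
      using f g by (auto simp: algebra_simps)
    then show ?thesis by blast
  qed
  moreover have "continuous_on \<Gamma> (\<lambda>x\<in>\<Gamma>. a * f x + b * g x + c)"
    using assms by (auto simp: CPA_def cong: continuous_on_cong intro!: continuous_intros)
  ultimately show ?thesis
    using X(1,2) Y(1,2) unfolding CPA_def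
    by (intro CollectI conjI exI[of _ "X \<union> Y"] restrict_extensional) blast+
qed

text \<open>Maximum principle. At a maximum all directional derivatives are at most \<open>0\<close> and their sum is
\<open>0\<close>, so all of them vanish and the function is constant near that point. The set where the
maximum is attained is thus open and closed. For complex functions it is applied to the real and
the imaginary part.\<close>

lemma harmonic_part_constant:
  fixes L :: "complex \<Rightarrow> real"
  assumes \<Gamma>: "metrized_graph \<Gamma>" and f: "f \<in> CPA \<Gamma>" and L: "bounded_linear L"
    and harm: "\<And>p. p \<in> \<Gamma> \<Longrightarrow> slope_sum \<Gamma> f p = 0"
  shows "\<exists>c. \<forall>x\<in>\<Gamma>. L (f x) = c"
proof -
  interpret L: bounded_linear L by fact
  have cpt: "compact \<Gamma>" "\<Gamma> \<noteq> {}" "connected \<Gamma>" using \<Gamma> by (auto simp: metrized_graph_def)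
  have cont: "continuous_on \<Gamma> (\<lambda>x. L (f x))"
    using f by (auto simp: CPA_def intro!: L.continuous_on)
  obtain q where q: "q \<in> \<Gamma>" "\<And>x. x \<in> \<Gamma> \<Longrightarrow> L (f x) \<le> L (f q)"
    using continuous_attains_sup[OF cpt(1,2) cont] by blast
  let ?M = "{x \<in> \<Gamma>. L (f x) = L (f q)}"
  have "closedin (top_of_set \<Gamma>) ?M"
    using continuous_closedin_preimage_constant[OF cont] by simp
  moreover have "openin (top_of_set \<Gamma>) ?M"
    unfolding openin_euclidean_subtopology_iff
  proof (intro conjI ballI)
    fix p assume p: "p \<in> ?M"
    then have p\<Gamma>: "p \<in> \<Gamma>" by simp
    obtain R where R: "star_neighborhood \<Gamma> p R"
      "\<And>v. v \<in> Vec \<Gamma> p \<Longrightarrow> \<exists>\<beta>. \<forall>t. 0 \<le> t \<and> t < R \<longrightarrow> f (move \<Gamma> p v t) = f p + \<beta> * of_real t"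
      using CPA_affine_near[OF \<Gamma> p\<Gamma> f] by metis
    obtain \<beta> where \<beta>: "\<And>v t. v \<in> Vec \<Gamma> p \<Longrightarrow> 0 \<le> t \<Longrightarrow> t < R \<Longrightarrow> f (move \<Gamma> p v t) = f p + \<beta> v * of_real t"
      using R(2) by metis
    have pos: "R > 0" using star_neighborhoodD(1)[OF R(1)] .
    have Lf: "L (f (move \<Gamma> p v t)) = L (f p) + t * L (\<beta> v)" if "v \<in> Vec \<Gamma> p" "0 \<le> t" "t < R" for v t
    proof -
      have "\<beta> v * of_real t = t *\<^sub>R \<beta> v" by (simp add: scaleR_conv_of_real)
      then show ?thesis using \<beta>[OF that] by (simp add: L.add L.scaleR)
    qed
    have "slope_sum \<Gamma> f p = (\<Sum>v\<in>Vec \<Gamma> p. \<beta> v)"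
      unfolding slope_sum_def using \<beta> pos by (intro sum.cong refl dir_deriv_affine[of R]) auto
    then have "(\<Sum>v\<in>Vec \<Gamma> p. L (\<beta> v)) = 0" using harm[OF p\<Gamma>] by (simp flip: L.sum)
    moreover have le: "L (\<beta> v) \<le> 0" if v: "v \<in> Vec \<Gamma> p" for v
    proof -
      have "L (f (move \<Gamma> p v (R/2))) \<le> L (f p)"
        using q(2) p star_neighborhoodD(3)[OF R(1) v, of "R/2"] pos by simp
      then show ?thesis using Lf[OF v, of "R/2"] pos by (simp add: mult_le_0_iff)
    qed
    ultimately have zero: "L (\<beta> v) = 0" if "v \<in> Vec \<Gamma> p" for v
      using that star_neighborhood_exists(1)[OF \<Gamma> p\<Gamma>]
      using sum_nonneg_eq_0_iff[of "Vec \<Gamma> p" "\<lambda>v. - L (\<beta> v)"] by (simp add: sum_negf)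
    have "x \<in> ?M" if x: "x \<in> \<Gamma>" "dist x p < R" for x
    proof -
      obtain v where "v \<in> Vec \<Gamma> p" "x = move \<Gamma> p v (dist p x)"
        using star_neighborhoodD(6)[OF R(1) x(1)] x(2) by (auto simp: dist_commute)
      then have "L (f x) = L (f p)" using Lf[of v "dist p x"] zero x(2) by (auto simp: dist_commute)
      then show ?thesis using p x by simp
    qed
    then show "\<exists>e>0. \<forall>x'\<in>\<Gamma>. dist x' p < e \<longrightarrow> x' \<in> ?M" using pos by blast
  qed auto
  ultimately have "?M = {} \<or> ?M = \<Gamma>" using cpt(3) unfolding connected_clopen by blast
  then show ?thesis using q(1) by blast
qed

lemma harmonic_constant:
  assumes "metrized_graph \<Gamma>" "f \<in> CPA \<Gamma>" "\<And>p. p \<in> \<Gamma> \<Longrightarrow> slope_sum \<Gamma> f p = 0"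
  obtains c where "\<And>x. x \<in> \<Gamma> \<Longrightarrow> f x = c"
proof -
  obtain a where "\<And>x. x \<in> \<Gamma> \<Longrightarrow> Re (f x) = a"
    using harmonic_part_constant[OF assms(1,2) bounded_linear_Re assms(3)] by auto
  moreover obtain b where "\<And>x. x \<in> \<Gamma> \<Longrightarrow> Im (f x) = b"
    using harmonic_part_constant[OF assms(1,2) bounded_linear_Im assms(3)] by auto
  ultimately have "f x = Complex a b" if "x \<in> \<Gamma>" for x using that by (simp add: complex_eq_iff)
  then show ?thesis using that by blast
qed

section \<open>Cutting a metrized graph into edges\<close>

text \<open>A finite graph whose edges are parametrized by arc length. The two ends of an edge have distance
\<open>len e > 0\<close> and hence are different vertices; several edges may join the same two vertices.\<close>

locale network =
  fixes \<Gamma> :: "'a::metric_space set" and V :: "'a set" and E :: "'e set"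
    and len :: "'e \<Rightarrow> real" and par :: "'e \<Rightarrow> real \<Rightarrow> 'a"
  assumes metrized: "metrized_graph \<Gamma>"
    and finite_V: "finite V" and finite_E: "finite E" and V_subset: "V \<subseteq> \<Gamma>"
    and len_pos: "e \<in> E \<Longrightarrow> 0 < len e"
    and par_in: "e \<in> E \<Longrightarrow> 0 \<le> t \<Longrightarrow> t \<le> len e \<Longrightarrow> par e t \<in> \<Gamma>"
    and par_dist: "e \<in> E \<Longrightarrow> 0 \<le> s \<Longrightarrow> s \<le> len e \<Longrightarrow> 0 \<le> t \<Longrightarrow> t \<le> len e \<Longrightarrow>
      dist (par e s) (par e t) = \<bar>s - t\<bar>"
    and par_ends: "e \<in> E \<Longrightarrow> par e 0 \<in> V" "e \<in> E \<Longrightarrow> par e (len e) \<in> V"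
    and par_interior: "e \<in> E \<Longrightarrow> 0 < t \<Longrightarrow> t < len e \<Longrightarrow> par e t \<notin> V"
    and edges_disjoint: "e \<in> E \<Longrightarrow> e' \<in> E \<Longrightarrow> e \<noteq> e' \<Longrightarrow> 0 < s \<Longrightarrow> s < len e \<Longrightarrow>
      0 < t \<Longrightarrow> t < len e' \<Longrightarrow> par e s \<noteq> par e' t"
    and cover: "x \<in> \<Gamma> \<Longrightarrow> x \<notin> V \<Longrightarrow> \<exists>e\<in>E. \<exists>t. 0 < t \<and> t < len e \<and> x = par e t"

text \<open>The chart does not decrease distances and the other rays form a closed set, so a point close to
an inner point of a ray lies on the same ray.\<close>

lemma open_ray_piece:
  assumes s: "star_neighborhood \<Gamma> p R" and fin: "finite (Vec \<Gamma> p)" and v: "v \<in> Vec \<Gamma> p"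
    and ab: "0 \<le> a" "b < R"
  shows "openin (top_of_set \<Gamma>) (move \<Gamma> p v ` {a<..<b})"
  unfolding openin_euclidean_subtopology_iff
proof (intro conjI ballI)
  show "move \<Gamma> p v ` {a<..<b} \<subseteq> \<Gamma>"
    using star_neighborhoodD(3)[OF s v] ab by auto
  fix x assume "x \<in> move \<Gamma> p v ` {a<..<b}"
  then obtain \<tau> where \<tau>: "a < \<tau>" "\<tau> < b" "x = move \<Gamma> p v \<tau>" by auto
  define C where "C = (\<Union>w\<in>Vec \<Gamma> p - {v}. {z :: complex. z = of_real (norm z) * w})"
  have "closed C" unfolding C_def
    using fin by (intro closed_UN) (auto intro!: closed_Collect_eq continuous_intros)
  moreover have "of_real \<tau> * v \<notin> C"
    using \<tau> ab norm_Vec[OF v] by (auto simp: C_def norm_mult)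
  ultimately obtain d where d: "d > 0" "ball (of_real \<tau> * v) d \<subseteq> - C"
    using open_contains_ball[of "- C"] by (auto simp: open_Compl)
  define \<delta> where "\<delta> = min d (min (\<tau> - a) (b - \<tau>))"
  have "y \<in> move \<Gamma> p v ` {a<..<b}" if y: "y \<in> \<Gamma>" "dist y x < \<delta>" for y
  proof -
    have px: "dist p x = \<tau>" using dist_move[OF s v] \<tau> ab by simp
    have "\<bar>dist p y - dist p x\<bar> \<le> dist y x"
      by (metis abs_dist_diff_le dist_commute)
    then have rng: "a < dist p y" "dist p y < b" using y(2) px by (auto simp: \<delta>_def)
    obtain w where w: "w \<in> Vec \<Gamma> p" "y = move \<Gamma> p w (dist p y)"
      using star_neighborhoodD(6)[OF s y(1)] rng ab by auto
    have "cmod (of_real \<tau> * v - of_real (dist p y) * w) \<le> dist x y"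
      using star_neighborhoodD(5)[OF s v w(1), of \<tau> "dist p y"] \<tau> ab rng w(2) by simp
    then have "of_real (dist p y) * w \<in> ball (of_real \<tau> * v) d"
      using y(2) by (simp add: dist_norm \<delta>_def dist_commute)
    then have "of_real (dist p y) * w \<notin> C" using d by blast
    moreover have "of_real (dist p y) * w = of_real (norm (of_real (dist p y) * w)) * w"
      using norm_Vec[OF w(1)] by (simp add: norm_mult)
    ultimately have "w = v" unfolding C_def using w(1) by blast
    then show ?thesis using w rng by auto
  qed
  moreover have "\<delta> > 0" using d \<tau> by (simp add: \<delta>_def)
  ultimately show "\<exists>e>0. \<forall>x'\<in>\<Gamma>. dist x' x < e \<longrightarrow> x' \<in> move \<Gamma> p v ` {a<..<b}" by blast
qed

text \<open>Finitely many charts cover the graph. Their centers and the endpoints of their rays, cut at half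
the radius, serve as vertices, and the edges are the pieces between consecutive vertices on a
ray. Such a piece is connected and open, and its closure adds only vertices, so two pieces that
meet are equal. One representative is kept of each.\<close>

lemma network_exists:
  fixes \<Gamma> :: "'a::metric_space set"
  assumes \<Gamma>: "metrized_graph \<Gamma>"
  shows "\<exists>V (E :: ('a \<times> complex \<times> real \<times> real) set) len par. network \<Gamma> V E len par"
proof -
  have "\<forall>p\<in>\<Gamma>. \<exists>R. star_neighborhood \<Gamma> p R" using star_neighborhood_exists(2)[OF \<Gamma>] by blast
  then obtain R where R: "\<And>p. p \<in> \<Gamma> \<Longrightarrow> star_neighborhood \<Gamma> p (R p)" by metis
  have Rpos: "R p > 0" if "p \<in> \<Gamma>" for p using star_neighborhoodD(1)[OF R[OF that]] .
  have fin: "finite (Vec \<Gamma> p)" if "p \<in> \<Gamma>" for p using star_neighborhood_exists(1)[OF \<Gamma> that] .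
  define h where "h p = R p / 2" for p
  have h: "0 < h p" "h p < R p" if "p \<in> \<Gamma>" for p using Rpos[OF that] by (auto simp: h_def)
  have "compact \<Gamma>" using \<Gamma> by (simp add: metrized_graph_def)
  moreover have "\<Gamma> \<subseteq> (\<Union>p\<in>\<Gamma>. ball p (h p))" using h by auto
  ultimately obtain P where P: "P \<subseteq> \<Gamma>" "finite P" "\<Gamma> \<subseteq> (\<Union>p\<in>P. ball p (h p))"
    using compactE_image[of \<Gamma> \<Gamma> "\<lambda>p. ball p (h p)"] by (metis open_ball)
  let ?m = "move \<Gamma>"
  define V where "V = P \<union> (\<Union>p\<in>P. (\<lambda>v. ?m p v (h p)) ` Vec \<Gamma> p)"
  have P\<Gamma>: "p \<in> \<Gamma>" if "p \<in> P" for p using that P by auto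
  have finV: "finite V" unfolding V_def using P(2) fin[OF P\<Gamma>] by auto
  have m\<Gamma>: "?m p v t \<in> \<Gamma>" if "p \<in> P" "v \<in> Vec \<Gamma> p" "0 \<le> t" "t \<le> h p" for p v t
    using star_neighborhoodD(3)[OF R[OF P\<Gamma>[OF that(1)]] that(2,3)] h[OF P\<Gamma>[OF that(1)]] that by simp
  have V\<Gamma>: "V \<subseteq> \<Gamma>" unfolding V_def using P\<Gamma> m\<Gamma> h by (auto simp: less_imp_le)
  have md: "dist (?m p v s) (?m p v t) = \<bar>s - t\<bar>"
    if "p \<in> P" "v \<in> Vec \<Gamma> p" "0 \<le> s" "s \<le> h p" "0 \<le> t" "t \<le> h p" for p v s t
    using star_neighborhoodD(4)[OF R[OF P\<Gamma>[OF that(1)]] that(2), of s t] h[OF P\<Gamma>[OF that(1)]] that by simp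
  define T where "T p v = {u \<in> {0..h p}. ?m p v u \<in> V}" for p v
  have finT: "finite (T p v)" if "p \<in> P" "v \<in> Vec \<Gamma> p" for p v
  proof -
    have "inj_on (?m p v) {0..h p}"
      using md[OF that] by (intro inj_onI) (metis abs_eq_0 atLeastAtMost_iff dist_self eq_iff_diff_eq_0)
    from finite_vimage_IntI[OF finV this] show ?thesis
      by (rule finite_subset[rotated]) (auto simp: T_def)
  qed
  define Q where "Q = {(p, v, s, t). p \<in> P \<and> v \<in> Vec \<Gamma> p \<and> s \<in> T p v \<and> t \<in> T p v \<and> s < t \<and>
    (\<forall>u. s < u \<and> u < t \<longrightarrow> ?m p v u \<notin> V)}"
  have finQ: "finite Q"
  proof (rule finite_subset)
    show "Q \<subseteq> Sigma P (\<lambda>p. Sigma (Vec \<Gamma> p) (\<lambda>v. T p v \<times> T p v))" by (auto simp: Q_def)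
    show "finite (Sigma P (\<lambda>p. Sigma (Vec \<Gamma> p) (\<lambda>v. T p v \<times> T p v)))"
      using P(2) fin[OF P\<Gamma>] finT by (intro finite_SigmaI) auto
  qed
  define Oe where "Oe = (\<lambda>(p, v, s, t). ?m p v ` {s<..<t})"
  have cover: "\<exists>q\<in>Q. x \<in> Oe q" if x: "x \<in> \<Gamma>" "x \<notin> V" for x
  proof -
    obtain p where p: "p \<in> P" "dist p x < h p" using P(3) x by auto
    define \<tau> where "\<tau> = dist p x"
    obtain v where v: "v \<in> Vec \<Gamma> p" "x = ?m p v \<tau>"
      using star_neighborhoodD(6)[OF R[OF P\<Gamma>[OF p(1)]] x(1)] p(2) h[OF P\<Gamma>[OF p(1)]] by (auto simp: \<tau>_def)
    have "p \<noteq> x" using x p(1) by (auto simp: V_def)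
    then have \<tau>: "0 < \<tau>" "\<tau> < h p" using p by (auto simp: \<tau>_def)
    have "\<tau> \<notin> T p v" using x v by (auto simp: T_def)
    have 0: "0 \<in> T p v"
      using star_neighborhoodD(2)[OF R[OF P\<Gamma>[OF p(1)]] v(1)] p \<tau> by (auto simp: T_def V_def)
    have 1: "h p \<in> T p v" using p(1) v(1) \<tau> by (auto simp: T_def V_def)
    let ?A = "{u \<in> T p v. u < \<tau>}" and ?B = "{u \<in> T p v. \<tau> < u}"
    have fAB: "finite ?A" "finite ?B" "?A \<noteq> {}" "?B \<noteq> {}" using finT[OF p(1) v(1)] 0 1 \<tau> by auto
    define s where "s = Max ?A"
    define t where "t = Min ?B"
    have st: "s \<in> ?A" "t \<in> ?B" unfolding s_def t_def using fAB Max_in Min_in by blast+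
    have "?m p v u \<notin> V" if u: "s < u" "u < t" for u
    proof
      assume "?m p v u \<in> V"
      then have "u \<in> T p v" using u st by (auto simp: T_def)
      moreover have "u \<noteq> \<tau>" using \<open>\<tau> \<notin> T p v\<close> calculation by auto
      ultimately have "u \<in> ?A \<or> u \<in> ?B" by auto
      then show False using u Max_ge[OF fAB(1), of u] Min_le[OF fAB(2), of u] unfolding s_def t_def by linarith
    qed
    then have "(p, v, s, t) \<in> Q" unfolding Q_def using p v st by auto
    moreover have "x \<in> Oe (p, v, s, t)" unfolding Oe_def using v st by auto
    ultimately show ?thesis by blast
  qed
  have OV: "Oe q \<inter> V = {}" if "q \<in> Q" for q using that by (auto simp: Q_def Oe_def)
  have Oopen: "openin (top_of_set \<Gamma>) (Oe q)" if q: "q \<in> Q" for q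
  proof -
    obtain p v s t where q': "q = (p, v, s, t)" by (cases q) auto
    then have *: "p \<in> P" "v \<in> Vec \<Gamma> p" "0 \<le> s" "t \<le> h p" using q by (auto simp: Q_def T_def)
    then have "t < R p" using h[OF P\<Gamma>] by fastforce
    then show ?thesis
      using open_ray_piece[OF R[OF P\<Gamma>[OF *(1)]] fin[OF P\<Gamma>[OF *(1)]] *(2,3)] by (simp add: Oe_def q')
  qed
  have cont: "continuous_on {0..h p} (?m p v)" if "p \<in> P" "v \<in> Vec \<Gamma> p" for p v
    unfolding continuous_on_iff
  proof (intro ballI allI impI)
    fix x e :: real assume x: "x \<in> {0..h p}" and e: "0 < e"
    then show "\<exists>d>0. \<forall>x'\<in>{0..h p}. dist x' x < d \<longrightarrow> dist (?m p v x') (?m p v x) < e"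
      by (intro exI[of _ e]) (auto simp: md[OF that] dist_real_def)
  qed
  have sub: "Oe q' \<subseteq> Oe q" if q: "q \<in> Q" "q' \<in> Q" "Oe q \<inter> Oe q' \<noteq> {}" for q q'
  proof -
    obtain p v s t where qq: "q = (p, v, s, t)" by (cases q) auto
    then have *: "p \<in> P" "v \<in> Vec \<Gamma> p" "0 \<le> s" "t \<le> h p" "s < t" "?m p v s \<in> V" "?m p v t \<in> V"
      using q(1) by (auto simp: Q_def T_def)
    obtain p' v' s' t' where qq': "q' = (p', v', s', t')" by (cases q') auto
    then have **: "p' \<in> P" "v' \<in> Vec \<Gamma> p'" "0 \<le> s'" "t' \<le> h p'" using q(2) by (auto simp: Q_def T_def)
    define K where "K = ?m p v ` {s..t}"
    have "compact K" unfolding K_def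
      using * by (intro compact_continuous_image continuous_on_subset[OF cont[OF *(1,2)]]) auto
    then have "closed K" by (rule compact_imp_closed)
    have "K \<subseteq> Oe q \<union> V"
    proof
      fix x assume "x \<in> K"
      then obtain u where u: "s \<le> u" "u \<le> t" "x = ?m p v u" by (auto simp: K_def)
      then consider "u = s" | "u = t" | "u \<in> {s<..<t}" by fastforce
      then show "x \<in> Oe q \<union> V" using * u by cases (auto simp: qq Oe_def)
    qed
    moreover have "Oe q \<subseteq> K" by (auto simp: K_def qq Oe_def)
    ultimately have eq: "Oe q' \<inter> K = Oe q' \<inter> Oe q" using OV[OF q(2)] by blast
    have "connected (Oe q')" unfolding qq' Oe_def
      using ** by (auto intro!: connected_continuous_image continuous_on_subset[OF cont[OF **(1,2)]])
    moreover have "closedin (top_of_set (Oe q')) (Oe q' \<inter> Oe q)"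
      unfolding eq[symmetric] using \<open>closed K\<close> by (rule closedin_closed_Int)
    moreover have "openin (top_of_set (Oe q')) (Oe q' \<inter> Oe q)"
    proof -
      obtain U where U: "open U" "Oe q = \<Gamma> \<inter> U" using Oopen[OF q(1)] by (auto simp: openin_open)
      have "Oe q' \<subseteq> \<Gamma>" using Oopen[OF q(2)] openin_imp_subset by blast
      then have "Oe q' \<inter> Oe q = Oe q' \<inter> U" using U by blast
      then show ?thesis using U(1) openin_open_Int by metis
    qed
    ultimately have "Oe q' \<inter> Oe q = {} \<or> Oe q' \<inter> Oe q = Oe q'"
      unfolding connected_clopen by blast
    then show ?thesis using q(3) by blast
  qed
  \<comment> \<open>The same piece can occur on rays of several charts.\<close>
  obtain E where E: "E \<subseteq> Q" "inj_on Oe E" "Oe ` E = Oe ` Q"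
    using subset_image_inj[of "Oe ` Q" Oe Q] by auto
  have "network \<Gamma> V E (\<lambda>(p, v, s, t). t - s) (\<lambda>(p, v, s, t) u. ?m p v (s + u))"
  proof (unfold_locales, goal_cases)
    case 1 show ?case by fact
  next
    case 2 show ?case by fact
  next
    case 3 show ?case using E(1) finQ finite_subset by blast
  next
    case 4 show ?case by fact
  next
    case (5 e)
    then show ?case using E(1) by (auto simp: Q_def)
  next
    case (6 e t)
    then show ?case using E(1) by (auto simp: Q_def T_def intro!: m\<Gamma>)
  next
    case (7 e s t)
    then obtain p v a b where e: "e = (p, v, a, b)" by (cases e) auto
    then have "(p, v, a, b) \<in> Q" using 7 E(1) by auto
    then have "p \<in> P" "v \<in> Vec \<Gamma> p" "0 \<le> a" "b \<le> h p" by (auto simp: Q_def T_def)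
    then show ?case using 7 md[of p v "a + s" "a + t"] by (simp add: e)
  next
    case (8 e)
    then show ?case using E(1) by (auto simp: Q_def T_def)
  next
    case (9 e)
    then show ?case using E(1) by (auto simp: Q_def T_def)
  next
    case (10 e t)
    then show ?case using E(1) by (auto simp: Q_def T_def)
  next
    case (11 e e' s t)
    obtain p v a b where e: "e = (p, v, a, b)" by (cases e) auto
    obtain p' v' a' b' where e': "e' = (p', v', a', b')" by (cases e') auto
    have "?m p v (a + s) \<in> Oe e" "?m p' v' (a' + t) \<in> Oe e'"
      using 11 by (auto simp: e e' Oe_def)
    moreover have "Oe e \<inter> Oe e' = {}"
    proof (rule ccontr)
      assume "Oe e \<inter> Oe e' \<noteq> {}"
      then have "Oe e = Oe e'" using sub[of e e'] sub[of e' e] 11(1,2) E(1) by blast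
      then show False using inj_onD[OF E(2)] 11(1-3) by blast
    qed
    ultimately show ?case by (auto simp: e e')
  next
    case (12 x)
    from cover[OF this] have "\<exists>q\<in>E. x \<in> Oe q" using E(3) by (metis imageE imageI)
    then obtain p v a b u where u: "(p, v, a, b) \<in> E" "a < u" "u < b" "x = ?m p v u"
      unfolding Oe_def by auto
    then show ?case by (intro bexI[of _ "(p, v, a, b)"] exI[of _ "u - a"]) auto
  qed
  then show ?thesis by blast
qed

section \<open>Piecewise affine functions along edges\<close>

context network
begin

definition open_edge :: "'e \<Rightarrow> 'a set" where "open_edge e = par e ` {0<..<len e}"
definition closed_edge :: "'e \<Rightarrow> 'a set" where "closed_edge e = par e ` {0..len e}"
text \<open>The value \<open>0\<close> off the edge keeps the coordinate Borel on the whole graph.\<close>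
definition crd :: "'e \<Rightarrow> 'a \<Rightarrow> real" where
  "crd e x = (if x \<in> closed_edge e then inv_into {0..len e} (par e) x else 0)"

lemma connected_\<Gamma>: "connected \<Gamma>" and nonempty_\<Gamma>: "\<Gamma> \<noteq> {}" and compact_\<Gamma>: "compact \<Gamma>"
  using metrized by (auto simp: metrized_graph_def)

lemma inj_on_par: "e \<in> E \<Longrightarrow> inj_on (par e) {0..len e}"
  using par_dist by (intro inj_onI) (metis abs_eq_0 atLeastAtMost_iff dist_self eq_iff_diff_eq_0)

lemma crd_par: "e \<in> E \<Longrightarrow> 0 \<le> t \<Longrightarrow> t \<le> len e \<Longrightarrow> crd e (par e t) = t"
  unfolding crd_def closed_edge_def using inj_on_par[of e] by (auto intro!: inv_into_f_f)

lemma par_crd: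
  assumes "x \<in> closed_edge e" shows "par e (crd e x) = x" "0 \<le> crd e x" "crd e x \<le> len e"
  using assms inv_into_into[of x "par e" "{0..len e}"] f_inv_into_f[of x "par e" "{0..len e}"]
  unfolding crd_def closed_edge_def by auto

lemma open_subset_closed_edge: "open_edge e \<subseteq> closed_edge e"
  by (auto simp: open_edge_def closed_edge_def)

lemma crd_open_edge:
  assumes "e \<in> E" "x \<in> open_edge e"
  shows "par e (crd e x) = x" "0 < crd e x" "crd e x < len e"
  using assms crd_par[of e] by (auto simp: open_edge_def)

lemma closed_edge_subset: "e \<in> E \<Longrightarrow> closed_edge e \<subseteq> \<Gamma>"
  using par_in by (auto simp: closed_edge_def)

lemma open_edge_V: "e \<in> E \<Longrightarrow> open_edge e \<inter> V = {}"
  using par_interior by (auto simp: open_edge_def)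

lemma closed_edge_split: "e \<in> E \<Longrightarrow> closed_edge e = open_edge e \<union> {par e 0, par e (len e)}"
  using len_pos[of e] unfolding open_edge_def closed_edge_def
  by (auto simp: image_iff) (metis greaterThanLessThan_iff less_eq_real_def)

lemma closed_edge_minus_V: "e \<in> E \<Longrightarrow> closed_edge e - V = open_edge e"
  using closed_edge_split[of e] open_edge_V[of e] par_ends[of e] by auto

lemma open_edges_disjoint: "e \<in> E \<Longrightarrow> e' \<in> E \<Longrightarrow> e \<noteq> e' \<Longrightarrow> open_edge e \<inter> open_edge e' = {}"
  using edges_disjoint by (auto simp: open_edge_def)

lemma \<Gamma>_decomp: "\<Gamma> = V \<union> (\<Union>e\<in>E. open_edge e)"
proof
  show "\<Gamma> \<subseteq> V \<union> (\<Union>e\<in>E. open_edge e)"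
  proof
    fix x assume x: "x \<in> \<Gamma>"
    show "x \<in> V \<union> (\<Union>e\<in>E. open_edge e)"
    proof (cases "x \<in> V")
      case False
      then obtain e t where "e \<in> E" "0 < t" "t < len e" "x = par e t" using cover[OF x] by blast
      then have "x \<in> open_edge e" by (simp add: open_edge_def)
      then show ?thesis using \<open>e \<in> E\<close> by blast
    qed simp
  qed
  show "V \<union> (\<Union>e\<in>E. open_edge e) \<subseteq> \<Gamma>"
    using V_subset closed_edge_subset open_subset_closed_edge by blast
qed

lemma continuous_on_par: "e \<in> E \<Longrightarrow> continuous_on {0..len e} (par e)"
  unfolding continuous_on_iff
proof (intro ballI allI impI)
  fix x \<epsilon> :: real assume e: "e \<in> E" and x: "x \<in> {0..len e}" and \<epsilon>: "0 < \<epsilon>"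
  then show "\<exists>d>0. \<forall>x'\<in>{0..len e}. dist x' x < d \<longrightarrow> dist (par e x') (par e x) < \<epsilon>"
    by (intro exI[of _ \<epsilon>]) (auto simp: par_dist dist_real_def)
qed

lemma dist_crd:
  assumes "e \<in> E" "x \<in> closed_edge e" "y \<in> closed_edge e"
  shows "dist (crd e x) (crd e y) = dist x y"
  using par_dist[OF assms(1), of "crd e x" "crd e y"] par_crd[OF assms(2)] par_crd[OF assms(3)]
  by (simp add: dist_real_def)

lemma continuous_on_crd: "e \<in> E \<Longrightarrow> continuous_on (closed_edge e) (crd e)"
  unfolding continuous_on_iff using dist_crd by (metis)

lemma compact_closed_edge: "e \<in> E \<Longrightarrow> compact (closed_edge e)"
  unfolding closed_edge_def by (intro compact_continuous_image continuous_on_par) auto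

lemma closed_closed_edge: "e \<in> E \<Longrightarrow> closed (closed_edge e)"
  by (simp add: compact_closed_edge compact_imp_closed)

lemma closed_vertices_edges:
  assumes "A \<subseteq> V" "F \<subseteq> E" shows "closed (A \<union> (\<Union>e\<in>F. closed_edge e))"
proof (rule closed_Un)
  show "closed A" using assms(1) finite_V finite_subset finite_imp_closed by blast
  show "closed (\<Union>e\<in>F. closed_edge e)"
    using assms(2) finite_E finite_subset closed_closed_edge by (intro closed_UN) blast+
qed

lemma openin_open_edge:
  assumes e: "e \<in> E" shows "openin (top_of_set \<Gamma>) (open_edge e)"
proof -
  let ?Z = "V \<union> (\<Union>e'\<in>E - {e}. closed_edge e')"
  have "open_edge e = \<Gamma> \<inter> - ?Z"
  proof -
    have "open_edge e \<inter> closed_edge e' = {}" if "e' \<in> E - {e}" for e'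
      using that e open_edges_disjoint[of e e'] open_edge_V[OF e] closed_edge_split[of e'] par_ends[of e'] by auto
    moreover have "open_edge e \<subseteq> \<Gamma>" using open_subset_closed_edge closed_edge_subset[OF e] by blast
    moreover have "x \<in> open_edge e" if "x \<in> \<Gamma>" "x \<notin> ?Z" for x
      using that \<Gamma>_decomp open_subset_closed_edge by blast
    ultimately show ?thesis using open_edge_V[OF e] by blast
  qed
  moreover have "closed ?Z" by (rule closed_vertices_edges) auto
  ultimately show ?thesis by (metis openin_open_Int open_Compl)
qed

text \<open>Among the points that are not vertices, an open edge is open and, having only vertices as
additional limit points, closed.\<close>

lemma connected_subset_open_edge:
  assumes e: "e \<in> E" and S: "connected S" "S \<subseteq> \<Gamma>" "S \<inter> V = {}" "S \<inter> open_edge e \<noteq> {}"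
  shows "S \<subseteq> open_edge e"
proof -
  have eq: "S \<inter> closed_edge e = S \<inter> open_edge e"
    using S(3) closed_edge_minus_V[OF e] by blast
  have "closedin (top_of_set S) (S \<inter> open_edge e)"
    unfolding eq[symmetric] using closed_closed_edge[OF e] by (rule closedin_closed_Int)
  moreover have "openin (top_of_set S) (S \<inter> open_edge e)"
  proof -
    obtain U where U: "open U" "open_edge e = \<Gamma> \<inter> U"
      using openin_open_edge[OF e] by (auto simp: openin_open)
    then have "S \<inter> open_edge e = S \<inter> U" using S(2) by blast
    then show ?thesis using U(1) openin_open_Int by metis
  qed
  ultimately have "S \<inter> open_edge e = {} \<or> S \<inter> open_edge e = S"
    using S(1) unfolding connected_clopen by blast
  then show ?thesis using S(4) by blast
qed

text \<open>Between vertices an isometric segment follows a single edge, and in the coordinate of that edge it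
is an isometry of the line.\<close>

lemma segment_in_edge:
  assumes s: "segment_in \<Gamma> a b \<gamma>" and ab: "a < b" and V: "\<gamma> ` {a<..<b} \<inter> V = {}"
  obtains e c \<epsilon> where "e \<in> E" "\<epsilon> = 1 \<or> \<epsilon> = (-1::real)"
    "\<And>t. t \<in> {a..b} \<Longrightarrow> 0 \<le> c + \<epsilon> * t \<and> c + \<epsilon> * t \<le> len e \<and> \<gamma> t = par e (c + \<epsilon> * t)"
proof -
  have \<gamma>: "\<gamma> t \<in> \<Gamma>" if "t \<in> {a..b}" for t using s that by (auto simp: segment_in_def)
  have d: "dist (\<gamma> s) (\<gamma> t) = \<bar>s - t\<bar>" if "s \<in> {a..b}" "t \<in> {a..b}" for s t
    using s that by (auto simp: segment_in_def)
  have cont: "continuous_on {a..b} \<gamma>"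
    unfolding continuous_on_iff using d by (metis dist_real_def)
  let ?m = "(a + b) / 2"
  have m: "?m \<in> {a<..<b}" using ab by auto
  have "\<gamma> ?m \<in> \<Gamma>" using \<gamma>[of ?m] m by auto
  moreover have "\<gamma> ?m \<notin> V" using m V by blast
  ultimately obtain e where e: "e \<in> E" "\<gamma> ?m \<in> open_edge e" using \<Gamma>_decomp by blast
  have sub: "\<gamma> ` {a<..<b} \<subseteq> open_edge e"
  proof (rule connected_subset_open_edge[OF e(1)])
    show "connected (\<gamma> ` {a<..<b})"
      by (intro connected_continuous_image continuous_on_subset[OF cont]) auto
    show "\<gamma> ` {a<..<b} \<inter> open_edge e \<noteq> {}" using e(2) m by blast
  qed (use \<gamma> V in auto)
  have cl: "closure {a<..<b} = {a..b}" using ab by simp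
  have "\<gamma> ` closure {a<..<b} \<subseteq> closed_edge e"
    by (rule image_closure_subset)
       (use cont sub open_subset_closed_edge closed_closed_edge[OF e(1)] in \<open>auto simp: cl\<close>)
  then have in_e: "\<gamma> t \<in> closed_edge e" if "t \<in> {a..b}" for t using that cl by auto
  obtain c \<epsilon> where c: "\<epsilon> = 1 \<or> \<epsilon> = -1" "\<And>t. t \<in> {a..b} \<Longrightarrow> crd e (\<gamma> t) = c + \<epsilon> * t"
    using isometry_on_real_set[of "{a..b}" "\<lambda>t. crd e (\<gamma> t)"] dist_crd[OF e(1) in_e in_e] d
    unfolding dist_real_def by metis
  show thesis
  proof (rule that[OF e(1) c(1)])
    fix t assume t: "t \<in> {a..b}"
    show "0 \<le> c + \<epsilon> * t \<and> c + \<epsilon> * t \<le> len e \<and> \<gamma> t = par e (c + \<epsilon> * t)"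
      using par_crd[OF in_e[OF t]] c(2)[OF t] by simp
  qed
qed

lemma continuous_on_edgewise:
  fixes f :: "'a \<Rightarrow> 'b::topological_space"
  assumes "\<And>e. e \<in> E \<Longrightarrow> continuous_on {0..len e} (\<lambda>t. f (par e t))"
  shows "continuous_on \<Gamma> f"
proof -
  have "continuous_on (closed_edge e) f" if e: "e \<in> E" for e
  proof -
    have "continuous_on (closed_edge e) (\<lambda>x. f (par e (crd e x)))"
      by (rule continuous_on_compose2[OF assms[OF e] continuous_on_crd[OF e]]) (use par_crd in auto)
    then show ?thesis by (rule continuous_on_eq) (simp add: par_crd)
  qed
  then have "continuous_on (\<Union>e\<in>E. closed_edge e) f"
    using finite_E closed_closed_edge by (intro continuous_on_closed_Union) auto
  then have "continuous_on (V \<union> (\<Union>e\<in>E. closed_edge e)) f"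
    using closed_vertices_edges[of V "{}"] closed_vertices_edges[of "{}" E]
    by (intro continuous_on_closed_Un continuous_on_finite[OF finite_V]) simp_all
  then show ?thesis
    by (rule continuous_on_subset) (use \<Gamma>_decomp open_subset_closed_edge in blast)
qed

text \<open>One possible break point per edge is enough for the functions needed here: with its pole on an
edge, the Green function is on that edge the sum of an affine function and a multiple of
\<open>min t \<sigma>\<close>.\<close>

lemma CPA_edgewise:
  fixes f :: "'a \<Rightarrow> real"
  assumes f: "\<And>e t. e \<in> E \<Longrightarrow> 0 \<le> t \<Longrightarrow> t \<le> len e \<Longrightarrow> f (par e t) = \<alpha> e + \<beta> e * t + \<kappa> e * min t (\<sigma> e)"
  shows "(\<lambda>x\<in>\<Gamma>. complex_of_real (f x)) \<in> CPA \<Gamma>"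
proof -
  define X where "X = V \<union> (\<lambda>e. par e (\<sigma> e)) ` {e \<in> E. 0 < \<sigma> e \<and> \<sigma> e < len e}"
  have X: "finite X" "X \<subseteq> \<Gamma>" using finite_V finite_E V_subset par_in by (auto simp: X_def)
  have "continuous_on {0..len e} (\<lambda>t. f (par e t))" if e: "e \<in> E" for e
  proof -
    have "continuous_on {0..len e} (\<lambda>t. \<alpha> e + \<beta> e * t + \<kappa> e * min t (\<sigma> e))"
      by (intro continuous_intros)
    then show ?thesis by (rule continuous_on_eq) (simp add: f[OF e])
  qed
  then have "continuous_on \<Gamma> f" by (rule continuous_on_edgewise)
  then have "continuous_on \<Gamma> (\<lambda>x. complex_of_real (f x))" by (rule continuous_on_of_real)
  then have cont: "continuous_on \<Gamma> (\<lambda>x\<in>\<Gamma>. complex_of_real (f x))"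
    by (rule continuous_on_eq) simp
  have "\<exists>A B. \<forall>t\<in>{a..b}. (\<lambda>x\<in>\<Gamma>. complex_of_real (f x)) (\<gamma> t) = A + B * of_real t"
    if s: "segment_in \<Gamma> a b \<gamma>" and dX: "\<gamma> ` {a<..<b} \<inter> X = {}" for a b \<gamma>
  proof (cases "a < b")
    case False
    let ?F = "\<lambda>x\<in>\<Gamma>. complex_of_real (f x)"
    have "?F (\<gamma> t) = ?F (\<gamma> a) + 0 * of_real t" if "t \<in> {a..b}" for t
    proof -
      have "t = a" using False that by auto
      then show ?thesis by simp
    qed
    then show ?thesis by blast
  next
    case ab: True
    have "\<gamma> ` {a<..<b} \<inter> V = {}" using dX by (auto simp: X_def)
    from segment_in_edge[OF s ab this] obtain e c \<epsilon> where e: "e \<in> E" and \<epsilon>: "\<epsilon> = 1 \<or> \<epsilon> = (-1::real)" and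
      *: "\<And>t. t \<in> {a..b} \<Longrightarrow> 0 \<le> c + \<epsilon> * t \<and> c + \<epsilon> * t \<le> len e \<and> \<gamma> t = par e (c + \<epsilon> * t)" by metis
    have side: "(\<forall>t\<in>{a..b}. c + \<epsilon> * t \<le> \<sigma> e) \<or> (\<forall>t\<in>{a..b}. \<sigma> e \<le> c + \<epsilon> * t)"
    proof (rule ccontr)
      assume "\<not> ?thesis"
      then obtain t u where tu: "t \<in> {a..b}" "u \<in> {a..b}" "\<sigma> e < c + \<epsilon> * t" "c + \<epsilon> * u < \<sigma> e"
        by (auto simp: not_le)
      \<comment> \<open>The parameter at which the segment passes through the break point.\<close>
      define w where "w = \<epsilon> * (\<sigma> e - c)"
      have w: "w \<in> {a<..<b}" "c + \<epsilon> * w = \<sigma> e"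
        using \<epsilon> tu by (auto simp: w_def)
      then have "\<gamma> w = par e (\<sigma> e)" using *[of w] by auto
      moreover have "0 < \<sigma> e" "\<sigma> e < len e" using tu *[of t] *[of u] by auto
      ultimately have "\<gamma> w \<in> X" using e by (auto simp: X_def)
      then show False using w dX by blast
    qed
    have "\<exists>A B. \<forall>t\<in>{a..b}. f (\<gamma> t) = A + B * t"
      using side
    proof
      assume le: "\<forall>t\<in>{a..b}. c + \<epsilon> * t \<le> \<sigma> e"
      show ?thesis
        by (intro exI[of _ "\<alpha> e + \<beta> e * c + \<kappa> e * c"] exI[of _ "(\<beta> e + \<kappa> e) * \<epsilon>"] ballI)
           (use le * f[OF e] in \<open>simp add: min_absorb1 algebra_simps\<close>)
    next
      assume ge: "\<forall>t\<in>{a..b}. \<sigma> e \<le> c + \<epsilon> * t"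
      show ?thesis
        by (intro exI[of _ "\<alpha> e + \<beta> e * c + \<kappa> e * \<sigma> e"] exI[of _ "\<beta> e * \<epsilon>"] ballI)
           (use ge * f[OF e] in \<open>simp add: min_absorb2 algebra_simps\<close>)
    qed
    then obtain A B where AB: "\<And>t. t \<in> {a..b} \<Longrightarrow> f (\<gamma> t) = A + B * t" by blast
    have "\<gamma> t \<in> \<Gamma>" if "t \<in> {a..b}" for t using s that unfolding segment_in_def by auto
    then show ?thesis
      by (intro exI[of _ "complex_of_real A"] exI[of _ "complex_of_real B"]) (simp add: AB)
  qed
  then show ?thesis unfolding CPA_def using X cont by blast
qed

lemma small_sphere_interior:
  assumes e: "e \<in> E" and s: "0 < s" "s < len e"
  obtains \<delta> where "\<delta> > 0" "\<And>\<epsilon>. 0 < \<epsilon> \<Longrightarrow> \<epsilon> < \<delta> \<Longrightarrow>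
    0 < s - \<epsilon> \<and> s + \<epsilon> < len e \<and> {x \<in> \<Gamma>. dist (par e s) x = \<epsilon>} = {par e (s + \<epsilon>), par e (s - \<epsilon>)}"
proof -
  obtain U where U: "open U" "open_edge e = \<Gamma> \<inter> U"
    using openin_open_edge[OF e] by (auto simp: openin_open)
  have "par e s \<in> open_edge e" using s by (auto simp: open_edge_def)
  then obtain d where d: "d > 0" "ball (par e s) d \<subseteq> U" using U open_contains_ball by blast
  define \<delta> where "\<delta> = min d (min s (len e - s))"
  have "0 < s - \<epsilon> \<and> s + \<epsilon> < len e \<and> {x \<in> \<Gamma>. dist (par e s) x = \<epsilon>} = {par e (s + \<epsilon>), par e (s - \<epsilon>)}"
    if \<epsilon>: "0 < \<epsilon>" "\<epsilon> < \<delta>" for \<epsilon>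
  proof (intro conjI equalityI subsetI)
    show b: "0 < s - \<epsilon>" "s + \<epsilon> < len e" using \<epsilon> by (auto simp: \<delta>_def)
    fix x
    {
      assume "x \<in> {x \<in> \<Gamma>. dist (par e s) x = \<epsilon>}"
      then have x: "x \<in> \<Gamma>" "dist (par e s) x = \<epsilon>" by auto
      then have "x \<in> open_edge e" using \<epsilon> d U by (auto simp: \<delta>_def)
      then obtain t where t: "0 < t" "t < len e" "x = par e t" by (auto simp: open_edge_def)
      then have "\<bar>s - t\<bar> = \<epsilon>" using x(2) par_dist[OF e, of s t] s by simp
      then have "t = s + \<epsilon> \<or> t = s - \<epsilon>" by linarith
      then show "x \<in> {par e (s + \<epsilon>), par e (s - \<epsilon>)}" using t by blast
    next
      assume "x \<in> {par e (s + \<epsilon>), par e (s - \<epsilon>)}"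
      then show "x \<in> {x \<in> \<Gamma>. dist (par e s) x = \<epsilon>}"
        using e s b \<epsilon> by (auto simp: par_dist intro!: par_in)
    }
  qed
  moreover have "\<delta> > 0" using d s by (simp add: \<delta>_def)
  ultimately show ?thesis using that by blast
qed

lemma slope_sum_interior:
  assumes f: "f \<in> CPA \<Gamma>" and e: "e \<in> E" and s: "0 < s" "s < len e"
  obtains \<delta> where "\<delta> > 0" "\<And>\<epsilon>. 0 < \<epsilon> \<Longrightarrow> \<epsilon> < \<delta> \<Longrightarrow>
    slope_sum \<Gamma> f (par e s) = (f (par e (s + \<epsilon>)) + f (par e (s - \<epsilon>)) - 2 * f (par e s)) / of_real \<epsilon>"
proof -
  have p: "par e s \<in> \<Gamma>" using e s by (simp add: par_in)
  obtain R where R: "star_neighborhood \<Gamma> (par e s) R" "\<And>v. v \<in> Vec \<Gamma> (par e s) \<Longrightarrow>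
      \<exists>\<beta>. \<forall>t. 0 \<le> t \<and> t < R \<longrightarrow> f (move \<Gamma> (par e s) v t) = f (par e s) + \<beta> * of_real t"
    using CPA_affine_near[OF metrized p f] by metis
  obtain \<delta> where \<delta>: "\<delta> > 0" "\<And>\<epsilon>. 0 < \<epsilon> \<Longrightarrow> \<epsilon> < \<delta> \<Longrightarrow> 0 < s - \<epsilon> \<and> s + \<epsilon> < len e \<and>
     {x \<in> \<Gamma>. dist (par e s) x = \<epsilon>} = {par e (s + \<epsilon>), par e (s - \<epsilon>)}"
    using small_sphere_interior[OF e s] by blast
  show ?thesis
  proof (rule that[of "min \<delta> R"])
    show "0 < min \<delta> R" using \<delta>(1) star_neighborhoodD(1)[OF R(1)] by simp
    fix \<epsilon> assume \<epsilon>: "0 < \<epsilon>" "\<epsilon> < min \<delta> R"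
    then have *: "0 < s - \<epsilon>" "s + \<epsilon> < len e"
      "{x \<in> \<Gamma>. dist (par e s) x = \<epsilon>} = {par e (s + \<epsilon>), par e (s - \<epsilon>)}" using \<delta>(2)[of \<epsilon>] by auto
    have "par e (s + \<epsilon>) \<noteq> par e (s - \<epsilon>)"
      using inj_onD[OF inj_on_par[OF e], of "s + \<epsilon>" "s - \<epsilon>"] * \<epsilon> s by auto
    then show "slope_sum \<Gamma> f (par e s) = (f (par e (s + \<epsilon>)) + f (par e (s - \<epsilon>)) - 2 * f (par e s)) / of_real \<epsilon>"
      using slope_sum_sphere[OF R(1), of f \<epsilon>] R(2) \<epsilon> unfolding *(3)
      by (simp add: add_divide_distrib diff_divide_distrib)
  qed
qed

lemma vertex_in_closed_edge:
  assumes "e \<in> E" "p \<in> V" "p \<in> closed_edge e" shows "p = par e 0 \<or> p = par e (len e)"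
  using closed_edge_split[OF assms(1)] open_edge_V[OF assms(1)] assms(2,3) by blast

lemma par_ends_distinct: "e \<in> E \<Longrightarrow> par e 0 \<noteq> par e (len e)"
  using par_dist[of e 0 "len e"] len_pos[of e] by auto

lemma small_sphere_vertex:
  assumes p: "p \<in> V"
  obtains \<delta> where "\<delta> > 0" "\<And>e. e \<in> E \<Longrightarrow> \<delta> \<le> len e" "\<And>\<epsilon>. 0 < \<epsilon> \<Longrightarrow> \<epsilon> < \<delta> \<Longrightarrow>
    {x \<in> \<Gamma>. dist p x = \<epsilon>} = (\<lambda>e. par e \<epsilon>) ` {e \<in> E. par e 0 = p} \<union>
      (\<lambda>e. par e (len e - \<epsilon>)) ` {e \<in> E. par e (len e) = p}"
proof -
  define Z where "Z = (V - {p}) \<union> (\<Union>e\<in>{e \<in> E. p \<notin> closed_edge e}. closed_edge e)"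
  have "closed Z" unfolding Z_def by (rule closed_vertices_edges) auto
  moreover have "p \<notin> Z" by (auto simp: Z_def)
  ultimately obtain d where d: "d > 0" "ball p d \<subseteq> - Z"
    using open_contains_ball[of "- Z"] by (auto simp: open_Compl)
  define m where "m = Min (insert 1 (len ` E))"
  have m: "m > 0" "\<And>e. e \<in> E \<Longrightarrow> m \<le> len e"
    unfolding m_def using finite_E len_pos by auto
  have "{x \<in> \<Gamma>. dist p x = \<epsilon>} = (\<lambda>e. par e \<epsilon>) ` {e \<in> E. par e 0 = p} \<union>
      (\<lambda>e. par e (len e - \<epsilon>)) ` {e \<in> E. par e (len e) = p}" (is "?S = ?A \<union> ?B")
    if \<epsilon>: "0 < \<epsilon>" "\<epsilon> < min d m" for \<epsilon>
  proof (intro equalityI subsetI)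
    fix x assume "x \<in> ?S"
    then have x: "x \<in> \<Gamma>" "dist p x = \<epsilon>" by auto
    then have "x \<notin> Z" using \<epsilon> d by auto
    moreover have "x \<noteq> p" using x \<epsilon> by auto
    ultimately have "x \<notin> V" by (auto simp: Z_def)
    then obtain e where e: "e \<in> E" "x \<in> open_edge e" using x \<Gamma>_decomp by blast
    then have "p \<in> closed_edge e" using \<open>x \<notin> Z\<close> open_subset_closed_edge by (auto simp: Z_def)
    from vertex_in_closed_edge[OF e(1) p this] show "x \<in> ?A \<union> ?B"
    proof
      assume p0: "p = par e 0"
      then have "crd e x = \<epsilon>" using crd_open_edge[OF e] par_dist[OF e(1), of 0 "crd e x"] x len_pos[OF e(1)] by simp
      then show ?thesis using crd_open_edge(1)[OF e] e(1) p0 by force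
    next
      assume p0: "p = par e (len e)"
      then have "crd e x = len e - \<epsilon>"
        using crd_open_edge[OF e] par_dist[OF e(1), of "len e" "crd e x"] x len_pos[OF e(1)] by simp
      then show ?thesis using crd_open_edge(1)[OF e] e(1) p0 by force
    qed
  next
    fix x assume "x \<in> ?A \<union> ?B"
    then consider e where "e \<in> E" "par e 0 = p" "x = par e \<epsilon>" |
       e where "e \<in> E" "par e (len e) = p" "x = par e (len e - \<epsilon>)" by blast
    then show "x \<in> ?S"
    proof cases
      case 1
      then have "\<epsilon> \<le> len e" using m(2)[OF 1(1)] \<epsilon> by simp
      then show ?thesis using 1 par_dist[OF 1(1), of 0 \<epsilon>] par_in[OF 1(1), of \<epsilon>] \<epsilon> by simp
    next
      case 2
      then have "\<epsilon> \<le> len e" using m(2)[OF 2(1)] \<epsilon> by simp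
      then show ?thesis using 2 par_dist[OF 2(1), of "len e" "len e - \<epsilon>"] par_in[OF 2(1), of "len e - \<epsilon>"] \<epsilon> by simp
    qed
  qed
  moreover have "min d m > 0" using d m by simp
  moreover have "min d m \<le> len e" if "e \<in> E" for e using m(2)[OF that] by simp
  ultimately show ?thesis using that by blast
qed

lemma slope_sum_vertex:
  assumes f: "f \<in> CPA \<Gamma>" and p: "p \<in> V"
  obtains \<delta> where "\<delta> > 0" "\<And>\<epsilon>. 0 < \<epsilon> \<Longrightarrow> \<epsilon> < \<delta> \<Longrightarrow>
    slope_sum \<Gamma> f p = (\<Sum>e\<in>E. of_bool (par e 0 = p) * ((f (par e \<epsilon>) - f p) / of_real \<epsilon>)
      + of_bool (par e (len e) = p) * ((f (par e (len e - \<epsilon>)) - f p) / of_real \<epsilon>))"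
proof -
  have p\<Gamma>: "p \<in> \<Gamma>" using p V_subset by blast
  obtain R where R: "star_neighborhood \<Gamma> p R" "\<And>v. v \<in> Vec \<Gamma> p \<Longrightarrow>
      \<exists>\<beta>. \<forall>t. 0 \<le> t \<and> t < R \<longrightarrow> f (move \<Gamma> p v t) = f p + \<beta> * of_real t"
    using CPA_affine_near[OF metrized p\<Gamma> f] by metis
  obtain \<delta> where \<delta>: "\<delta> > 0" "\<And>e. e \<in> E \<Longrightarrow> \<delta> \<le> len e" "\<And>\<epsilon>. 0 < \<epsilon> \<Longrightarrow> \<epsilon> < \<delta> \<Longrightarrow>
    {x \<in> \<Gamma>. dist p x = \<epsilon>} = (\<lambda>e. par e \<epsilon>) ` {e \<in> E. par e 0 = p} \<union>
      (\<lambda>e. par e (len e - \<epsilon>)) ` {e \<in> E. par e (len e) = p}"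
    using small_sphere_vertex[OF p] by blast
  show ?thesis
  proof (rule that[of "min \<delta> R"])
    show "0 < min \<delta> R" using \<delta>(1) star_neighborhoodD(1)[OF R(1)] by simp
    fix \<epsilon> assume \<epsilon>: "0 < \<epsilon>" "\<epsilon> < min \<delta> R"
    let ?A = "{e \<in> E. par e 0 = p}" and ?B = "{e \<in> E. par e (len e) = p}"
    let ?q = "\<lambda>x. (f x - f p) / of_real \<epsilon>"
    have le: "0 < \<epsilon>" "\<epsilon> < len e" if "e \<in> E" for e using \<delta>(2)[OF that] \<epsilon> by auto
    have inj: "e = e'" if "e \<in> E" "e' \<in> E" "par e s = par e' t" "s \<in> {0<..<len e}" "t \<in> {0<..<len e'}" for e e' s t
      using edges_disjoint[of e e' s t] that by auto
    have "(\<lambda>e. par e \<epsilon>) ` ?A \<inter> (\<lambda>e. par e (len e - \<epsilon>)) ` ?B = {}"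
    proof (rule ccontr)
      assume "(\<lambda>e. par e \<epsilon>) ` ?A \<inter> (\<lambda>e. par e (len e - \<epsilon>)) ` ?B \<noteq> {}"
      then obtain e e' where e: "e \<in> ?A" "e' \<in> ?B" "par e \<epsilon> = par e' (len e' - \<epsilon>)" by auto
      then have "e = e'" using inj[of e e' \<epsilon> "len e' - \<epsilon>"] le by auto
      then show False using e par_ends_distinct by auto
    qed
    moreover have "inj_on (\<lambda>e. par e \<epsilon>) ?A"
      using inj[of _ _ \<epsilon> \<epsilon>] le by (intro inj_onI) auto
    moreover have "inj_on (\<lambda>e. par e (len e - \<epsilon>)) ?B"
    proof (rule inj_onI)
      fix e e' assume "e \<in> ?B" "e' \<in> ?B" "par e (len e - \<epsilon>) = par e' (len e' - \<epsilon>)"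
      then show "e = e'" using inj[of e e' "len e - \<epsilon>" "len e' - \<epsilon>"] le by auto
    qed
    moreover have "slope_sum \<Gamma> f p = (\<Sum>x\<in>{x \<in> \<Gamma>. dist p x = \<epsilon>}. ?q x)"
      using R \<epsilon> by (intro slope_sum_sphere) auto
    moreover have "{x \<in> \<Gamma>. dist p x = \<epsilon>} = (\<lambda>e. par e \<epsilon>) ` ?A \<union> (\<lambda>e. par e (len e - \<epsilon>)) ` ?B"
      using \<epsilon> by (intro \<delta>(3)) auto
    ultimately have "slope_sum \<Gamma> f p = (\<Sum>e\<in>?A. ?q (par e \<epsilon>)) + (\<Sum>e\<in>?B. ?q (par e (len e - \<epsilon>)))"
      using finite_E by (simp add: sum.union_disjoint sum.reindex)
    also have "(\<Sum>e\<in>?A. ?q (par e \<epsilon>)) = (\<Sum>e\<in>E. of_bool (par e 0 = p) * ?q (par e \<epsilon>))"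
      using finite_E by (intro sum.mono_neutral_cong_left) auto
    also have "(\<Sum>e\<in>?B. ?q (par e (len e - \<epsilon>))) = (\<Sum>e\<in>E. of_bool (par e (len e) = p) * ?q (par e (len e - \<epsilon>)))"
      using finite_E by (intro sum.mono_neutral_cong_left) auto
    finally show "slope_sum \<Gamma> f p = (\<Sum>e\<in>E. of_bool (par e 0 = p) * ?q (par e \<epsilon>)
      + of_bool (par e (len e) = p) * ?q (par e (len e - \<epsilon>)))"
      by (simp add: sum.distrib)
  qed
qed

text \<open>A function that is affine on both sides of an inner point of an edge with the same slope has slope
sum \<open>0\<close> there, so only vertices and break points remain. Finiteness matters because the sum in
the Laplacian would be \<open>0\<close> over an infinite set, and the slope sums could not be recovered.\<close>

lemma finite_slope_sum_support:
  assumes f: "f \<in> CPA \<Gamma>" shows "finite {p \<in> \<Gamma>. slope_sum \<Gamma> f p \<noteq> 0}"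
proof -
  obtain X where X: "finite X" "\<And>u v \<gamma>. segment_in \<Gamma> u v \<gamma> \<Longrightarrow> \<gamma> ` {u<..<v} \<inter> X = {} \<Longrightarrow>
           \<exists>\<alpha> \<beta>. \<forall>t \<in> {u..v}. f (\<gamma> t) = \<alpha> + \<beta> * of_real t"
    using f unfolding CPA_def by blast
  have "slope_sum \<Gamma> f p = 0" if p: "p \<in> \<Gamma>" "p \<notin> V" "p \<notin> X" for p
  proof -
    obtain e s where e: "e \<in> E" "0 < s" "s < len e" "p = par e s" using cover[OF p(1,2)] by blast
    obtain \<delta> where \<delta>: "\<delta> > 0" "\<And>\<epsilon>. 0 < \<epsilon> \<Longrightarrow> \<epsilon> < \<delta> \<Longrightarrow>
       slope_sum \<Gamma> f (par e s) = (f (par e (s + \<epsilon>)) + f (par e (s - \<epsilon>)) - 2 * f (par e s)) / of_real \<epsilon>"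
      using slope_sum_interior[OF f e(1-3)] by blast
    obtain d where d: "d > 0" "\<And>x. x \<in> X \<Longrightarrow> x \<noteq> p \<Longrightarrow> d \<le> dist p x" using finite_set_avoid[OF X(1)] by metis
    define \<epsilon> where "\<epsilon> = min (\<delta> / 2) (min d (min s (len e - s)))"
    have \<epsilon>: "0 < \<epsilon>" "\<epsilon> < \<delta>" "\<epsilon> \<le> d" "0 \<le> s - \<epsilon>" "s + \<epsilon> \<le> len e"
      using \<delta>(1) d(1) e by (auto simp: \<epsilon>_def)
    have "segment_in \<Gamma> (s - \<epsilon>) (s + \<epsilon>) (par e)"
      unfolding segment_in_def using \<epsilon> e(1) by (auto intro!: par_in par_dist)
    from X(2)[OF this] have aff: "par e ` {s - \<epsilon><..<s + \<epsilon>} \<inter> X = {} \<Longrightarrow>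
      \<exists>\<alpha> \<beta>. \<forall>t\<in>{s - \<epsilon>..s + \<epsilon>}. f (par e t) = \<alpha> + \<beta> * of_real t" .
    have "par e ` {s - \<epsilon><..<s + \<epsilon>} \<inter> X = {}"
    proof (rule ccontr)
      assume "par e ` {s - \<epsilon><..<s + \<epsilon>} \<inter> X \<noteq> {}"
      then obtain t where t: "s - \<epsilon> < t" "t < s + \<epsilon>" "par e t \<in> X" by auto
      then have "par e t \<noteq> p" using p by auto
      then have "d \<le> dist p (par e t)" using d t by blast
      also have "\<dots> = \<bar>s - t\<bar>" using e t \<epsilon> par_dist[OF e(1), of s t] by simp
      finally show False using t \<epsilon> by linarith
    qed
    from aff[OF this] obtain \<alpha> \<beta> where "\<forall>t\<in>{s - \<epsilon>..s + \<epsilon>}. f (par e t) = \<alpha> + \<beta> * of_real t"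
      by (elim exE)
    then have "f (par e (s + \<epsilon>)) + f (par e (s - \<epsilon>)) - 2 * f (par e s) = 0"
      using \<epsilon> by (simp add: algebra_simps)
    then show ?thesis using \<delta>(2)[OF \<epsilon>(1,2)] e(4) by simp
  qed
  then have "{p \<in> \<Gamma>. slope_sum \<Gamma> f p \<noteq> 0} \<subseteq> V \<union> X" by blast
  then show ?thesis using finite_V X(1) finite_subset by blast
qed

text \<open>Connectedness of the graph as a space turns into connectedness of the combinatorial graph: the
vertices with one value together with their edges form a closed set, and so do the others.\<close>

lemma edgewise_constant_on_vertices:
  assumes w: "\<And>e. e \<in> E \<Longrightarrow> w (par e 0) = w (par e (len e))" and "p \<in> V" "q \<in> V"
  shows "w p = w q"
proof (rule ccontr)
  assume ne: "w p \<noteq> w q"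
  define A where "A = {v \<in> V. w v = w p} \<union> (\<Union>e\<in>{e \<in> E. w (par e 0) = w p}. closed_edge e)"
  define B where "B = {v \<in> V. w v \<noteq> w p} \<union> (\<Union>e\<in>{e \<in> E. w (par e 0) \<noteq> w p}. closed_edge e)"
  have "closed A" "closed B" unfolding A_def B_def
    by (auto intro!: closed_vertices_edges)
  moreover have "\<Gamma> \<subseteq> A \<union> B" using \<Gamma>_decomp open_subset_closed_edge unfolding A_def B_def by blast
  moreover have "A \<inter> B \<inter> \<Gamma> = {}"
  proof -
    have AV: "w x = w p" if xs: "x \<in> A" "x \<in> V" for x
    proof -
      consider "w x = w p" | e where "e \<in> E" "w (par e 0) = w p" "x \<in> closed_edge e"
        using xs(1) unfolding A_def by blast
      then show ?thesis
        by cases (use vertex_in_closed_edge xs(2) w in metis)+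
    qed
    have BV: "w x \<noteq> w p" if xs: "x \<in> B" "x \<in> V" for x
    proof -
      consider "w x \<noteq> w p" | e where "e \<in> E" "w (par e 0) \<noteq> w p" "x \<in> closed_edge e"
        using xs(1) unfolding B_def by blast
      then show ?thesis
        by cases (use vertex_in_closed_edge xs(2) w in metis)+
    qed
    have "False" if x: "x \<in> A" "x \<in> B" "x \<notin> V" for x
    proof -
      obtain e e' where "e \<in> E" "e' \<in> E" "w (par e 0) = w p" "w (par e' 0) \<noteq> w p"
        "x \<in> closed_edge e" "x \<in> closed_edge e'" using x unfolding A_def B_def by blast
      moreover from this have "x \<in> open_edge e" "x \<in> open_edge e'"
        using x(3) closed_edge_minus_V by blast+
      ultimately show False using open_edges_disjoint by (metis disjoint_iff)
    qed
    then show ?thesis using AV BV by blast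
  qed
  moreover have "A \<inter> \<Gamma> \<noteq> {}" "B \<inter> \<Gamma> \<noteq> {}"
    using assms ne V_subset unfolding A_def B_def by auto
  ultimately show False using connected_\<Gamma> unfolding connected_closed by blast
qed

lemma V_nonempty: "V \<noteq> {}"
  using nonempty_\<Gamma> \<Gamma>_decomp par_ends by blast

end

section \<open>The Green function\<close>

context network
begin

definition bnd :: "'e \<Rightarrow> 'a \<Rightarrow> real" where
  "bnd e p = of_bool (par e 0 = p) - of_bool (par e (len e) = p)"

text \<open>The weighted graph Laplacian with conductance \<open>1 / len e\<close> on the edge \<open>e\<close>, grounded at the vertex
\<open>base\<close>: the additional diagonal entry removes the constants from its kernel.\<close>

definition lap :: "'a \<Rightarrow> 'a \<Rightarrow> 'a \<Rightarrow> real" where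
  "lap base p q = (\<Sum>e\<in>E. bnd e p * bnd e q / len e) + of_bool (p = base) * of_bool (q = base)"

lemma sum_V_of_bool: "a \<in> V \<Longrightarrow> (\<Sum>q\<in>V. of_bool (a = q) * w q) = (w a :: real)"
  using finite_V by (simp add: of_bool_def if_distrib[of "\<lambda>x. x * _"] cong: if_cong)

lemma sum_bnd: "e \<in> E \<Longrightarrow> (\<Sum>q\<in>V. bnd e q * w q) = w (par e 0) - w (par e (len e))"
  unfolding bnd_def left_diff_distrib sum_subtractf using par_ends[of e] by (simp only: sum_V_of_bool)

lemma lap_apply:
  assumes "base \<in> V"
  shows "(\<Sum>q\<in>V. lap base p q * w q)
    = (\<Sum>e\<in>E. bnd e p * (w (par e 0) - w (par e (len e))) / len e) + of_bool (p = base) * w base"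
proof -
  have "(\<Sum>q\<in>V. lap base p q * w q)
     = (\<Sum>q\<in>V. \<Sum>e\<in>E. bnd e p / len e * (bnd e q * w q)) + of_bool (p = base) * (\<Sum>q\<in>V. of_bool (base = q) * w q)"
  proof -
    have "lap base p q * w q
        = (\<Sum>e\<in>E. bnd e p / len e * (bnd e q * w q)) + of_bool (p = base) * (of_bool (base = q) * w q)" for q
      unfolding lap_def distrib_right sum_distrib_right
      by (intro arg_cong2[of _ _ _ _ "(+)"] sum.cong refl) auto
    then show ?thesis by (simp only: sum.distrib sum_distrib_left)
  qed
  also have "(\<Sum>q\<in>V. \<Sum>e\<in>E. bnd e p / len e * (bnd e q * w q))
      = (\<Sum>e\<in>E. bnd e p / len e * (\<Sum>q\<in>V. bnd e q * w q))"
    unfolding sum_distrib_left by (rule sum.swap)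
  also have "\<dots> = (\<Sum>e\<in>E. bnd e p * (w (par e 0) - w (par e (len e))) / len e)"
    by (intro sum.cong refl) (simp add: sum_bnd)
  finally show ?thesis using assms by (simp only: sum_V_of_bool)
qed

lemma lap_form:
  assumes "base \<in> V"
  shows "(\<Sum>p\<in>V. w p * (\<Sum>q\<in>V. lap base p q * w q))
    = (\<Sum>e\<in>E. (w (par e 0) - w (par e (len e)))\<^sup>2 / len e) + (w base)\<^sup>2"
proof -
  have "(\<Sum>p\<in>V. w p * (\<Sum>q\<in>V. lap base p q * w q))
     = (\<Sum>p\<in>V. \<Sum>e\<in>E. (w (par e 0) - w (par e (len e))) / len e * (bnd e p * w p))
       + (\<Sum>p\<in>V. of_bool (base = p) * (w p * w base))"
    unfolding lap_apply[OF assms] 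
    by (simp add: distrib_left sum.distrib sum_distrib_left mult_ac eq_commute)
  also have "(\<Sum>p\<in>V. \<Sum>e\<in>E. (w (par e 0) - w (par e (len e))) / len e * (bnd e p * w p))
     = (\<Sum>e\<in>E. (w (par e 0) - w (par e (len e))) / len e * (\<Sum>p\<in>V. bnd e p * w p))"
    unfolding sum_distrib_left by (rule sum.swap)
  also have "\<dots> = (\<Sum>e\<in>E. (w (par e 0) - w (par e (len e)))\<^sup>2 / len e)"
    by (intro sum.cong refl) (simp add: sum_bnd power2_eq_square)
  finally show ?thesis using assms by (simp add: sum_V_of_bool[of base "\<lambda>p. w p * w base"] power2_eq_square)
qed

lemma lap_form_nonneg:
  assumes "base \<in> V"
  shows "0 \<le> (\<Sum>p\<in>V. w p * (\<Sum>q\<in>V. lap base p q * w q))"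
  unfolding lap_form[OF assms] using len_pos by (intro add_nonneg_nonneg sum_nonneg) (auto simp: less_imp_le)

lemma lap_form_zero:
  assumes base: "base \<in> V" and z: "(\<Sum>p\<in>V. w p * (\<Sum>q\<in>V. lap base p q * w q)) = 0" and p: "p \<in> V"
  shows "w p = 0"
proof -
  have nn: "0 \<le> (\<Sum>e\<in>E. (w (par e 0) - w (par e (len e)))\<^sup>2 / len e)"
    using len_pos by (intro sum_nonneg) (auto simp: less_imp_le)
  have "(\<Sum>e\<in>E. (w (par e 0) - w (par e (len e)))\<^sup>2 / len e) + (w base)\<^sup>2 = 0"
    using z unfolding lap_form[OF base] .
  with nn have "w base = 0" and s: "(\<Sum>e\<in>E. (w (par e 0) - w (par e (len e)))\<^sup>2 / len e) = 0"
    by (auto simp: add_nonneg_eq_0_iff)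
  have "w (par e 0) = w (par e (len e))" if e: "e \<in> E" for e
  proof -
    have "(w (par e 0) - w (par e (len e)))\<^sup>2 / len e = 0"
      using s finite_E e len_pos by (subst (asm) sum_nonneg_eq_0_iff) (auto simp: less_imp_le)
    then show ?thesis using len_pos[OF e] by simp
  qed
  from edgewise_constant_on_vertices[OF this p base] \<open>w base = 0\<close> show ?thesis by simp
qed

lemma lap_inverse_exists:
  assumes base: "base \<in> V"
  obtains J where "\<And>p q. p \<in> V \<Longrightarrow> q \<in> V \<Longrightarrow> J p q = J q p"
    "\<And>p r. p \<in> V \<Longrightarrow> r \<in> V \<Longrightarrow> (\<Sum>q\<in>V. lap base p q * J q r) = of_bool (p = r)"
proof (rule symmetric_matrix_inverse[OF finite_V, of "lap base"])
  show "lap base p q = lap base q p" for p q by (simp add: lap_def mult.commute)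
  show "w p = 0" if "\<And>p. p \<in> V \<Longrightarrow> (\<Sum>q\<in>V. lap base p q * w q) = 0" "p \<in> V" for w p
    by (rule lap_form_zero[OF base _ that(2)]) (simp add: that(1))
qed (use that in blast)

text \<open>The function that is affine on every edge, \<open>1\<close> at the vertex \<open>p\<close> and \<open>0\<close> at all other vertices.\<close>

definition hat :: "'a \<Rightarrow> 'a \<Rightarrow> real" where
  "hat p x = of_bool (x = p) + (\<Sum>e\<in>E. of_bool (x \<in> open_edge e) *
     ((1 - crd e x / len e) * of_bool (par e 0 = p) + crd e x / len e * of_bool (par e (len e) = p)))"

text \<open>The Green function of the interval \<open>{0..len e}\<close> with boundary values \<open>0\<close>.\<close>

definition kern :: "'e \<Rightarrow> 'a \<Rightarrow> 'a \<Rightarrow> real" where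
  "kern e x y = of_bool (x \<in> open_edge e) * of_bool (y \<in> open_edge e) *
     (min (crd e x) (crd e y) - crd e x * crd e y / len e)"

lemma not_in_open_edge: "x \<in> V \<Longrightarrow> e \<in> E \<Longrightarrow> x \<notin> open_edge e"
  using open_edge_V by blast

lemma hat_vertex: "x \<in> V \<Longrightarrow> hat p x = of_bool (x = p)"
  by (simp add: hat_def not_in_open_edge)

lemma par_in_open_edge:
  assumes "e \<in> E" "e' \<in> E" "0 < t" "t < len e"
  shows "par e t \<in> open_edge e' \<longleftrightarrow> e' = e"
proof -
  have "par e t \<in> open_edge e" using assms by (simp add: open_edge_def)
  then show ?thesis using open_edges_disjoint[OF assms(1,2)] by blast
qed

lemma hat_open_edge:
  assumes e: "e \<in> E" and x: "x \<in> open_edge e" and p: "p \<in> V"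
  shows "hat p x = (1 - crd e x / len e) * of_bool (par e 0 = p) + crd e x / len e * of_bool (par e (len e) = p)"
proof -
  have "x \<noteq> p" using not_in_open_edge[OF p e] x by auto
  have "x \<notin> open_edge e'" if "e' \<in> E - {e}" for e' using open_edges_disjoint[of e e'] that e x by auto
  then have "(\<Sum>e'\<in>E - {e}. of_bool (x \<in> open_edge e') *
     ((1 - crd e' x / len e') * of_bool (par e' 0 = p) + crd e' x / len e' * of_bool (par e' (len e') = p))) = 0"
    by (intro sum.neutral) auto
  then show ?thesis unfolding hat_def sum.remove[OF finite_E e] using \<open>x \<noteq> p\<close> x by simp
qed

lemma hat_par:
  assumes e: "e \<in> E" and t: "0 \<le> t" "t \<le> len e" and p: "p \<in> V"
  shows "hat p (par e t) = (1 - t / len e) * of_bool (par e 0 = p) + t / len e * of_bool (par e (len e) = p)"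
proof -
  consider "t = 0" | "t = len e" | "0 < t" "t < len e" using t by linarith
  then show ?thesis
  proof cases
    case 3
    then have "par e t \<in> open_edge e" by (simp add: open_edge_def)
    from hat_open_edge[OF e this p] show ?thesis using crd_par[OF e t] by simp
  qed (use par_ends[OF e] len_pos[OF e] in \<open>auto simp: hat_vertex\<close>)
qed

lemma sum_hat_par:
  assumes e: "e \<in> E" and t: "0 \<le> t" "t \<le> len e"
  shows "(\<Sum>p\<in>V. hat p (par e t) * w p) = (1 - t / len e) * w (par e 0) + t / len e * w (par e (len e))"
proof -
  have "(\<Sum>p\<in>V. hat p (par e t) * w p) = (1 - t / len e) * (\<Sum>p\<in>V. of_bool (par e 0 = p) * w p)
     + t / len e * (\<Sum>p\<in>V. of_bool (par e (len e) = p) * w p)"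
    by (simp add: hat_par[OF e t] distrib_right sum.distrib sum_distrib_left mult.assoc)
  then show ?thesis using par_ends[OF e] by (simp only: sum_V_of_bool)
qed

lemma sum_hat_vertex: "x \<in> V \<Longrightarrow> (\<Sum>p\<in>V. hat p x * w p) = w x"
  by (simp only: hat_vertex sum_V_of_bool)

lemma sum_hat: assumes "x \<in> \<Gamma>" shows "(\<Sum>p\<in>V. hat p x) = 1"
proof (cases "x \<in> V")
  case True
  from sum_hat_vertex[OF this, of "\<lambda>_. 1"] show ?thesis by simp
next
  case False
  then obtain e t where "e \<in> E" "0 < t" "t < len e" "x = par e t" using cover assms by blast
  with sum_hat_par[of e t "\<lambda>_. 1"] show ?thesis by simp
qed

lemma kern_par:
  assumes e: "e \<in> E" and e': "e' \<in> E" and t: "0 \<le> t" "t \<le> len e"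
  shows "kern e' (par e t) y = of_bool (e' = e) * of_bool (y \<in> open_edge e) * (min t (crd e y) - t * crd e y / len e)"
proof -
  consider "t = 0" | "t = len e" | "0 < t" "t < len e" using t by linarith
  then show ?thesis
  proof cases
    case 1
    then show ?thesis
      using not_in_open_edge[OF par_ends(1)[OF e] e'] crd_open_edge(2)[OF e, of y] by (auto simp: kern_def)
  next
    case 2
    then show ?thesis
      using not_in_open_edge[OF par_ends(2)[OF e] e'] crd_open_edge(3)[OF e, of y] len_pos[OF e]
      by (auto simp: kern_def)
  next
    case 3
    then show ?thesis using par_in_open_edge[OF e e' 3] crd_par[OF e t] by (auto simp: kern_def)
  qed
qed

end

locale green_network = network \<Gamma> V E len par
  for \<Gamma> :: "'a::metric_space set" and V :: "'a set" and E :: "'e set"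
    and len :: "'e \<Rightarrow> real" and par :: "'e \<Rightarrow> real \<Rightarrow> 'a" +
  fixes base :: 'a and J :: "'a \<Rightarrow> 'a \<Rightarrow> real"
  assumes base: "base \<in> V"
    and J_sym: "p \<in> V \<Longrightarrow> q \<in> V \<Longrightarrow> J p q = J q p"
    and J_inverse: "p \<in> V \<Longrightarrow> r \<in> V \<Longrightarrow> (\<Sum>q\<in>V. lap base p q * J q r) = of_bool (p = r)"
begin

text \<open>The value at the vertex \<open>p\<close> of the Green function with pole \<open>y\<close>: a pole inside an edge acts on
the vertices like point masses at the two ends, in the proportion given by the hat functions.\<close>

definition vpot :: "'a \<Rightarrow> 'a \<Rightarrow> real" where
  "vpot y p = (\<Sum>q\<in>V. J p q * hat q y)"

text \<open>The first sum interpolates the vertex values linearly along the edges, and the second one puts the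
pole back inside its edge.\<close>

definition G :: "'a \<Rightarrow> 'a \<Rightarrow> real" where
  "G x y = (\<Sum>p\<in>V. hat p x * vpot y p) + (\<Sum>e\<in>E. kern e x y)"

lemma lap_vpot:
  assumes p: "p \<in> V" shows "(\<Sum>q\<in>V. lap base p q * vpot y q) = hat p y"
proof -
  have "(\<Sum>q\<in>V. lap base p q * vpot y q) = (\<Sum>q\<in>V. \<Sum>r\<in>V. lap base p q * J q r * hat r y)"
    unfolding vpot_def by (simp add: sum_distrib_left mult.assoc)
  also have "\<dots> = (\<Sum>r\<in>V. (\<Sum>q\<in>V. lap base p q * J q r) * hat r y)"
    unfolding sum_distrib_right by (rule sum.swap)
  also have "\<dots> = (\<Sum>r\<in>V. of_bool (p = r) * hat r y)" by (simp add: J_inverse p)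
  finally show ?thesis using p by (simp only: sum_V_of_bool)
qed

text \<open>The constant function \<open>1\<close> is mapped by the grounded Laplacian to the point mass at the base. This
makes the mass that the Green function has at the base independent of its pole.\<close>

lemma vpot_base: assumes "y \<in> \<Gamma>" shows "vpot y base = 1"
proof -
  have lap1: "(\<Sum>q\<in>V. lap base q p) = of_bool (base = p)" for p
  proof -
    have "(\<Sum>q\<in>V. lap base q p) = (\<Sum>q\<in>V. lap base p q * 1)" by (simp add: lap_def mult.commute)
    then show ?thesis unfolding lap_apply[OF base] by (simp add: eq_commute)
  qed
  have "vpot y base = (\<Sum>p\<in>V. of_bool (base = p) * vpot y p)" using base by (simp only: sum_V_of_bool)
  also have "\<dots> = (\<Sum>p\<in>V. \<Sum>q\<in>V. lap base q p * vpot y p)" by (simp only: lap1[symmetric] sum_distrib_right)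
  also have "\<dots> = (\<Sum>q\<in>V. \<Sum>p\<in>V. lap base q p * vpot y p)" by (rule sum.swap)
  also have "\<dots> = 1" using sum_hat[OF assms] by (simp add: lap_vpot)
  finally show ?thesis .
qed

lemma G_par:
  assumes e: "e \<in> E" and t: "0 \<le> t" "t \<le> len e"
  shows "G (par e t) y = (1 - t / len e) * vpot y (par e 0) + t / len e * vpot y (par e (len e))
     + of_bool (y \<in> open_edge e) * (min t (crd e y) - t * crd e y / len e)"
proof -
  have "(\<Sum>e'\<in>E. kern e' (par e t) y)
     = (\<Sum>e'\<in>E. if e = e' then of_bool (y \<in> open_edge e) * (min t (crd e y) - t * crd e y / len e) else 0)"
    by (intro sum.cong refl) (simp add: kern_par[OF e _ t])
  then show ?thesis using e finite_E unfolding G_def sum_hat_par[OF e t] by simp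
qed

lemma G_sym: "G x y = G y x"
proof -
  have "(\<Sum>p\<in>V. hat p x * vpot y p) = (\<Sum>p\<in>V. \<Sum>q\<in>V. hat p x * J p q * hat q y)" for x y
    unfolding vpot_def by (simp add: sum_distrib_left mult.assoc)
  note a = this[of x y] this[of y x]
  have "(\<Sum>p\<in>V. \<Sum>q\<in>V. hat p x * J p q * hat q y) = (\<Sum>q\<in>V. \<Sum>p\<in>V. hat p x * J p q * hat q y)"
    by (rule sum.swap)
  also have "\<dots> = (\<Sum>p\<in>V. \<Sum>q\<in>V. hat p y * J p q * hat q x)"
    by (intro sum.cong refl) (simp add: J_sym mult_ac)
  finally have *: "(\<Sum>p\<in>V. \<Sum>q\<in>V. hat p x * J p q * hat q y) = (\<Sum>p\<in>V. \<Sum>q\<in>V. hat p y * J p q * hat q x)" .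
  have "kern e x y = kern e y x" for e by (simp add: kern_def min.commute mult_ac)
  then show ?thesis unfolding G_def a * by simp
qed

definition Gc :: "'a \<Rightarrow> 'a \<Rightarrow> complex" where
  "Gc y = (\<lambda>x\<in>\<Gamma>. complex_of_real (G x y))"

lemma Gc_CPA: "Gc y \<in> CPA \<Gamma>"
  unfolding Gc_def
proof (rule CPA_edgewise)
  fix e t assume e: "e \<in> E" and t: "0 \<le> t" "t \<le> len e"
  show "G (par e t) y = vpot y (par e 0)
      + ((vpot y (par e (len e)) - vpot y (par e 0)) / len e - of_bool (y \<in> open_edge e) * crd e y / len e) * t
      + of_bool (y \<in> open_edge e) * min t (crd e y)"
    unfolding G_par[OF e t] using len_pos[OF e] by (simp add: field_simps)
qed

lemma slope_sum_Gc_interior: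
  assumes e: "e \<in> E" and s: "0 < s" "s < len e"
  shows "slope_sum \<Gamma> (Gc y) (par e s) = - of_bool (par e s = y)"
proof -
  obtain \<delta> where \<delta>: "\<delta> > 0" "\<And>\<epsilon>. 0 < \<epsilon> \<Longrightarrow> \<epsilon> < \<delta> \<Longrightarrow>
     slope_sum \<Gamma> (Gc y) (par e s) = (Gc y (par e (s + \<epsilon>)) + Gc y (par e (s - \<epsilon>)) - 2 * Gc y (par e s)) / of_real \<epsilon>"
    using slope_sum_interior[OF Gc_CPA e s] by blast
  \<comment> \<open>A step of this size does not pass the pole, unless it starts there.\<close>
  define d where "d = (if crd e y = s then 1 else \<bar>crd e y - s\<bar>)"
  define \<epsilon> where "\<epsilon> = min (\<delta> / 2) (min d (min s (len e - s)))"
  have "d > 0" by (simp add: d_def)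
  then have \<epsilon>: "0 < \<epsilon>" "\<epsilon> < \<delta>" "\<epsilon> \<le> d" "0 \<le> s - \<epsilon>" "s + \<epsilon> \<le> len e"
    using \<delta>(1) s by (auto simp: \<epsilon>_def)
  have G: "Gc y (par e t) = of_real (G (par e t) y)" if "0 \<le> t" "t \<le> len e" for t
    using par_in[OF e that] by (simp add: Gc_def)
  have y: "y \<in> open_edge e \<Longrightarrow> par e s = y \<longleftrightarrow> crd e y = s"
    using crd_open_edge(1)[OF e, of y] crd_par[OF e, of s] s by auto
  have y': "y \<notin> open_edge e \<Longrightarrow> par e s \<noteq> y" using s by (auto simp: open_edge_def)
  have L: "len e \<noteq> 0" using len_pos[OF e] by simp
  have m: "min (s + \<epsilon>) (crd e y) + min (s - \<epsilon>) (crd e y) - 2 * min s (crd e y) = - \<epsilon> * of_bool (crd e y = s)"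
    using \<epsilon>(1,3) by (auto simp: d_def min_def split: if_splits)
  have "G (par e (s + \<epsilon>)) y + G (par e (s - \<epsilon>)) y - 2 * G (par e s) y
      = of_bool (y \<in> open_edge e) * (min (s + \<epsilon>) (crd e y) + min (s - \<epsilon>) (crd e y) - 2 * min s (crd e y))"
    using \<epsilon> s L by (simp add: G_par[OF e] field_simps)
  also have "\<dots> = - \<epsilon> * of_bool (par e s = y)" unfolding m using y y' by auto
  finally have *: "G (par e (s + \<epsilon>)) y + G (par e (s - \<epsilon>)) y - 2 * G (par e s) y = - \<epsilon> * of_bool (par e s = y)" .
  have "slope_sum \<Gamma> (Gc y) (par e s)
      = of_real ((G (par e (s + \<epsilon>)) y + G (par e (s - \<epsilon>)) y - 2 * G (par e s) y) / \<epsilon>)"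
    using \<delta>(2)[OF \<epsilon>(1,2)] \<epsilon> s by (simp add: G)
  then show ?thesis unfolding * using \<epsilon>(1) by simp
qed

text \<open>By \<open>lap_vpot\<close> the interpolated vertex values contribute \<open>- hat p y\<close>, up to the grounding term at the
base. The kernel of the edge that contains \<open>y\<close> contributes \<open>hat p y\<close>, which cancels it; no edge
does so if \<open>y\<close> is itself a vertex.\<close>

lemma slope_sum_Gc_vertex:
  assumes p: "p \<in> V" and y: "y \<in> \<Gamma>"
  shows "slope_sum \<Gamma> (Gc y) p = of_bool (p = base) - of_bool (p = y)"
proof -
  obtain \<delta> where \<delta>: "\<delta> > 0" "\<And>\<epsilon>. 0 < \<epsilon> \<Longrightarrow> \<epsilon> < \<delta> \<Longrightarrow>
    slope_sum \<Gamma> (Gc y) p = (\<Sum>e\<in>E. of_bool (par e 0 = p) * ((Gc y (par e \<epsilon>) - Gc y p) / of_real \<epsilon>)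
      + of_bool (par e (len e) = p) * ((Gc y (par e (len e - \<epsilon>)) - Gc y p) / of_real \<epsilon>))"
    using slope_sum_vertex[OF Gc_CPA p] by blast
  \<comment> \<open>A step of this size from an end of an edge stays on the edge and does not pass the pole.\<close>
  define m where "m = Min (insert 1 ((\<lambda>e. min (len e) (if y \<in> open_edge e then min (crd e y) (len e - crd e y) else 1)) ` E))"
  have m: "m > 0" unfolding m_def using finite_E len_pos crd_open_edge by auto
  have me: "m \<le> len e" "y \<in> open_edge e \<Longrightarrow> m \<le> crd e y \<and> m \<le> len e - crd e y" if e: "e \<in> E" for e
  proof -
    have "m \<le> min (len e) (if y \<in> open_edge e then min (crd e y) (len e - crd e y) else 1)"
      unfolding m_def using finite_E e by (intro Min_le) auto
    then show "m \<le> len e" "y \<in> open_edge e \<Longrightarrow> m \<le> crd e y \<and> m \<le> len e - crd e y" by auto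
  qed
  define \<epsilon> where "\<epsilon> = min (\<delta> / 2) m"
  have \<epsilon>: "0 < \<epsilon>" "\<epsilon> < \<delta>" "\<epsilon> \<le> m" using \<delta>(1) m by (auto simp: \<epsilon>_def)
  let ?v0 = "\<lambda>e. vpot y (par e 0)" and ?v1 = "\<lambda>e. vpot y (par e (len e))"
  let ?k = "\<lambda>e. of_bool (y \<in> open_edge e) :: real"
  have G: "Gc y (par e t) = of_real (G (par e t) y)" if "e \<in> E" "0 \<le> t" "t \<le> len e" for e t
    using par_in[OF that] by (simp add: Gc_def)
  have term0: "(Gc y (par e \<epsilon>) - Gc y (par e 0)) / of_real \<epsilon>
      = of_real ((?v1 e - ?v0 e) / len e + ?k e * (1 - crd e y / len e))" if e: "e \<in> E" for e
  proof -
    have "G (par e \<epsilon>) y - G (par e 0) y = \<epsilon> * ((?v1 e - ?v0 e) / len e + ?k e * (1 - crd e y / len e))"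
      using me[OF e] \<epsilon> len_pos[OF e] crd_open_edge[OF e, of y]
      by (cases "y \<in> open_edge e") (simp_all add: G_par[OF e] field_simps)
    moreover have "Gc y (par e \<epsilon>) - Gc y (par e 0) = of_real (G (par e \<epsilon>) y - G (par e 0) y)"
      using me[OF e] \<epsilon> len_pos[OF e] by (simp add: G[OF e])
    ultimately show ?thesis using \<epsilon>(1) by simp
  qed
  have term1: "(Gc y (par e (len e - \<epsilon>)) - Gc y (par e (len e))) / of_real \<epsilon>
      = of_real ((?v0 e - ?v1 e) / len e + ?k e * (crd e y / len e))" if e: "e \<in> E" for e
  proof -
    have "G (par e (len e - \<epsilon>)) y - G (par e (len e)) y = \<epsilon> * ((?v0 e - ?v1 e) / len e + ?k e * (crd e y / len e))"
      using me[OF e] \<epsilon> len_pos[OF e] crd_open_edge[OF e, of y]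
      by (cases "y \<in> open_edge e") (simp_all add: G_par[OF e] field_simps min_absorb2)
    moreover have "Gc y (par e (len e - \<epsilon>)) - Gc y (par e (len e)) = of_real (G (par e (len e - \<epsilon>)) y - G (par e (len e)) y)"
      using me[OF e] \<epsilon> len_pos[OF e] by (simp add: G[OF e])
    ultimately show ?thesis using \<epsilon>(1) by simp
  qed
  have "slope_sum \<Gamma> (Gc y) p = of_real (\<Sum>e\<in>E.
      of_bool (par e 0 = p) * ((?v1 e - ?v0 e) / len e + ?k e * (1 - crd e y / len e))
      + of_bool (par e (len e) = p) * ((?v0 e - ?v1 e) / len e + ?k e * (crd e y / len e)))"
    unfolding \<delta>(2)[OF \<epsilon>(1,2)] of_real_sum
  proof (intro sum.cong refl)
    fix e assume e: "e \<in> E"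
    show "of_bool (par e 0 = p) * ((Gc y (par e \<epsilon>) - Gc y p) / of_real \<epsilon>)
      + of_bool (par e (len e) = p) * ((Gc y (par e (len e - \<epsilon>)) - Gc y p) / of_real \<epsilon>)
      = of_real (of_bool (par e 0 = p) * ((?v1 e - ?v0 e) / len e + ?k e * (1 - crd e y / len e))
      + of_bool (par e (len e) = p) * ((?v0 e - ?v1 e) / len e + ?k e * (crd e y / len e)))"
      using term0[OF e] term1[OF e] by (cases "par e 0 = p"; cases "par e (len e) = p") auto
  qed
  also have "(\<Sum>e\<in>E. of_bool (par e 0 = p) * ((?v1 e - ?v0 e) / len e + ?k e * (1 - crd e y / len e))
      + of_bool (par e (len e) = p) * ((?v0 e - ?v1 e) / len e + ?k e * (crd e y / len e)))
     = (\<Sum>e\<in>E. - (bnd e p * (?v0 e - ?v1 e) / len e) + ?k e *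
     ((1 - crd e y / len e) * of_bool (par e 0 = p) + crd e y / len e * of_bool (par e (len e) = p)))"
    by (intro sum.cong refl) (auto simp: bnd_def diff_divide_distrib)
  also have "\<dots> = - (\<Sum>e\<in>E. bnd e p * (?v0 e - ?v1 e) / len e) + (hat p y - of_bool (y = p))"
    by (simp only: sum.distrib sum_negf hat_def)
  also have "\<dots> = of_bool (p = base) - of_bool (p = y)"
    using lap_vpot[OF p, of y] unfolding lap_apply[OF base] vpot_base[OF y] by (auto simp: eq_commute)
  finally show ?thesis by simp
qed

lemma slope_sum_Gc:
  assumes "p \<in> \<Gamma>" "y \<in> \<Gamma>"
  shows "slope_sum \<Gamma> (Gc y) p = of_bool (p = base) - of_bool (p = y)"
proof (cases "p \<in> V")
  case False
  then obtain e s where "e \<in> E" "0 < s" "s < len e" "p = par e s" using cover assms by blast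
  moreover have "p \<noteq> base" using False base by auto
  ultimately show ?thesis using slope_sum_Gc_interior[of e s y] by auto
qed (simp add: slope_sum_Gc_vertex assms)

lemma Laplacian_dipole:
  assumes s: "\<And>p. p \<in> \<Gamma> \<Longrightarrow> slope_sum \<Gamma> f p = of_bool (p = \<zeta>) - of_bool (p = y)"
    and "\<zeta> \<in> \<Gamma>" "y \<in> \<Gamma>"
  shows "Laplacian \<Gamma> f A = dirac y A - dirac \<zeta> A"
proof -
  have "(\<Sum>p | p \<in> \<Gamma> \<and> slope_sum \<Gamma> f p \<noteq> 0. slope_sum \<Gamma> f p * dirac p A)
     = (\<Sum>p\<in>{\<zeta>, y}. slope_sum \<Gamma> f p * dirac p A)"
    by (rule sum.mono_neutral_left) (use s assms in \<open>auto split: if_splits\<close>)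
  also have "\<dots> = dirac \<zeta> A - dirac y A"
    by (cases "\<zeta> = y") (use s assms in auto)
  finally show ?thesis by (simp add: Laplacian_def)
qed

lemma slope_sum_of_Laplacian:
  assumes f: "f \<in> CPA \<Gamma>" and L: "vector_measure_eq \<Gamma> (Laplacian \<Gamma> f) \<nu>" and p: "p \<in> \<Gamma>"
  shows "slope_sum \<Gamma> f p = - \<nu> {p}"
proof -
  have "\<Gamma> \<inter> {p} \<in> borel_sets_of \<Gamma>" unfolding sets_restrict_space by (intro imageI) simp
  moreover have "\<Gamma> \<inter> {p} = {p}" using p by blast
  ultimately have "{p} \<in> borel_sets_of \<Gamma>" by simp
  then have "\<nu> {p} = Laplacian \<Gamma> f {p}" using L by (simp add: vector_measure_eq_def)
  also have "\<dots> = - (\<Sum>q | q \<in> \<Gamma> \<and> slope_sum \<Gamma> f q \<noteq> 0. if q = p then slope_sum \<Gamma> f p else 0)"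
    unfolding Laplacian_def dirac_def by (intro arg_cong[of _ _ uminus] sum.cong) auto
  also have "\<dots> = - slope_sum \<Gamma> f p"
    using finite_slope_sum_support[OF f] p by simp
  finally show ?thesis by simp
qed

text \<open>Both sides have the same Laplacian in \<open>x\<close>, because the masses at the base cancel, and both vanish
at \<open>\<zeta>\<close>. Their difference is harmonic, hence constant.\<close>

lemma j_fun_eq:
  assumes z: "\<zeta> \<in> \<Gamma>" and y: "y \<in> \<Gamma>" and x: "x \<in> \<Gamma>"
  shows "j_fun \<Gamma> \<zeta> x y = of_real (G x y - G x \<zeta> - G \<zeta> y + G \<zeta> \<zeta>)"
proof -
  define c where "c = complex_of_real (G \<zeta> \<zeta> - G \<zeta> y)"
  define F where "F = (\<lambda>x\<in>\<Gamma>. 1 * Gc y x + (-1) * Gc \<zeta> x + c)"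
  have F: "F \<in> CPA \<Gamma>" unfolding F_def by (intro CPA_lincomb Gc_CPA)
  have sF: "slope_sum \<Gamma> F p = of_bool (p = \<zeta>) - of_bool (p = y)" if p: "p \<in> \<Gamma>" for p
  proof -
    have "slope_sum \<Gamma> F p = 1 * slope_sum \<Gamma> (Gc y) p + (-1) * slope_sum \<Gamma> (Gc \<zeta>) p"
      by (rule slope_sum_lincomb[OF metrized p Gc_CPA Gc_CPA, of _ _ _ _ _ c]) (simp add: F_def)
    then show ?thesis by (simp add: slope_sum_Gc p y z)
  qed
  have LF: "vector_measure_eq \<Gamma> (Laplacian \<Gamma> F) (\<lambda>A. dirac y A - dirac \<zeta> A)"
    unfolding vector_measure_eq_def using Laplacian_dipole[OF sF z y] by blast
  have F\<zeta>: "F \<zeta> = 0" using z by (simp add: F_def Gc_def c_def)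
  have "(THE f. f \<in> CPA \<Gamma> \<and> vector_measure_eq \<Gamma> (Laplacian \<Gamma> f) (\<lambda>A. dirac y A - dirac \<zeta> A) \<and> f \<zeta> = 0) = F"
  proof (rule the_equality)
    fix f assume f: "f \<in> CPA \<Gamma> \<and> vector_measure_eq \<Gamma> (Laplacian \<Gamma> f) (\<lambda>A. dirac y A - dirac \<zeta> A) \<and> f \<zeta> = 0"
    have sf: "slope_sum \<Gamma> f p = slope_sum \<Gamma> F p" if p: "p \<in> \<Gamma>" for p
      using f slope_sum_of_Laplacian[OF _ _ p, of f] slope_sum_of_Laplacian[OF F LF p] by metis
    define D where "D = (\<lambda>x\<in>\<Gamma>. 1 * f x + (-1) * F x + 0)"
    have "D \<in> CPA \<Gamma>" unfolding D_def using f F by (intro CPA_lincomb) auto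
    moreover have "slope_sum \<Gamma> D p = 0" if p: "p \<in> \<Gamma>" for p
    proof -
      have "slope_sum \<Gamma> D p = 1 * slope_sum \<Gamma> f p + (-1) * slope_sum \<Gamma> F p"
        using f by (intro slope_sum_lincomb[OF metrized p _ F, of _ _ _ _ 0]) (auto simp: D_def)
      then show ?thesis using sf[OF p] by simp
    qed
    ultimately obtain k where k: "\<And>x. x \<in> \<Gamma> \<Longrightarrow> D x = k" using harmonic_constant[OF metrized] by metis
    have "k = 0" using k[OF z] f F\<zeta> z by (simp add: D_def)
    then have "f x = F x" if "x \<in> \<Gamma>" for x using k[OF that] that by (simp add: D_def)
    moreover have "f \<in> extensional \<Gamma>" "F \<in> extensional \<Gamma>" using f F by (auto simp: CPA_def)
    ultimately show "f = F" by (metis extensionalityI)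
  qed (use F LF F\<zeta> in simp)
  then have "j_fun \<Gamma> \<zeta> x y = F x" by (simp add: j_fun_def)
  also have "\<dots> = of_real (G x y - G x \<zeta> - G \<zeta> y + G \<zeta> \<zeta>)"
    using x by (simp add: F_def Gc_def c_def)
  finally show ?thesis .
qed

end


lemma borel_sets_ofI: "A \<in> sets borel \<Longrightarrow> A \<subseteq> \<Gamma> \<Longrightarrow> A \<in> borel_sets_of \<Gamma>"
  by (auto simp: sets_restrict_space image_iff intro!: bexI[of _ A])

lemma bounded_borel_of_bool: "A \<in> borel_sets_of \<Gamma> \<Longrightarrow> bounded_borel \<Gamma> (\<lambda>x. of_bool (x \<in> A))"
  unfolding bounded_borel_def by (auto simp: of_bool_def intro!: exI[of _ 1])

lemma integral_of_bool:
  assumes "sets M = borel_sets_of \<Gamma>" "A \<in> borel_sets_of \<Gamma>"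
  shows "(\<integral>x. of_bool (x \<in> A) \<partial>M) = measure M A"
proof -
  have "A \<subseteq> \<Gamma>" using sets.sets_into_space[OF assms(2)] by simp
  have "(\<integral>x. of_bool (x \<in> A) \<partial>M) = (\<integral>x. indicator A x \<partial>M :: real)"
    by (intro Bochner_Integration.integral_cong) (auto simp: indicator_def)
  then show ?thesis using \<open>A \<subseteq> \<Gamma>\<close> assms by (simp add: space_eq_of_sets Int_absorb2)
qed

lemma real_integral_of_bool:
  assumes "bounded_signed \<Gamma> \<mu>" "A \<in> borel_sets_of \<Gamma>"
  shows "real_integral \<Gamma> \<mu> (\<lambda>x. of_bool (x \<in> A)) = \<mu> A"
  using assms by (simp add: real_integral_def integral_of_bool jordan_decomposition)

lemma real_integral_bound:
  assumes \<mu>: "bounded_signed \<Gamma> \<mu>"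
  obtains C where "\<And>f. bounded_borel \<Gamma> f \<Longrightarrow> (\<And>x. x \<in> \<Gamma> \<Longrightarrow> \<bar>f x\<bar> \<le> 1) \<Longrightarrow> \<bar>real_integral \<Gamma> \<mu> f\<bar> \<le> C"
proof
  let ?P = "pos_part \<Gamma> \<mu>" and ?N = "pos_part \<Gamma> (\<lambda>A. - \<mu> A)"
  fix f :: "'a \<Rightarrow> real" assume f: "bounded_borel \<Gamma> f" "\<And>x. x \<in> \<Gamma> \<Longrightarrow> \<bar>f x\<bar> \<le> 1"
  have *: "\<bar>integral\<^sup>L M f\<bar> \<le> measure M \<Gamma>" if M: "finite_measure M" "sets M = borel_sets_of \<Gamma>" for M
  proof -
    interpret finite_measure M by fact
    have sp: "space M = \<Gamma>" by (rule space_eq_of_sets[OF M(2)])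
    have int: "integrable M f" by (rule bounded_borel_integrable[OF f(1) M])
    have "norm (integral\<^sup>L M f) \<le> (\<integral>x. norm (f x) \<partial>M)" by (rule integral_norm_bound)
    also have "\<dots> \<le> (\<integral>x. 1 \<partial>M)" using int f(2) by (intro integral_mono) (auto simp: sp)
    finally show ?thesis by (simp add: sp)
  qed
  show "\<bar>real_integral \<Gamma> \<mu> f\<bar> \<le> measure ?P \<Gamma> + measure ?N \<Gamma>"
    using *[OF finite_measure_pos_part[OF \<mu>] sets_pos_part]
      *[OF finite_measure_pos_part[OF bounded_signed_uminus[OF \<mu>]] sets_pos_part]
    unfolding real_integral_def by linarith
qed

section \<open>Arc-length measure\<close>

context network
begin

lemma closed_edge_borel: "e \<in> E \<Longrightarrow> closed_edge e \<in> sets borel"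
  using closed_closed_edge by (rule borel_closed)

lemma open_edge_borel: "e \<in> E \<Longrightarrow> open_edge e \<in> sets borel"
  using closed_edge_borel[of e] closed_edge_minus_V[of e] finite_V
  by (metis sets.Diff borel_closed finite_imp_closed)

lemma open_edge_sets: "e \<in> E \<Longrightarrow> open_edge e \<in> borel_sets_of \<Gamma>"
  using open_edge_borel open_subset_closed_edge closed_edge_subset by (intro borel_sets_ofI) blast+

lemma vertex_sets: "p \<in> V \<Longrightarrow> {p} \<in> borel_sets_of \<Gamma>"
  using V_subset by (intro borel_sets_ofI) auto

lemma borel_measurable_crd:
  assumes "e \<in> E" shows "crd e \<in> borel_measurable (borel_on \<Gamma>)"
proof -
  have "(\<lambda>x. indicator (closed_edge e) x *\<^sub>R crd e x) \<in> borel_measurable borel"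
    using closed_edge_borel[OF assms] continuous_on_crd[OF assms] by (rule borel_measurable_continuous_on_indicator)
  also have "(\<lambda>x. indicator (closed_edge e) x *\<^sub>R crd e x) = crd e"
    by (auto simp: crd_def indicator_def)
  finally show ?thesis by (rule measurable_restrict_space1)
qed

text \<open>These sets generate the Borel sets of an edge, like the half-lines on the real line.\<close>

definition edge_tail :: "'e \<Rightarrow> real \<Rightarrow> 'a set" where
  "edge_tail e u = {x \<in> open_edge e. u < crd e x}"

lemma edge_tail_eq: "e \<in> E \<Longrightarrow> edge_tail e u = par e ` {max 0 u<..<len e}"
  using crd_open_edge[of e] crd_par[of e]
  by (auto simp: edge_tail_def open_edge_def image_iff)

lemma edge_tail_sets:
  assumes e: "e \<in> E" shows "edge_tail e u \<in> borel_sets_of \<Gamma>"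
proof -
  have "{x \<in> space (borel_on \<Gamma>). u < crd e x} \<in> borel_sets_of \<Gamma>"
    using borel_measurable_crd[OF e] by measurable
  from sets.Int[OF open_edge_sets[OF e] this]
  have "open_edge e \<inter> {x \<in> \<Gamma>. u < crd e x} \<in> borel_sets_of \<Gamma>" by simp
  also have "open_edge e \<inter> {x \<in> \<Gamma>. u < crd e x} = edge_tail e u"
    using sets.sets_into_space[OF open_edge_sets[OF e]] by (auto simp: edge_tail_def)
  finally show ?thesis .
qed

lemma measurable_par:
  assumes e: "e \<in> E"
  shows "par e \<in> measurable (restrict_space borel {0<..<len e}) (borel_on \<Gamma>)"
proof (rule measurable_restrict_space2)
  show "par e \<in> borel_measurable (restrict_space borel {0<..<len e})"
    by (intro borel_measurable_continuous_on_restrict continuous_on_subset[OF continuous_on_par[OF e]]) auto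
  show "par e \<in> space (restrict_space borel {0<..<len e}) \<rightarrow> \<Gamma>"
    using par_in[OF e] by (auto simp: space_restrict_space)
qed

text \<open>The graph is the disjoint union of its vertices and its open edges. On an open edge the measure is
transported by the coordinate to the real line, where half-lines determine it. This serves both for
the uniqueness of arc length and for the definiteness of the energy.\<close>

lemma measure_eqI_network:
  assumes M: "finite_measure M" "sets M = borel_sets_of \<Gamma>"
    and N: "finite_measure N" "sets N = borel_sets_of \<Gamma>"
    and vert: "\<And>p. p \<in> V \<Longrightarrow> emeasure M {p} = emeasure N {p}"
    and tail: "\<And>e u. e \<in> E \<Longrightarrow> emeasure M (edge_tail e u) = emeasure N (edge_tail e u)"
  shows "M = N"
proof (rule measure_eqI)
  show "sets M = sets N" using M N by simp
  fix A assume "A \<in> sets M"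
  then have A: "A \<in> borel_sets_of \<Gamma>" using M by simp
  then have A\<Gamma>: "A \<subseteq> \<Gamma>" using sets.sets_into_space[OF A] by simp
  have edge: "emeasure M (A \<inter> open_edge e) = emeasure N (A \<inter> open_edge e)" if e: "e \<in> E" for e
  proof -
    let ?D = "\<lambda>K. distr (restrict_space K (open_edge e)) borel (crd e)"
    have D: "emeasure (?D K) B = emeasure K (crd e -` B \<inter> open_edge e)"
      if K: "sets K = borel_sets_of \<Gamma>" and B: "B \<in> sets borel" for K B
    proof -
      have "crd e \<in> borel_measurable K" using borel_measurable_crd[OF e] K by (simp cong: measurable_cong_sets)
      then have m: "crd e \<in> borel_measurable (restrict_space K (open_edge e))" by (rule measurable_restrict_space1)
      have sp: "space (restrict_space K (open_edge e)) = open_edge e"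
        using sets.sets_into_space[OF open_edge_sets[OF e]] space_eq_of_sets[OF K]
        by (auto simp: space_restrict_space)
      have "open_edge e \<inter> space K \<in> sets K" using open_edge_sets[OF e] K by auto
      then show ?thesis unfolding emeasure_distr[OF m B] sp
        by (rule emeasure_restrict_space) auto
    qed
    have tl: "crd e -` {u<..} \<inter> open_edge e = edge_tail e u" for u by (auto simp: edge_tail_def)
    have "?D M = ?D N"
    proof (rule measure_eqI_lessThan)
      fix u :: real
      show "emeasure (?D M) {u<..} < \<infinity>"
        using D[OF M(2), of "{u<..}"] finite_measure.emeasure_finite[OF M(1)] by (simp add: less_top)
      show "emeasure (?D M) {u<..} = emeasure (?D N) {u<..}"
        using D[OF M(2), of "{u<..}"] D[OF N(2), of "{u<..}"] tail[OF e] by (simp add: tl)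
    qed auto
    moreover have "par e -` A \<inter> {0<..<len e} \<in> sets borel"
    proof -
      have "par e -` A \<inter> space (restrict_space borel {0<..<len e}) \<in> sets (restrict_space borel {0<..<len e})"
        by (rule measurable_sets[OF measurable_par[OF e] A])
      then show ?thesis by (auto simp: space_restrict_space sets_restrict_space)
    qed
    moreover have "crd e -` (par e -` A \<inter> {0<..<len e}) \<inter> open_edge e = A \<inter> open_edge e"
      using crd_open_edge[OF e] by auto
    ultimately show ?thesis using D[OF M(2)] D[OF N(2)] by metis
  qed
  have split: "emeasure K A = (\<Sum>p\<in>A \<inter> V. emeasure K {p}) + (\<Sum>e\<in>E. emeasure K (A \<inter> open_edge e))"
    if K: "sets K = borel_sets_of \<Gamma>" for K
  proof -
    have AV: "A \<inter> V \<in> sets K"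
      unfolding K using sets.Int[OF A borel_sets_ofI[of V]] V_subset finite_V by (simp add: finite_imp_closed borel_closed)
    have AE: "A \<inter> open_edge e \<in> sets K" if "e \<in> E" for e using A open_edge_sets[OF that] K by auto
    have "A = (A \<inter> V) \<union> (\<Union>e\<in>E. A \<inter> open_edge e)" using \<Gamma>_decomp A\<Gamma> by blast
    then have "emeasure K A = emeasure K ((A \<inter> V) \<union> (\<Union>e\<in>E. A \<inter> open_edge e))" by simp
    also have "\<dots> = emeasure K (A \<inter> V) + emeasure K (\<Union>e\<in>E. A \<inter> open_edge e)"
      using AV AE finite_E open_edge_V by (intro plus_emeasure[symmetric]) blast+
    also have "emeasure K (\<Union>e\<in>E. A \<inter> open_edge e) = (\<Sum>e\<in>E. emeasure K (A \<inter> open_edge e))"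
      using AE finite_E open_edges_disjoint
      by (intro sum_emeasure[symmetric]) (auto simp: disjoint_family_on_def)
    also have "emeasure K (A \<inter> V) = (\<Sum>p\<in>A \<inter> V. emeasure K {p})"
      using finite_V vertex_sets K by (intro emeasure_eq_sum_singleton) auto
    finally show ?thesis .
  qed
  show "emeasure M A = emeasure N A"
    unfolding split[OF M(2)] split[OF N(2)] using vert edge by (intro arg_cong2[of _ _ _ _ "(+)"] sum.cong) auto
qed

definition length_measure :: "'a measure \<Rightarrow> bool" where
  "length_measure M \<longleftrightarrow> space M = \<Gamma> \<and> sets M = borel_sets_of \<Gamma> \<and>
     (\<forall>a b \<gamma>. segment_in \<Gamma> a b \<gamma> \<longrightarrow> emeasure M (\<gamma> ` {a..b}) = ennreal (b - a))"

lemma segment_par: "e \<in> E \<Longrightarrow> 0 \<le> a \<Longrightarrow> a \<le> b \<Longrightarrow> b \<le> len e \<Longrightarrow> segment_in \<Gamma> a b (par e)"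
  unfolding segment_in_def by (auto intro!: par_in par_dist)

lemma length_measure_point:
  assumes M: "length_measure M" and p: "p \<in> \<Gamma>" shows "emeasure M {p} = 0"
proof -
  have "segment_in \<Gamma> 0 0 (\<lambda>_. p)" using p by (simp add: segment_in_def)
  then have "emeasure M ((\<lambda>_. p) ` {0..0::real}) = ennreal (0 - 0)" using M unfolding length_measure_def by blast
  then show ?thesis by simp
qed

lemma length_measure_par:
  assumes M: "length_measure M" and e: "e \<in> E" and ab: "0 \<le> a" "a \<le> b" "b \<le> len e"
  shows "emeasure M (par e ` {a..b}) = ennreal (b - a)"
  using M segment_par[OF e ab] unfolding length_measure_def by blast

lemma finite_length_measure:
  assumes M: "length_measure M" shows "finite_measure M"
proof
  have s: "sets M = borel_sets_of \<Gamma>" and sp: "space M = \<Gamma>" using M by (auto simp: length_measure_def)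
  have C: "closed_edge e \<in> sets M" if "e \<in> E" for e
    unfolding s using closed_edge_borel closed_edge_subset that by (intro borel_sets_ofI) auto
  have Vs: "V \<in> sets M" unfolding s using V_subset finite_V by (intro borel_sets_ofI borel_closed finite_imp_closed)
  have "emeasure M V \<le> (\<Sum>p\<in>V. emeasure M {p})"
    using finite_V vertex_sets s by (subst emeasure_eq_sum_singleton) auto
  then have V0: "emeasure M V = 0" using length_measure_point[OF M] V_subset by (simp add: subset_iff)
  have "\<Gamma> \<subseteq> V \<union> (\<Union>e\<in>E. closed_edge e)" using \<Gamma>_decomp open_subset_closed_edge by blast
  then have "emeasure M \<Gamma> \<le> emeasure M (V \<union> (\<Union>e\<in>E. closed_edge e))"
    using Vs C finite_E by (intro emeasure_mono) auto
  also have "\<dots> \<le> emeasure M V + emeasure M (\<Union>e\<in>E. closed_edge e)"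
    using Vs C finite_E by (intro emeasure_subadditive) auto
  also have "emeasure M (\<Union>e\<in>E. closed_edge e) \<le> (\<Sum>e\<in>E. emeasure M (closed_edge e))"
    using C finite_E by (intro emeasure_subadditive_finite) auto
  also have "\<dots> = (\<Sum>e\<in>E. ennreal (len e))"
    using length_measure_par[OF M _ order_refl _ order_refl] len_pos
    by (intro sum.cong) (auto simp: closed_edge_def less_imp_le)
  finally have "emeasure M \<Gamma> \<le> (\<Sum>e\<in>E. ennreal (len e))" using V0 by simp
  also have "\<dots> < \<infinity>" by (subst sum_ennreal) (simp_all add: len_pos less_imp_le)
  finally show "emeasure M (space M) \<noteq> \<infinity>" using sp by simp
qed

lemma length_measure_tail:
  assumes M: "length_measure M" and e: "e \<in> E"
  shows "emeasure M (edge_tail e u) = (if max 0 u < len e then ennreal (len e - max 0 u) else 0)"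
proof (cases "max 0 u < len e")
  case True
  let ?v = "max 0 u"
  have s: "sets M = borel_sets_of \<Gamma>" using M by (auto simp: length_measure_def)
  have "par e ` {?v<..<len e} = par e ` ({?v..len e} - {?v, len e})"
    by (rule arg_cong[of _ _ "image (par e)"]) auto
  also have "\<dots> = par e ` {?v..len e} - {par e ?v, par e (len e)}"
    using True by (subst inj_on_image_set_diff[OF inj_on_par[OF e]]) auto
  finally have eq: "edge_tail e u = par e ` {?v..len e} - {par e ?v, par e (len e)}"
    unfolding edge_tail_eq[OF e] .
  have "par e ?v \<in> \<Gamma>" "par e (len e) \<in> \<Gamma>" using True len_pos[OF e] by (auto intro!: par_in[OF e])
  then have "{par e ?v, par e (len e)} \<in> null_sets M"
    using length_measure_point[OF M] s borel_sets_ofI[of "{par e ?v}" \<Gamma>] borel_sets_ofI[of "{par e (len e)}" \<Gamma>]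
    by (intro null_setsI null_sets.insert_in_sets; simp add: insert_is_Un[of "par e ?v" "{par e (len e)}"])
  moreover have "par e ` {?v..len e} \<in> sets M"
  proof -
    have "compact (par e ` {?v..len e})"
      by (intro compact_continuous_image continuous_on_subset[OF continuous_on_par[OF e]]) auto
    then show ?thesis unfolding s using par_in[OF e]
      by (intro borel_sets_ofI borel_closed compact_imp_closed) auto
  qed
  ultimately have "emeasure M (edge_tail e u) = emeasure M (par e ` {?v..len e})"
    unfolding eq by (rule emeasure_Diff_null_set)
  then show ?thesis using length_measure_par[OF M e, of ?v "len e"] True by simp
next
  case False
  then have "{max 0 u<..<len e} = {}" by (simp only: not_less greaterThanLessThan_empty)
  then have "edge_tail e u = {}" unfolding edge_tail_eq[OF e] by simp
  then show ?thesis by (subst if_not_P[OF False]) simp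
qed

lemma length_measure_unique: "length_measure M \<Longrightarrow> length_measure N \<Longrightarrow> M = N"
  using length_measure_point V_subset
  by (intro measure_eqI_network) (auto simp: length_measure_tail finite_length_measure, auto simp: length_measure_def subset_iff)

text \<open>The measure adds up the Lebesgue measures of the coordinate images in all edges. For a segment, the
part in one edge has two arc-length parametrizations, by the segment and by the edge; they differ
by an isometry of the line, which preserves Lebesgue measure.\<close>

lemma length_measure_exists: "\<exists>M. length_measure M"
proof -
  define D where "D e = distr (restrict_space lborel {0<..<len e}) (borel_on \<Gamma>) (par e)" for e
  define tot where "tot A = (\<Sum>e\<in>E. emeasure (D e) A)" for A
  define M where "M = measure_of \<Gamma> (borel_sets_of \<Gamma>) tot"
  have mp: "par e \<in> measurable (restrict_space lborel {0<..<len e}) (borel_on \<Gamma>)" if "e \<in> E" for e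
    using measurable_par[OF that]
    unfolding measurable_cong_sets[OF sets_restrict_space_cong[OF sets_lborel] refl] .
  have De: "emeasure (D e) A = emeasure lborel (par e -` A \<inter> {0<..<len e})"
    if e: "e \<in> E" and A: "A \<in> borel_sets_of \<Gamma>" for e A
    unfolding D_def emeasure_distr[OF mp[OF e] A]
    by (subst emeasure_restrict_space) (auto simp: space_restrict_space)
  have pos: "positive (borel_sets_of \<Gamma>) tot" by (simp add: positive_def tot_def)
  have ca: "countably_additive (borel_sets_of \<Gamma>) tot"
    unfolding countably_additive_def
  proof (intro allI impI)
    fix A :: "nat \<Rightarrow> 'a set"
    assume A: "range A \<subseteq> borel_sets_of \<Gamma>" "disjoint_family A" "\<Union> (range A) \<in> borel_sets_of \<Gamma>"
    have "(\<Sum>i. emeasure (D e) (A i)) = emeasure (D e) (\<Union> (range A))" for e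
      using A by (intro suminf_emeasure) (auto simp: D_def)
    then show "(\<Sum>i. tot (A i)) = tot (\<Union> (range A))"
      unfolding tot_def by (subst suminf_sum) auto
  qed
  note sub = borel_sets_subset_Pow[of \<Gamma>]
  have spM: "space M = \<Gamma>" unfolding M_def using sub by (rule space_measure_of)
  have "sigma_sets \<Gamma> (borel_sets_of \<Gamma>) = borel_sets_of \<Gamma>"
    using sets.sigma_sets_eq[of "borel_on \<Gamma>"] by simp
  then have sM: "sets M = borel_sets_of \<Gamma>" unfolding M_def using sub by simp
  have eM: "emeasure M A = (\<Sum>e\<in>E. emeasure lborel (par e -` A \<inter> {0<..<len e}))"
    if A: "A \<in> borel_sets_of \<Gamma>" for A
  proof -
    have "emeasure M A = tot A" unfolding M_def using emeasure_measure_of_sigma[OF sigma_algebra_borel_sets pos ca A] .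
    also have "\<dots> = (\<Sum>e\<in>E. emeasure lborel (par e -` A \<inter> {0<..<len e}))"
      unfolding tot_def by (intro sum.cong refl De A)
    finally show ?thesis .
  qed
  have "emeasure M (\<gamma> ` {a..b}) = ennreal (b - a)" if seg: "segment_in \<Gamma> a b \<gamma>" for a b \<gamma>
  proof -
    have \<gamma>: "\<gamma> t \<in> \<Gamma>" if "t \<in> {a..b}" for t using seg that by (auto simp: segment_in_def)
    have d: "dist (\<gamma> s) (\<gamma> t) = \<bar>s - t\<bar>" if "s \<in> {a..b}" "t \<in> {a..b}" for s t
      using seg that by (auto simp: segment_in_def)
    have ab: "a \<le> b" using seg by (simp add: segment_in_def)
    have cont: "continuous_on {a..b} \<gamma>" unfolding continuous_on_iff using d by (metis dist_real_def)
    have "closed (\<gamma> ` {a..b})" by (intro compact_imp_closed compact_continuous_image cont) simp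
    then have im: "\<gamma> ` {a..b} \<in> borel_sets_of \<Gamma>" using \<gamma> by (intro borel_sets_ofI borel_closed) auto
    have inj: "inj_on \<gamma> {a..b}"
      using d by (intro inj_onI) (metis abs_eq_0 dist_self eq_iff_diff_eq_0)
    have m\<gamma>: "\<gamma> \<in> measurable (restrict_space borel {a..b}) borel"
      by (intro borel_measurable_continuous_on_restrict cont)
    define S where "S e = \<gamma> -` open_edge e \<inter> {a..b}" for e
    have Sb: "S e \<in> sets borel" if e: "e \<in> E" for e
      using measurable_sets[OF m\<gamma> open_edge_borel[OF e]]
      by (auto simp: S_def space_restrict_space sets_restrict_space)
    have "emeasure lborel (par e -` (\<gamma> ` {a..b}) \<inter> {0<..<len e}) = emeasure lborel (S e)" if e: "e \<in> E" for e
    proof -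
      have in_e: "\<gamma> t \<in> open_edge e" "\<gamma> t \<in> closed_edge e" "t \<in> {a..b}" if "t \<in> S e" for t
        using that open_subset_closed_edge by (auto simp: S_def)
      obtain c \<epsilon> where c: "\<epsilon> = 1 \<or> \<epsilon> = -1" "\<And>t. t \<in> S e \<Longrightarrow> crd e (\<gamma> t) = c + \<epsilon> * t"
        using isometry_on_real_set[of "S e" "\<lambda>t. crd e (\<gamma> t)"] dist_crd[OF e] in_e d
        unfolding dist_real_def by metis
      let ?g = "\<lambda>t. - \<epsilon> * c + \<epsilon> * t"
      have "par e -` (\<gamma> ` {a..b}) \<inter> {0<..<len e} = ?g -` S e"
      proof (intro equalityI subsetI)
        fix t assume t: "t \<in> par e -` (\<gamma> ` {a..b}) \<inter> {0<..<len e}"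
        then obtain u where u: "u \<in> {a..b}" "par e t = \<gamma> u" by auto
        have "par e t \<in> open_edge e" using t by (auto simp: open_edge_def)
        then have uS: "u \<in> S e" using u by (simp add: S_def)
        have "t = c + \<epsilon> * u" using c(2)[OF uS] crd_par[OF e, of t] t u by simp
        then have "?g t = u" using c(1) by (auto simp: algebra_simps)
        then show "t \<in> ?g -` S e" using uS by simp
      next
        fix t assume "t \<in> ?g -` S e"
        then have u: "?g t \<in> S e" by simp
        have "crd e (\<gamma> (?g t)) = t" using c(2)[OF u] c(1) by auto
        then show "t \<in> par e -` (\<gamma> ` {a..b}) \<inter> {0<..<len e}"
          using crd_open_edge[OF e in_e(1)[OF u]] in_e(3)[OF u] by force
      qed
      moreover have "emeasure lborel (S e) = emeasure lborel (?g -` S e)"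
      proof -
        have "\<epsilon> \<noteq> 0" "\<bar>\<epsilon>\<bar> = 1" using c(1) by auto
        then have "lborel = density (distr lborel borel ?g) (\<lambda>_. 1)"
          using lborel_real_affine[of \<epsilon> "- \<epsilon> * c"] by simp
        then have "emeasure lborel (S e) = emeasure (distr lborel borel ?g) (S e)"
          by (metis density_1)
        also have "\<dots> = emeasure lborel (?g -` S e \<inter> space lborel)"
          by (rule emeasure_distr) (use Sb[OF e] in auto)
        finally show ?thesis by simp
      qed
      ultimately show ?thesis by simp
    qed
    then have "emeasure M (\<gamma> ` {a..b}) = (\<Sum>e\<in>E. emeasure lborel (S e))"
      unfolding eM[OF im] by simp
    also have "\<dots> = emeasure lborel (\<Union>e\<in>E. S e)"
    proof (rule sum_emeasure)
      show "S ` E \<subseteq> sets lborel" using Sb by auto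
      show "disjoint_family_on S E" using open_edges_disjoint unfolding disjoint_family_on_def S_def by blast
    qed (rule finite_E)
    also have "(\<Union>e\<in>E. S e) = {a..b} - (\<gamma> -` V \<inter> {a..b})"
      using \<gamma> \<Gamma>_decomp open_edge_V unfolding S_def by blast
    also have "emeasure lborel ({a..b} - (\<gamma> -` V \<inter> {a..b})) = emeasure lborel {a..b}"
      using finite_vimage_IntI[OF finite_V inj] finite_imp_null_set_lborel by (intro emeasure_Diff_null_set) auto
    also have "\<dots> = ennreal (b - a)" using ab by simp
    finally show ?thesis .
  qed
  then have "length_measure M" using spM sM by (simp add: length_measure_def)
  then show ?thesis ..
qed

lemma length_measure_arc_length: "length_measure (arc_length \<Gamma>)"
proof -
  have "\<exists>!M. length_measure M" using length_measure_exists length_measure_unique by blast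
  from theI'[OF this] show ?thesis by (simp add: arc_length_def length_measure_def[abs_def])
qed

lemma finite_measure_arc_length: "finite_measure (arc_length \<Gamma>)"
  and sets_arc_length: "sets (arc_length \<Gamma>) = borel_sets_of \<Gamma>"
  using length_measure_arc_length finite_length_measure by (auto simp: length_measure_def)

end


section \<open>The energy form\<close>

lemma sum_integral_of_bool_less:
  fixes L :: real
  assumes s: "0 < s" "s < L"
  shows "(\<integral>u. of_bool (u < s) \<partial>restrict_space lborel {0<..<L}) = s"
    and "integrable (restrict_space lborel {0<..<L}) (\<lambda>u. of_bool (u < s) :: real)"
proof -
  let ?D = "restrict_space lborel {0<..<L}"
  have sp: "space ?D = {0<..<L}" by (simp add: space_restrict_space)
  have ind: "(\<lambda>u. of_bool (u < s) :: real) = indicator {..<s}" by (auto simp: indicator_def)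
  have Is: "{..<s} \<inter> {0<..<L} = {0<..<s}" using s by auto
  have S: "{0<..<s} \<in> sets ?D" using s by (auto simp: sets_restrict_space image_iff intro!: bexI[of _ "{0<..<s}"])
  have m: "measure ?D {0<..<s} = s" using s by (subst measure_restrict_space) auto
  have em: "emeasure ?D {0<..<s} = ennreal s" using s by (subst emeasure_restrict_space) auto
  show "(\<integral>u. of_bool (u < s) \<partial>?D) = s" unfolding ind by (simp add: sp Is m)
  show "integrable ?D (\<lambda>u. of_bool (u < s) :: real)"
    unfolding ind by (subst integrable_indicator_iff) (simp add: sp Is S em)
qed

context network
begin

definition edge_measure :: "'e \<Rightarrow> real measure" where
  "edge_measure e = restrict_space lborel {0<..<len e}"

text \<open>The partial derivative in \<open>u\<close> of the kernel of the edge, \<open>min u s - u * s / len e\<close>, where \<open>s\<close> is the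
coordinate of \<open>x\<close>.\<close>

definition feat :: "'e \<Rightarrow> real \<Rightarrow> 'a \<Rightarrow> real" where
  "feat e u x = of_bool (x \<in> open_edge e) * (of_bool (u < crd e x) - crd e x / len e)"

lemma space_edge_measure: "space (edge_measure e) = {0<..<len e}"
  by (simp add: edge_measure_def space_restrict_space)

lemma finite_edge_measure: "e \<in> E \<Longrightarrow> finite_measure (edge_measure e)"
  using len_pos[of e] unfolding edge_measure_def
  by (intro finite_measureI) (simp add: space_restrict_space emeasure_restrict_space)

text \<open>The kernel of an edge is a Gram matrix. This is integration by parts for the Dirichlet problem, and
the source of positivity on the edges.\<close>

lemma kern_feat:
  assumes e: "e \<in> E"
  shows "kern e x y = (\<integral>u. feat e u x * feat e u y \<partial>edge_measure e)"
proof (cases "x \<in> open_edge e \<and> y \<in> open_edge e")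
  case True
  let ?s = "crd e x" and ?t = "crd e y" and ?L = "len e"
  interpret finite_measure "edge_measure e" by (rule finite_edge_measure[OF e])
  have s: "0 < ?s" "?s < ?L" and t: "0 < ?t" "?t < ?L" using crd_open_edge[OF e] True by auto
  have m: "0 < min ?s ?t" "min ?s ?t < ?L" using s t by auto
  note i = sum_integral_of_bool_less[of _ ?L, folded edge_measure_def]
  have mD: "measure (edge_measure e) {0<..<?L} = ?L"
    unfolding edge_measure_def using s by (subst measure_restrict_space) auto
  have lin: "(\<integral>u. f u - a * g u - b * h u + c \<partial>edge_measure e)
      = integral\<^sup>L (edge_measure e) f - a * integral\<^sup>L (edge_measure e) g - b * integral\<^sup>L (edge_measure e) h + c * ?L"
    if "integrable (edge_measure e) f" "integrable (edge_measure e) g" "integrable (edge_measure e) h"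
    for f g h :: "real \<Rightarrow> real" and a b c
    using that by (simp add: space_edge_measure mD)
  have "(\<integral>u. feat e u x * feat e u y \<partial>edge_measure e)
     = (\<integral>u. of_bool (u < min ?s ?t) - ?t / ?L * of_bool (u < ?s) - ?s / ?L * of_bool (u < ?t) + (?s / ?L * (?t / ?L))
         \<partial>edge_measure e)"
    using True by (intro Bochner_Integration.integral_cong refl) (auto simp: feat_def algebra_simps)
  also have "\<dots> = min ?s ?t - ?t / ?L * ?s - ?s / ?L * ?t + ?s / ?L * (?t / ?L) * ?L"
    unfolding lin[OF i(2)[OF m] i(2)[OF s] i(2)[OF t]] i(1)[OF m] i(1)[OF s] i(1)[OF t] ..
  also have "\<dots> = min ?s ?t - ?s * ?t / ?L" using s by (simp add: field_simps)
  finally show ?thesis using True by (simp add: kern_def)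
qed (auto simp: kern_def feat_def)

lemma feat_bound: "e \<in> E \<Longrightarrow> \<bar>feat e u x\<bar> \<le> 1"
  using crd_open_edge[of e x] len_pos[of e] by (auto simp: feat_def abs_le_iff field_simps)

lemma bounded_borel_edge:
  assumes e: "e \<in> E" and F: "F \<in> borel_measurable borel" and B: "\<And>t. 0 < t \<Longrightarrow> t < len e \<Longrightarrow> \<bar>F t\<bar> \<le> B"
  shows "bounded_borel \<Gamma> (\<lambda>x. of_bool (x \<in> open_edge e) * F (crd e x))"
proof -
  have "(\<lambda>x. F (crd e x)) \<in> borel_measurable (borel_on \<Gamma>)"
    using measurable_compose[OF borel_measurable_crd[OF e] F] .
  moreover have "(\<lambda>x. of_bool (x \<in> open_edge e) :: real) \<in> borel_measurable (borel_on \<Gamma>)"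
    using bounded_borel_of_bool[OF open_edge_sets[OF e]] by (rule bounded_borel_measurable)
  ultimately have "(\<lambda>x. of_bool (x \<in> open_edge e) * F (crd e x)) \<in> borel_measurable (borel_on \<Gamma>)"
    by (intro borel_measurable_times)
  moreover have "\<bar>of_bool (x \<in> open_edge e) * F (crd e x)\<bar> \<le> \<bar>B\<bar>" for x
    using B[of "crd e x"] crd_open_edge[OF e, of x] by (cases "x \<in> open_edge e") auto
  ultimately show ?thesis unfolding bounded_borel_def by blast
qed

lemma bounded_borel_feat: "e \<in> E \<Longrightarrow> bounded_borel \<Gamma> (feat e u)"
  using bounded_borel_edge[of e "\<lambda>t. of_bool (u < t) - t / len e" 1] unfolding feat_def[abs_def]
  by (rule meta_mp) (auto simp: abs_le_iff field_simps)

lemma bounded_borel_hat: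
  assumes p: "p \<in> V" shows "bounded_borel \<Gamma> (hat p)"
proof -
  have "bounded_borel \<Gamma> (\<lambda>x. of_bool (x \<in> open_edge e) *
     ((1 - crd e x / len e) * of_bool (par e 0 = p) + crd e x / len e * of_bool (par e (len e) = p)))"
    if e: "e \<in> E" for e
    by (rule bounded_borel_edge[OF e, of "\<lambda>t. (1 - t / len e) * of_bool (par e 0 = p) + t / len e * of_bool (par e (len e) = p)" 2])
       (auto simp: abs_le_iff field_simps)
  moreover have "bounded_borel \<Gamma> (\<lambda>x. of_bool (x = p))"
    using bounded_borel_of_bool[OF vertex_sets[OF p]] by simp
  ultimately show ?thesis unfolding hat_def[abs_def] by (intro bounded_borel_add bounded_borel_sum)
qed

lemma bounded_borel_kern_diag: "e \<in> E \<Longrightarrow> bounded_borel \<Gamma> (\<lambda>x. kern e x x)"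
proof -
  assume e: "e \<in> E"
  have "bounded_borel \<Gamma> (\<lambda>x. of_bool (x \<in> open_edge e) * (crd e x - crd e x * crd e x / len e))"
  proof (rule bounded_borel_edge[OF e, of "\<lambda>t. t - t * t / len e" "len e"])
    fix t assume t: "0 < t" "t < len e"
    have "t * t / len e \<le> t" using t by (simp add: field_simps)
    moreover have "0 \<le> t * t / len e" using t by simp
    ultimately show "\<bar>t - t * t / len e\<bar> \<le> len e" using t by linarith
  qed measurable
  moreover have "kern e x x = of_bool (x \<in> open_edge e) * (crd e x - crd e x * crd e x / len e)" for x
    by (simp add: kern_def)
  ultimately show ?thesis by simp
qed

lemma measurable_feat:
  assumes e: "e \<in> E"
  shows "case_prod (feat e) \<in> borel_measurable (edge_measure e \<Otimes>\<^sub>M borel_on \<Gamma>)"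
proof -
  have [measurable]: "crd e \<in> borel_measurable (borel_on \<Gamma>)" by (rule borel_measurable_crd[OF e])
  have [measurable]: "(\<lambda>x. of_bool (x \<in> open_edge e) :: real) \<in> borel_measurable (borel_on \<Gamma>)"
    using bounded_borel_of_bool[OF open_edge_sets[OF e]] by (rule bounded_borel_measurable)
  have "(\<lambda>u. u) \<in> borel_measurable lborel" by simp
  then have [measurable]: "(\<lambda>u. u) \<in> borel_measurable (edge_measure e)"
    unfolding edge_measure_def by (rule measurable_restrict_space1)
  have "Measurable.pred (edge_measure e \<Otimes>\<^sub>M borel_on \<Gamma>) (\<lambda>z. fst z < crd e (snd z))"
    by measurable
  then have [measurable]: "(\<lambda>z. of_bool (fst z < crd e (snd z)) :: real) \<in> borel_measurable (edge_measure e \<Otimes>\<^sub>M borel_on \<Gamma>)"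
    by measurable
  show ?thesis unfolding feat_def case_prod_unfold by measurable
qed

lemma real_integral_feat:
  assumes \<mu>: "bounded_signed \<Gamma> \<mu>" and e: "e \<in> E"
  defines "m \<equiv> \<lambda>u. real_integral \<Gamma> \<mu> (feat e u)"
  shows "m \<in> borel_measurable (edge_measure e)" and "\<exists>C. \<forall>u. \<bar>m u\<bar> \<le> C"
proof -
  show "m \<in> borel_measurable (edge_measure e)" unfolding m_def
    using real_integral_Fubini(2)[OF \<mu> finite_edge_measure[OF e] measurable_feat[OF e], of 1] feat_bound[OF e]
    by (auto dest: borel_measurable_integrable)
  show "\<exists>C. \<forall>u. \<bar>m u\<bar> \<le> C"
    using real_integral_bound[OF \<mu>] bounded_borel_feat[OF e] feat_bound[OF e] unfolding m_def by metis
qed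

lemma real_integral_weighted_feat:
  assumes \<mu>: "bounded_signed \<Gamma> \<mu>" and e: "e \<in> E"
    and w: "w \<in> borel_measurable (edge_measure e)" "\<And>u. \<bar>w u\<bar> \<le> C"
  shows "real_integral \<Gamma> \<mu> (\<lambda>x. \<integral>u. w u * feat e u x \<partial>edge_measure e)
      = (\<integral>u. w u * real_integral \<Gamma> \<mu> (feat e u) \<partial>edge_measure e)"
    and "bounded_borel \<Gamma> (\<lambda>x. \<integral>u. w u * feat e u x \<partial>edge_measure e)"
proof -
  have m: "case_prod (\<lambda>u x. w u * feat e u x) \<in> borel_measurable (edge_measure e \<Otimes>\<^sub>M borel_on \<Gamma>)"
    using measurable_feat[OF e] w(1) unfolding case_prod_unfold by measurable
  have b: "\<bar>w u * feat e u x\<bar> \<le> C" for u x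
    using mult_mono[OF w(2)[of u] feat_bound[OF e, of u x]] order_trans[OF abs_ge_zero w(2)[of u]] by (simp add: abs_mult)
  show "real_integral \<Gamma> \<mu> (\<lambda>x. \<integral>u. w u * feat e u x \<partial>edge_measure e)
      = (\<integral>u. w u * real_integral \<Gamma> \<mu> (feat e u) \<partial>edge_measure e)"
    using real_integral_Fubini(1)[OF \<mu> finite_edge_measure[OF e] m b] by (simp add: real_integral_cmult)
  show "bounded_borel \<Gamma> (\<lambda>x. \<integral>u. w u * feat e u x \<partial>edge_measure e)"
    by (rule real_integral_Fubini(3)[OF \<mu> finite_edge_measure[OF e] m b])
qed

end

context green_network
begin

definition pot :: "('a set \<Rightarrow> real) \<Rightarrow> 'a \<Rightarrow> real" where
  "pot \<mu> y = real_integral \<Gamma> \<mu> (\<lambda>x. G x y)"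

definition energy :: "('a set \<Rightarrow> real) \<Rightarrow> ('a set \<Rightarrow> real) \<Rightarrow> real" where
  "energy \<mu> \<nu> = real_integral \<Gamma> \<nu> (pot \<mu>)"

lemma measurable_feat_fst: 
  assumes "e \<in> E" "y \<in> \<Gamma>" shows "(\<lambda>u. feat e u y) \<in> borel_measurable (edge_measure e)"
  using measurable_compose[OF measurable_Pair2'[of y "borel_on \<Gamma>" "edge_measure e"] measurable_feat[OF assms(1)]] assms(2)
  by simp

lemma G_feat: "G x y = (\<Sum>p\<in>V. vpot y p * hat p x) + (\<Sum>e\<in>E. \<integral>u. feat e u y * feat e u x \<partial>edge_measure e)"
  unfolding G_def by (simp add: kern_feat mult.commute cong: sum.cong)

lemma bounded_borel_kern:
  assumes \<mu>: "bounded_signed \<Gamma> \<mu>" and e: "e \<in> E" and y: "y \<in> \<Gamma>"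
  shows "bounded_borel \<Gamma> (\<lambda>x. \<integral>u. feat e u y * feat e u x \<partial>edge_measure e)"
  by (rule real_integral_weighted_feat(2)[OF \<mu> e measurable_feat_fst[OF e y] feat_bound[OF e]])

lemma bounded_signed_zero: "bounded_signed \<Gamma> (\<lambda>_. 0)"
  unfolding bounded_signed_def vector_borel_measure_def by auto

lemma bounded_borel_G: "y \<in> \<Gamma> \<Longrightarrow> bounded_borel \<Gamma> (\<lambda>x. G x y)"
  unfolding G_feat
  by (intro bounded_borel_add bounded_borel_sum bounded_borel_mult bounded_borel_const bounded_borel_hat
      bounded_borel_kern[OF bounded_signed_zero])

lemma bounded_borel_vpot: "bounded_borel \<Gamma> (\<lambda>x. vpot x p)"
  unfolding vpot_def by (intro bounded_borel_sum bounded_borel_mult bounded_borel_const bounded_borel_hat)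

lemma bounded_borel_G_diag: "bounded_borel \<Gamma> (\<lambda>x. G x x)"
  unfolding G_def
  by (intro bounded_borel_add bounded_borel_sum bounded_borel_mult bounded_borel_vpot bounded_borel_hat bounded_borel_kern_diag)

lemma pot_eq:
  assumes \<mu>: "bounded_signed \<Gamma> \<mu>" and y: "y \<in> \<Gamma>"
  shows "pot \<mu> y = (\<Sum>p\<in>V. real_integral \<Gamma> \<mu> (hat p) * vpot y p)
     + (\<Sum>e\<in>E. \<integral>u. real_integral \<Gamma> \<mu> (feat e u) * feat e u y \<partial>edge_measure e)"
proof -
  have b1: "bounded_borel \<Gamma> (\<lambda>x. vpot y p * hat p x)" if "p \<in> V" for p
    using that by (intro bounded_borel_mult bounded_borel_const bounded_borel_hat)
  have b2: "bounded_borel \<Gamma> (\<lambda>x. \<integral>u. feat e u y * feat e u x \<partial>edge_measure e)" if "e \<in> E" for e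
    by (rule bounded_borel_kern[OF \<mu> that y])
  have "pot \<mu> y = (\<Sum>p\<in>V. real_integral \<Gamma> \<mu> (\<lambda>x. vpot y p * hat p x))
     + (\<Sum>e\<in>E. real_integral \<Gamma> \<mu> (\<lambda>x. \<integral>u. feat e u y * feat e u x \<partial>edge_measure e))"
    unfolding pot_def G_feat using b1 b2
    by (subst real_integral_add[OF \<mu>]) (simp_all add: bounded_borel_sum real_integral_sum[OF \<mu>])
  moreover have "real_integral \<Gamma> \<mu> (\<lambda>x. \<integral>u. feat e u y * feat e u x \<partial>edge_measure e)
      = (\<integral>u. real_integral \<Gamma> \<mu> (feat e u) * feat e u y \<partial>edge_measure e)" if e: "e \<in> E" for e
    using real_integral_weighted_feat(1)[OF \<mu> e measurable_feat_fst[OF e y] feat_bound[OF e]]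
    by (simp add: mult.commute)
  moreover have "real_integral \<Gamma> \<mu> (\<lambda>x. vpot y p * hat p x) = real_integral \<Gamma> \<mu> (hat p) * vpot y p" for p
    unfolding real_integral_cmult by (rule mult.commute)
  ultimately show ?thesis by simp
qed

lemma pot_parts_bounded_borel:
  assumes \<mu>: "bounded_signed \<Gamma> \<mu>"
  shows "bounded_borel \<Gamma> (\<lambda>y. \<Sum>p\<in>V. real_integral \<Gamma> \<mu> (hat p) * vpot y p)"
    and "e \<in> E \<Longrightarrow> bounded_borel \<Gamma> (\<lambda>y. \<integral>u. real_integral \<Gamma> \<mu> (feat e u) * feat e u y \<partial>edge_measure e)"
proof -
  show "bounded_borel \<Gamma> (\<lambda>y. \<Sum>p\<in>V. real_integral \<Gamma> \<mu> (hat p) * vpot y p)"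
    by (intro bounded_borel_sum bounded_borel_mult bounded_borel_const bounded_borel_vpot)
  assume e: "e \<in> E"
  obtain C where "\<And>u. \<bar>real_integral \<Gamma> \<mu> (feat e u)\<bar> \<le> C" using real_integral_feat(2)[OF \<mu> e] by auto
  then show "bounded_borel \<Gamma> (\<lambda>y. \<integral>u. real_integral \<Gamma> \<mu> (feat e u) * feat e u y \<partial>edge_measure e)"
    by (rule real_integral_weighted_feat(2)[OF \<mu> e real_integral_feat(1)[OF \<mu> e]])
qed

lemma bounded_borel_pot:
  assumes \<mu>: "bounded_signed \<Gamma> \<mu>" shows "bounded_borel \<Gamma> (pot \<mu>)"
proof -
  have "bounded_borel \<Gamma> (\<lambda>y. (\<Sum>p\<in>V. real_integral \<Gamma> \<mu> (hat p) * vpot y p)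
     + (\<Sum>e\<in>E. \<integral>u. real_integral \<Gamma> \<mu> (feat e u) * feat e u y \<partial>edge_measure e))"
    by (rule bounded_borel_add[OF pot_parts_bounded_borel(1)[OF \<mu>] bounded_borel_sum[OF pot_parts_bounded_borel(2)[OF \<mu>]]])
  then show ?thesis by (subst bounded_borel_cong[OF pot_eq[OF \<mu>]])
qed

text \<open>The energy is the sum of a quadratic form in the integrals of the hat functions and of inner
products in \<open>L\<^sup>2\<close> of the edges. The order of integration changes only between the given measures and
Lebesgue measure on an edge.\<close>

lemma energy_eq:
  assumes \<mu>: "bounded_signed \<Gamma> \<mu>" and \<nu>: "bounded_signed \<Gamma> \<nu>"
  shows "energy \<mu> \<nu> = (\<Sum>p\<in>V. \<Sum>q\<in>V. J p q * real_integral \<Gamma> \<mu> (hat p) * real_integral \<Gamma> \<nu> (hat q))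
     + (\<Sum>e\<in>E. \<integral>u. real_integral \<Gamma> \<mu> (feat e u) * real_integral \<Gamma> \<nu> (feat e u) \<partial>edge_measure e)"
proof -
  have "energy \<mu> \<nu> = real_integral \<Gamma> \<nu> (\<lambda>y. (\<Sum>p\<in>V. real_integral \<Gamma> \<mu> (hat p) * vpot y p)
     + (\<Sum>e\<in>E. \<integral>u. real_integral \<Gamma> \<mu> (feat e u) * feat e u y \<partial>edge_measure e))"
    unfolding energy_def by (rule real_integral_cong) (rule pot_eq[OF \<mu>])
  also have "\<dots> = real_integral \<Gamma> \<nu> (\<lambda>y. \<Sum>p\<in>V. real_integral \<Gamma> \<mu> (hat p) * vpot y p)
     + (\<Sum>e\<in>E. real_integral \<Gamma> \<nu> (\<lambda>y. \<integral>u. real_integral \<Gamma> \<mu> (feat e u) * feat e u y \<partial>edge_measure e))"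
    using pot_parts_bounded_borel[OF \<mu>]
    by (subst real_integral_add[OF \<nu>]) (simp_all add: bounded_borel_sum real_integral_sum[OF \<nu>])
  also have "real_integral \<Gamma> \<nu> (\<lambda>y. \<Sum>p\<in>V. real_integral \<Gamma> \<mu> (hat p) * vpot y p)
      = (\<Sum>p\<in>V. \<Sum>q\<in>V. J p q * real_integral \<Gamma> \<mu> (hat p) * real_integral \<Gamma> \<nu> (hat q))"
  proof -
    have "real_integral \<Gamma> \<nu> (\<lambda>y. vpot y p) = (\<Sum>q\<in>V. J p q * real_integral \<Gamma> \<nu> (hat q))" for p
      unfolding vpot_def
      by (subst real_integral_sum[OF \<nu>])
         (auto simp: real_integral_cmult intro!: bounded_borel_mult bounded_borel_const bounded_borel_hat)
    then have "real_integral \<Gamma> \<nu> (\<lambda>y. real_integral \<Gamma> \<mu> (hat p) * vpot y p)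
        = (\<Sum>q\<in>V. J p q * real_integral \<Gamma> \<mu> (hat p) * real_integral \<Gamma> \<nu> (hat q))" for p
      unfolding real_integral_cmult by (simp add: sum_distrib_left mult.assoc mult.left_commute)
    then show ?thesis
      by (subst real_integral_sum[OF \<nu>])
         (auto intro!: bounded_borel_mult bounded_borel_const bounded_borel_vpot)
  qed
  also have "(\<Sum>e\<in>E. real_integral \<Gamma> \<nu> (\<lambda>y. \<integral>u. real_integral \<Gamma> \<mu> (feat e u) * feat e u y \<partial>edge_measure e))
      = (\<Sum>e\<in>E. \<integral>u. real_integral \<Gamma> \<mu> (feat e u) * real_integral \<Gamma> \<nu> (feat e u) \<partial>edge_measure e)"
  proof (rule sum.cong[OF refl])
    fix e assume e: "e \<in> E"
    obtain C where "\<And>u. \<bar>real_integral \<Gamma> \<mu> (feat e u)\<bar> \<le> C" using real_integral_feat(2)[OF \<mu> e] by auto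
    then show "real_integral \<Gamma> \<nu> (\<lambda>y. \<integral>u. real_integral \<Gamma> \<mu> (feat e u) * feat e u y \<partial>edge_measure e)
      = (\<integral>u. real_integral \<Gamma> \<mu> (feat e u) * real_integral \<Gamma> \<nu> (feat e u) \<partial>edge_measure e)"
      by (rule real_integral_weighted_feat(1)[OF \<nu> e real_integral_feat(1)[OF \<mu> e]])
  qed
  finally show ?thesis .
qed

lemma energy_sym:
  assumes \<mu>: "bounded_signed \<Gamma> \<mu>" and \<nu>: "bounded_signed \<Gamma> \<nu>"
  shows "energy \<mu> \<nu> = energy \<nu> \<mu>"
proof -
  have "(\<Sum>p\<in>V. \<Sum>q\<in>V. J p q * real_integral \<Gamma> \<mu> (hat p) * real_integral \<Gamma> \<nu> (hat q))
      = (\<Sum>q\<in>V. \<Sum>p\<in>V. J p q * real_integral \<Gamma> \<mu> (hat p) * real_integral \<Gamma> \<nu> (hat q))"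
    by (rule sum.swap)
  also have "\<dots> = (\<Sum>q\<in>V. \<Sum>p\<in>V. J q p * real_integral \<Gamma> \<nu> (hat q) * real_integral \<Gamma> \<mu> (hat p))"
    by (intro sum.cong refl) (simp add: J_sym)
  finally show ?thesis unfolding energy_eq[OF \<mu> \<nu>] energy_eq[OF \<nu> \<mu>] by (simp add: mult.commute)
qed

text \<open>Substituting \<open>v = lap w\<close> turns the form of the inverse matrix into the form of the grounded Laplacian,
which is visibly positive.\<close>

lemma J_form:
  assumes w: "\<And>p. w p = (\<Sum>q\<in>V. J p q * v q)"
  shows "(\<Sum>p\<in>V. \<Sum>q\<in>V. J p q * v p * v q) = (\<Sum>p\<in>V. w p * (\<Sum>q\<in>V. lap base p q * w q))"
    and "\<And>p. p \<in> V \<Longrightarrow> (\<Sum>q\<in>V. lap base p q * w q) = v p"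
proof -
  show lw: "(\<Sum>q\<in>V. lap base p q * w q) = v p" if p: "p \<in> V" for p
  proof -
    have "(\<Sum>q\<in>V. lap base p q * w q) = (\<Sum>q\<in>V. \<Sum>r\<in>V. lap base p q * J q r * v r)"
      unfolding w by (simp add: sum_distrib_left mult.assoc)
    also have "\<dots> = (\<Sum>r\<in>V. (\<Sum>q\<in>V. lap base p q * J q r) * v r)"
      unfolding sum_distrib_right by (rule sum.swap)
    also have "\<dots> = (\<Sum>r\<in>V. of_bool (p = r) * v r)" by (simp add: J_inverse p)
    finally show ?thesis using p by (simp only: sum_V_of_bool)
  qed
  show "(\<Sum>p\<in>V. \<Sum>q\<in>V. J p q * v p * v q) = (\<Sum>p\<in>V. w p * (\<Sum>q\<in>V. lap base p q * w q))"
  proof (rule sum.cong[OF refl])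
    fix p assume "p \<in> V"
    then show "(\<Sum>q\<in>V. J p q * v p * v q) = w p * (\<Sum>q\<in>V. lap base p q * w q)"
      unfolding lw[OF \<open>p \<in> V\<close>] by (simp add: w sum_distrib_left mult_ac)
  qed
qed

lemma energy_nonneg:
  assumes \<nu>: "bounded_signed \<Gamma> \<nu>" shows "0 \<le> energy \<nu> \<nu>"
  unfolding energy_eq[OF \<nu> \<nu>] J_form(1)[OF refl]
  by (intro add_nonneg_nonneg sum_nonneg lap_form_nonneg base Bochner_Integration.integral_nonneg) auto

lemma energy_zero:
  assumes \<nu>: "bounded_signed \<Gamma> \<nu>" and z: "energy \<nu> \<nu> = 0"
  shows "p \<in> V \<Longrightarrow> real_integral \<Gamma> \<nu> (hat p) = 0"
    and "e \<in> E \<Longrightarrow> AE u in edge_measure e. real_integral \<Gamma> \<nu> (feat e u) = 0"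
proof -
  define v where "v p = real_integral \<Gamma> \<nu> (hat p)" for p
  define w where "w p = (\<Sum>q\<in>V. J p q * v q)" for p
  let ?I = "\<lambda>e. \<integral>u. real_integral \<Gamma> \<nu> (feat e u) * real_integral \<Gamma> \<nu> (feat e u) \<partial>edge_measure e"
  have eq: "(\<Sum>p\<in>V. w p * (\<Sum>q\<in>V. lap base p q * w q)) + (\<Sum>e\<in>E. ?I e) = 0"
    using z unfolding energy_eq[OF \<nu> \<nu>] J_form(1)[OF w_def, symmetric] v_def .
  have I: "0 \<le> ?I e" for e by (intro Bochner_Integration.integral_nonneg) auto
  then have "0 \<le> (\<Sum>e\<in>E. ?I e)" by (rule sum_nonneg)
  with eq lap_form_nonneg[OF base, of w]
  have z1: "(\<Sum>p\<in>V. w p * (\<Sum>q\<in>V. lap base p q * w q)) = 0" and z2: "(\<Sum>e\<in>E. ?I e) = 0" by linarith+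
  {
    assume p: "p \<in> V"
    have "v p = (\<Sum>q\<in>V. lap base p q * w q)" using J_form(2)[OF w_def p] by simp
    also have "\<dots> = 0" using lap_form_zero[OF base z1] by simp
    finally show "real_integral \<Gamma> \<nu> (hat p) = 0" by (simp add: v_def)
  }
  assume e: "e \<in> E"
  interpret finite_measure "edge_measure e" by (rule finite_edge_measure[OF e])
  have "?I e = 0" using z2 I finite_E e by (simp add: sum_nonneg_eq_0_iff)
  obtain C where C: "\<And>u. \<bar>real_integral \<Gamma> \<nu> (feat e u)\<bar> \<le> C" using real_integral_feat(2)[OF \<nu> e] by auto
  have m: "(\<lambda>u. real_integral \<Gamma> \<nu> (feat e u)) \<in> borel_measurable (edge_measure e)" by (rule real_integral_feat(1)[OF \<nu> e])
  have "integrable (edge_measure e) (\<lambda>u. real_integral \<Gamma> \<nu> (feat e u) * real_integral \<Gamma> \<nu> (feat e u))"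
  proof (rule integrable_const_bound)
    show "AE u in edge_measure e. norm (real_integral \<Gamma> \<nu> (feat e u) * real_integral \<Gamma> \<nu> (feat e u)) \<le> C * C"
      unfolding real_norm_def abs_mult
      by (intro AE_I2 mult_mono C abs_ge_zero) (rule order_trans[OF abs_ge_zero C])
  qed (use m in measurable)
  from integral_nonneg_eq_0_iff_AE[OF this] \<open>?I e = 0\<close>
  show "AE u in edge_measure e. real_integral \<Gamma> \<nu> (feat e u) = 0" by simp
qed

end

section \<open>Definiteness of the energy and the trace\<close>

context green_network
begin

lemma real_integral_feat_eq:
  assumes \<nu>: "bounded_signed \<Gamma> \<nu>" and e: "e \<in> E"
  shows "real_integral \<Gamma> \<nu> (feat e u)
     = \<nu> (edge_tail e u) - real_integral \<Gamma> \<nu> (\<lambda>x. of_bool (x \<in> open_edge e) * (crd e x / len e))"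
proof -
  have "real_integral \<Gamma> \<nu> (feat e u) = real_integral \<Gamma> \<nu>
     (\<lambda>x. of_bool (x \<in> edge_tail e u) - of_bool (x \<in> open_edge e) * (crd e x / len e))"
    by (rule real_integral_cong) (auto simp: feat_def edge_tail_def)
  also have "\<dots> = real_integral \<Gamma> \<nu> (\<lambda>x. of_bool (x \<in> edge_tail e u))
     - real_integral \<Gamma> \<nu> (\<lambda>x. of_bool (x \<in> open_edge e) * (crd e x / len e))"
    by (intro real_integral_diff \<nu> bounded_borel_of_bool edge_tail_sets e
        bounded_borel_edge[OF e, of "\<lambda>t. t / len e" 1]) (auto simp: field_simps)
  finally show ?thesis by (simp add: real_integral_of_bool[OF \<nu> edge_tail_sets[OF e]])
qed

lemma edge_tail_mono: "u \<le> v \<Longrightarrow> edge_tail e v \<subseteq> edge_tail e u"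
  by (auto simp: edge_tail_def)

lemma edge_tail_right_continuous:
  assumes K: "finite_measure K" "sets K = borel_sets_of \<Gamma>" and e: "e \<in> E"
    and s: "decseq s" "s \<longlonglongrightarrow> u" "\<And>n. u \<le> s n"
  shows "(\<lambda>n. measure K (edge_tail e (s n))) \<longlonglongrightarrow> measure K (edge_tail e u)"
proof -
  have "(\<lambda>n. measure K (edge_tail e (s n))) \<longlonglongrightarrow> measure K (\<Union>n. edge_tail e (s n))"
    using K e s(1) edge_tail_sets edge_tail_mono
    by (intro finite_measure.finite_Lim_measure_incseq) (auto simp: incseq_def decseq_def)
  also have "(\<Union>n. edge_tail e (s n)) = edge_tail e u"
  proof (intro equalityI subsetI)
    fix x assume x: "x \<in> edge_tail e u"
    then have "u < crd e x" by (simp add: edge_tail_def)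
    with s(2) have "eventually (\<lambda>n. s n < crd e x) sequentially" by (rule order_tendstoD(2))
    then obtain n where "s n < crd e x" using eventually_happens'[OF sequentially_bot] by blast
    then show "x \<in> (\<Union>n. edge_tail e (s n))" using x by (auto simp: edge_tail_def)
  qed (use edge_tail_mono[OF s(3)] in blast)
  finally show ?thesis .
qed

text \<open>On an edge, vanishing energy says that the mass of the points beyond \<open>u\<close> equals one and the same
number \<open>b\<close> for almost all \<open>u\<close>. That mass is continuous from the right in \<open>u\<close>, so the equality holds
for all \<open>u\<close>; it tends to \<open>0\<close> at the far end of the edge, so \<open>b = 0\<close>.\<close>

lemma energy_zero_edge:
  assumes \<nu>: "bounded_signed \<Gamma> \<nu>" and z: "energy \<nu> \<nu> = 0" and e: "e \<in> E"
  shows "real_integral \<Gamma> \<nu> (\<lambda>x. of_bool (x \<in> open_edge e) * (crd e x / len e)) = 0"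
    and "\<nu> (edge_tail e u) = 0"
proof -
  let ?P = "pos_part \<Gamma> \<nu>" and ?N = "pos_part \<Gamma> (\<lambda>A. - \<nu> A)" and ?L = "len e" and ?D = "edge_measure e"
  define b where "b = real_integral \<Gamma> \<nu> (\<lambda>x. of_bool (x \<in> open_edge e) * (crd e x / len e))"
  have P: "finite_measure ?P" "sets ?P = borel_sets_of \<Gamma>" and N: "finite_measure ?N" "sets ?N = borel_sets_of \<Gamma>"
    using finite_measure_pos_part[OF \<nu>] finite_measure_pos_part[OF bounded_signed_uminus[OF \<nu>]] by simp_all
  have L: "0 < ?L" by (rule len_pos[OF e])
  define a where "a u = \<nu> (edge_tail e u)" for u
  have a: "a u = measure ?P (edge_tail e u) - measure ?N (edge_tail e u)" for u
    unfolding a_def by (rule jordan_decomposition[OF \<nu> edge_tail_sets[OF e]])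
  have "AE u in ?D. a u - b = 0"
    using energy_zero(2)[OF \<nu> z e] unfolding real_integral_feat_eq[OF \<nu> e] a_def b_def .
  then have ae: "AE u in ?D. a u = b" by simp
  have good: "\<exists>u. c < u \<and> u < d \<and> a u = b" if cd: "0 \<le> c" "c < d" "d \<le> ?L" for c d
  proof (rule ccontr)
    assume no: "\<not> ?thesis"
    have ae': "AE u in ?D. u \<notin> {c<..<d}" using ae by eventually_elim (use no in auto)
    have S: "{c<..<d} \<in> sets ?D"
      using cd by (auto simp: edge_measure_def sets_restrict_space image_iff intro!: bexI[of _ "{c<..<d}"])
    have eq: "{u \<in> space ?D. \<not> u \<notin> {c<..<d}} = {c<..<d}" using cd by (auto simp: space_edge_measure)
    have "emeasure ?D {c<..<d} = 0" using ae' unfolding AE_iff_measurable[OF S eq] .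
    moreover have "emeasure ?D {c<..<d} = ennreal (d - c)"
      unfolding edge_measure_def using cd by (subst emeasure_restrict_space) auto
    ultimately show False using cd by simp
  qed
  have ab: "a u = b" if u: "0 \<le> u" "u < ?L" for u
  proof -
    \<comment> \<open>Exceptional parameters are approached from the right by good ones, squeezed between \<open>u\<close> and this sequence.\<close>
    define s where "s n = u + (?L - u) * inverse (real (Suc n))" for n
    have su: "u < s n" "s n \<le> ?L" for n
    proof -
      have "inverse (real (Suc n)) \<le> 1" by (simp add: field_simps)
      then have "(?L - u) * inverse (real (Suc n)) \<le> (?L - u) * 1" using u by (intro mult_left_mono) simp_all
      then have "s n \<le> u + (?L - u) * 1" unfolding s_def by (rule add_left_mono)
      then show "s n \<le> ?L" by simp
      show "u < s n" using u by (simp add: s_def)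
    qed
    have s0: "s \<longlonglongrightarrow> u"
      unfolding s_def using tendsto_add[OF tendsto_const tendsto_mult[OF tendsto_const LIMSEQ_inverse_real_of_nat]] by fastforce
    have "decseq s" unfolding s_def decseq_def using u
      by (auto intro!: mult_left_mono le_imp_inverse_le)
    have "\<forall>n. \<exists>g. u < g \<and> g < s n \<and> a g = b" using good[OF u(1) su(1) su(2)] by blast
    then obtain g where g: "\<And>n. u < g n" "\<And>n. g n < s n" "\<And>n. a (g n) = b" by metis
    have lim: "(\<lambda>n. measure K (edge_tail e (g n))) \<longlonglongrightarrow> measure K (edge_tail e u)"
      if K: "finite_measure K" "sets K = borel_sets_of \<Gamma>" for K
    proof (rule real_tendsto_sandwich)
      show "(\<lambda>n. measure K (edge_tail e (s n))) \<longlonglongrightarrow> measure K (edge_tail e u)"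
        using K e \<open>decseq s\<close> s0 less_imp_le[OF su(1)] by (rule edge_tail_right_continuous)
      have m: "measure K (edge_tail e q) \<le> measure K (edge_tail e r)" if "r \<le> q" for q r
        using edge_tail_mono[OF that] edge_tail_sets[OF e] K by (intro finite_measure.finite_measure_mono) auto
      show "\<forall>\<^sub>F n in sequentially. measure K (edge_tail e (s n)) \<le> measure K (edge_tail e (g n))"
        using g(2) by (intro always_eventually allI m less_imp_le)
      show "\<forall>\<^sub>F n in sequentially. measure K (edge_tail e (g n)) \<le> measure K (edge_tail e u)"
        using g(1) by (intro always_eventually allI m less_imp_le)
    qed simp
    have "(\<lambda>n. a (g n)) \<longlonglongrightarrow> a u"
      unfolding a by (intro tendsto_diff lim P N)
    then show ?thesis unfolding g(3) using LIMSEQ_unique tendsto_const by blast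
  qed
  have "b = 0"
  proof -
    define t where "t n = ?L - ?L * inverse (real (Suc n))" for n
    have t: "0 \<le> t n" "t n < ?L" for n
    proof -
      have "inverse (real (Suc n)) \<le> 1" by (simp add: field_simps)
      from mult_left_mono[OF this, of ?L] L show "0 \<le> t n" by (simp add: t_def)
      show "t n < ?L" using L by (simp add: t_def)
    qed
    have "incseq t" unfolding t_def incseq_def using L
      by (auto intro!: mult_left_mono le_imp_inverse_le)
    have tL: "t \<longlonglongrightarrow> ?L"
      unfolding t_def using tendsto_diff[OF tendsto_const tendsto_mult[OF tendsto_const LIMSEQ_inverse_real_of_nat], of ?L ?L] by simp
    have empty: "(\<Inter>n. edge_tail e (t n)) = {}"
    proof (rule ccontr)
      assume "(\<Inter>n. edge_tail e (t n)) \<noteq> {}"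
      then obtain x where x: "\<And>n. x \<in> edge_tail e (t n)" by blast
      then have "x \<in> open_edge e" "\<And>n. t n < crd e x" by (auto simp: edge_tail_def)
      then have "crd e x < ?L" using crd_open_edge[OF e] by blast
      then have "eventually (\<lambda>n. crd e x < t n) sequentially" using tL by (rule order_tendstoD(1)[rotated])
      then obtain n where "crd e x < t n" using eventually_happens'[OF sequentially_bot] by blast
      then show False using \<open>\<And>n. t n < crd e x\<close>[of n] by simp
    qed
    have lim: "(\<lambda>n. measure K (edge_tail e (t n))) \<longlonglongrightarrow> 0"
      if K: "finite_measure K" "sets K = borel_sets_of \<Gamma>" for K
    proof -
      have "(\<lambda>n. measure K (edge_tail e (t n))) \<longlonglongrightarrow> measure K (\<Inter>n. edge_tail e (t n))"
        using K e \<open>incseq t\<close> edge_tail_sets edge_tail_mono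
        by (intro finite_measure.finite_Lim_measure_decseq) (auto simp: incseq_def decseq_def)
      then show ?thesis unfolding empty by simp
    qed
    have "(\<lambda>n. a (t n)) \<longlonglongrightarrow> 0 - 0" unfolding a by (intro tendsto_diff lim P N)
    then have "(\<lambda>n. b) \<longlonglongrightarrow> 0" using ab[OF t] by simp
    then show "b = 0" using LIMSEQ_unique tendsto_const by blast
  qed
  then show "real_integral \<Gamma> \<nu> (\<lambda>x. of_bool (x \<in> open_edge e) * (crd e x / len e)) = 0" by (simp add: b_def)
  show "\<nu> (edge_tail e u) = 0"
  proof (cases "max 0 u < ?L")
    case True
    have "edge_tail e u = edge_tail e (max 0 u)" by (simp add: edge_tail_eq[OF e])
    then show ?thesis using ab[of "max 0 u"] True \<open>b = 0\<close> by (simp add: a_def)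
  next
    case False
    then have "{max 0 u<..<?L} = {}" by (simp only: not_less greaterThanLessThan_empty)
    then have "edge_tail e u = {}" unfolding edge_tail_eq[OF e] by simp
    then show ?thesis using \<nu> by (simp add: bounded_signed_def vector_borel_measure_def)
  qed
qed

text \<open>Every edge carries no mass beyond any of its points, so the hat functions integrate to the point
masses of their vertices, which vanish as well. The positive and the negative part of the measure then
agree on a determining family of sets.\<close>

lemma energy_definite:
  assumes \<nu>: "bounded_signed \<Gamma> \<nu>" and z: "energy \<nu> \<nu> = 0" and A: "A \<in> borel_sets_of \<Gamma>"
  shows "\<nu> A = 0"
proof -
  let ?P = "pos_part \<Gamma> \<nu>" and ?N = "pos_part \<Gamma> (\<lambda>A. - \<nu> A)"
  note jd = jordan_decomposition[OF \<nu>]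
  interpret P: finite_measure ?P by (rule finite_measure_pos_part[OF \<nu>])
  interpret N: finite_measure ?N by (rule finite_measure_pos_part[OF bounded_signed_uminus[OF \<nu>]])
  have vert: "\<nu> {p} = 0" if p: "p \<in> V" for p
  proof -
    let ?a = "\<lambda>e. of_bool (par e 0 = p) :: real" and ?c = "\<lambda>e. of_bool (par e (len e) = p) - of_bool (par e 0 = p) :: real"
    let ?f = "\<lambda>e x. of_bool (x \<in> open_edge e) :: real" and ?g = "\<lambda>e x. of_bool (x \<in> open_edge e) * (crd e x / len e)"
    have h: "hat p = (\<lambda>x. of_bool (x \<in> {p}) + (\<Sum>e\<in>E. ?a e * ?f e x + ?c e * ?g e x))"
      unfolding hat_def by (intro ext arg_cong2[of _ _ _ _ "(+)"] sum.cong) (auto simp: algebra_simps)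
    have bf: "bounded_borel \<Gamma> (\<lambda>x. ?a e * ?f e x)" and bg: "bounded_borel \<Gamma> (\<lambda>x. ?c e * ?g e x)" if e: "e \<in> E" for e
      by (intro bounded_borel_mult[OF bounded_borel_const] bounded_borel_of_bool open_edge_sets e
         bounded_borel_edge[OF e, of "\<lambda>t. t / len e" 1]; simp add: field_simps)+
    have "real_integral \<Gamma> \<nu> (hat p) = real_integral \<Gamma> \<nu> (\<lambda>x. of_bool (x \<in> {p}))
        + (\<Sum>e\<in>E. real_integral \<Gamma> \<nu> (\<lambda>x. ?a e * ?f e x + ?c e * ?g e x))"
      unfolding h using bf bg
      by (subst real_integral_add[OF \<nu>])
         (auto simp only: real_integral_sum[OF \<nu>] bounded_borel_add intro!: bounded_borel_of_bool vertex_sets p bounded_borel_sum)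
    also have "(\<Sum>e\<in>E. real_integral \<Gamma> \<nu> (\<lambda>x. ?a e * ?f e x + ?c e * ?g e x)) = 0"
    proof (rule sum.neutral, rule ballI)
      fix e assume e: "e \<in> E"
      have "edge_tail e 0 = open_edge e" using crd_open_edge[OF e] by (auto simp: edge_tail_def)
      then have "real_integral \<Gamma> \<nu> (?f e) = 0"
        using real_integral_of_bool[OF \<nu> open_edge_sets[OF e]] energy_zero_edge(2)[OF \<nu> z e, of 0] by simp
      then show "real_integral \<Gamma> \<nu> (\<lambda>x. ?a e * ?f e x + ?c e * ?g e x) = 0"
        using energy_zero_edge(1)[OF \<nu> z e]
        by (simp only: real_integral_add[OF \<nu> bf[OF e] bg[OF e]] real_integral_cmult)
    qed
    finally show ?thesis
      using energy_zero(1)[OF \<nu> z p] real_integral_of_bool[OF \<nu> vertex_sets[OF p]] by simp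
  qed
  have "?P = ?N"
  proof (rule measure_eqI_network)
    show "emeasure ?P {p} = emeasure ?N {p}" if "p \<in> V" for p
      using jd[OF vertex_sets[OF that]] vert[OF that] by (simp add: P.emeasure_eq_measure N.emeasure_eq_measure)
    show "emeasure ?P (edge_tail e u) = emeasure ?N (edge_tail e u)" if "e \<in> E" for e u
      using jd[OF edge_tail_sets[OF that]] energy_zero_edge(2)[OF \<nu> z that]
      by (simp add: P.emeasure_eq_measure N.emeasure_eq_measure)
  qed (simp_all add: P.finite_measure_axioms N.finite_measure_axioms)
  then show ?thesis using jd[OF A] by simp
qed

lemma j_mu_eq:
  assumes \<mu>: "bounded_signed \<Gamma> \<mu>" "\<mu> \<Gamma> = 1" and x: "x \<in> \<Gamma>" and y: "y \<in> \<Gamma>"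
  shows "j_mu \<Gamma> \<mu> x y = of_real (G x y - pot \<mu> x - pot \<mu> y + real_integral \<Gamma> \<mu> (\<lambda>z. G z z))"
proof -
  have "j_mu \<Gamma> \<mu> x y = signed_integral \<Gamma> \<mu> (\<lambda>z. of_real (G x y - G z x - G z y + G z z))"
    unfolding j_mu_def using x y by (intro signed_integral_cong) (simp add: j_fun_eq G_sym[of x])
  also have "\<dots> = of_real (real_integral \<Gamma> \<mu> (\<lambda>z. G x y - G z x - G z y + G z z))"
    by (rule signed_integral_of_real)
  also have "real_integral \<Gamma> \<mu> (\<lambda>z. G x y - G z x - G z y + G z z)
     = real_integral \<Gamma> \<mu> (\<lambda>z. G x y) - pot \<mu> x - pot \<mu> y + real_integral \<Gamma> \<mu> (\<lambda>z. G z z)"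
    unfolding pot_def using x y
    by (simp add: real_integral_add real_integral_diff \<mu>(1) bounded_borel_G bounded_borel_G_diag
        bounded_borel_diff bounded_borel_const)
  finally show ?thesis using \<mu> by (simp add: real_integral_const)
qed

text \<open>The potential of \<open>\<mu>\<close> at \<open>y\<close> enters once through the Green function and once with the opposite sign
and total mass \<open>1\<close>; this is why the integral does not depend on \<open>y\<close>.\<close>

lemma c_mu_eq:
  assumes \<mu>: "bounded_signed \<Gamma> \<mu>" "\<mu> \<Gamma> = 1"
  shows "c_mu \<Gamma> \<mu> = of_real (real_integral \<Gamma> \<mu> (\<lambda>z. G z z) - energy \<mu> \<mu>)"
proof -
  let ?D = "real_integral \<Gamma> \<mu> (\<lambda>z. G z z)"
  have "signed_integral \<Gamma> \<mu> (\<lambda>x. j_mu \<Gamma> \<mu> x y) = of_real (?D - energy \<mu> \<mu>)" if y: "y \<in> \<Gamma>" for y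
  proof -
    have "signed_integral \<Gamma> \<mu> (\<lambda>x. j_mu \<Gamma> \<mu> x y)
       = signed_integral \<Gamma> \<mu> (\<lambda>x. of_real (G x y - pot \<mu> x - pot \<mu> y + ?D))"
      using y by (intro signed_integral_cong) (simp add: j_mu_eq[OF \<mu>])
    also have "\<dots> = of_real (real_integral \<Gamma> \<mu> (\<lambda>x. G x y - pot \<mu> x - pot \<mu> y + ?D))"
      by (rule signed_integral_of_real)
    also have "real_integral \<Gamma> \<mu> (\<lambda>x. G x y - pot \<mu> x - pot \<mu> y + ?D)
      = pot \<mu> y - energy \<mu> \<mu> - pot \<mu> y * \<mu> \<Gamma> + ?D * \<mu> \<Gamma>"
      unfolding energy_def using y
      by (simp add: real_integral_add real_integral_diff real_integral_const \<mu>(1) bounded_borel_G bounded_borel_pot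
          bounded_borel_diff bounded_borel_const pot_def[symmetric])
    finally show ?thesis using \<mu>(2) by simp
  qed
  moreover obtain y where "y \<in> \<Gamma>" using nonempty_\<Gamma> by blast
  ultimately show ?thesis unfolding c_mu_def by (intro the_equality) auto
qed

lemma g_mu_eq:
  assumes "bounded_signed \<Gamma> \<mu>" "\<mu> \<Gamma> = 1" "x \<in> \<Gamma>" "y \<in> \<Gamma>"
  shows "g_mu \<Gamma> \<mu> x y = of_real (G x y - pot \<mu> x - pot \<mu> y + energy \<mu> \<mu>)"
  by (simp add: g_mu_def j_mu_eq c_mu_eq assms)

lemma dx_eq_measure: "dx \<Gamma> = measure (arc_length \<Gamma>)"
  by (simp add: fun_eq_iff dx_def)

lemma bounded_signed_dx: "bounded_signed \<Gamma> (dx \<Gamma>)"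
  unfolding dx_eq_measure using finite_measure_arc_length sets_arc_length by (rule finite_measure_bounded_signed)

lemma Tr_phi_eq:
  assumes \<mu>: "bounded_signed \<Gamma> \<mu>" "\<mu> \<Gamma> = 1" and len1: "dx \<Gamma> \<Gamma> = 1"
  shows "Tr_phi \<Gamma> \<mu> = of_real (real_integral \<Gamma> (dx \<Gamma>) (\<lambda>x. G x x) - 2 * energy \<mu> (dx \<Gamma>) + energy \<mu> \<mu>)"
proof -
  let ?f = "\<lambda>x. G x x - 2 * pot \<mu> x + energy \<mu> \<mu>"
  have b: "bounded_borel \<Gamma> (\<lambda>x. 2 * pot \<mu> x)"
    by (intro bounded_borel_mult bounded_borel_const bounded_borel_pot \<mu>(1))
  have bf: "bounded_borel \<Gamma> ?f"
    by (intro bounded_borel_add bounded_borel_diff bounded_borel_G_diag bounded_borel_const b)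
  have "Tr_phi \<Gamma> \<mu> = (\<integral>x. complex_of_real (?f x) \<partial>arc_length \<Gamma>)"
    unfolding Tr_phi_def
    by (intro Bochner_Integration.integral_cong refl)
       (simp add: space_eq_of_sets[OF sets_arc_length] g_mu_eq \<mu>)
  also have "\<dots> = of_real (real_integral \<Gamma> (dx \<Gamma>) ?f)"
    unfolding dx_eq_measure real_integral_measure[OF finite_measure_arc_length sets_arc_length bf]
    by (rule integral_complex_of_real)
  also have "real_integral \<Gamma> (dx \<Gamma>) ?f
      = real_integral \<Gamma> (dx \<Gamma>) (\<lambda>x. G x x) - 2 * energy \<mu> (dx \<Gamma>) + energy \<mu> \<mu>"
    unfolding energy_def[of \<mu> "dx \<Gamma>"] using len1
    by (simp add: real_integral_add real_integral_diff real_integral_cmult real_integral_const bounded_signed_dx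
        bounded_borel_diff bounded_borel_G_diag bounded_borel_const b)
  finally show ?thesis .
qed

text \<open>For a measure of total mass \<open>0\<close> all terms of the kernel vanish that depend on one variable only. What
remains does not involve the auxiliary measure \<open>\<mu>'\<close>, and \<open>\<mu>\<close> itself is one that is admissible.\<close>

lemma energy_pairing_eq:
  fixes \<mu> :: "'a set \<Rightarrow> real"
  assumes \<nu>: "bounded_signed \<Gamma> \<nu>" "\<nu> \<Gamma> = 0"
    and \<mu>: "vector_borel_measure \<Gamma> \<mu>" "total_variation \<Gamma> \<mu> \<Gamma> < \<infinity>" "\<mu> \<Gamma> = 1"
  shows "energy_pairing \<Gamma> (\<lambda>A. of_real (\<nu> A)) (\<lambda>A. of_real (\<nu> A)) = of_real (energy \<nu> \<nu>)"
proof -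
  have ci: "complex_integral \<Gamma> (\<lambda>A. complex_of_real (\<nu> A)) F = signed_integral \<Gamma> \<nu> F"
    "complex_integral \<Gamma> (\<lambda>A. cnj (complex_of_real (\<nu> A))) F = signed_integral \<Gamma> \<nu> F" for F
    by (simp_all add: complex_integral_def signed_integral_zero_measure)
  have "complex_integral \<Gamma> (\<lambda>A. cnj (of_real (\<nu> A))) (\<lambda>y. complex_integral \<Gamma> (\<lambda>A. of_real (\<nu> A)) (\<lambda>x. g_mu \<Gamma> \<mu>' x y))
      = of_real (energy \<nu> \<nu>)" if \<mu>': "bounded_vector_measure \<Gamma> \<mu>'" "\<mu>' \<Gamma> = 1" for \<mu>'
  proof -
    have s: "bounded_signed \<Gamma> \<mu>'"
      using \<mu>'(1) bounded_signedI_total_variation unfolding bounded_vector_measure_def by blast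
    let ?k = "real_integral \<Gamma> \<nu> (pot \<mu>')"
    have inner: "signed_integral \<Gamma> \<nu> (\<lambda>x. g_mu \<Gamma> \<mu>' x y) = of_real (pot \<nu> y - ?k)" if y: "y \<in> \<Gamma>" for y
    proof -
      have "signed_integral \<Gamma> \<nu> (\<lambda>x. g_mu \<Gamma> \<mu>' x y)
        = signed_integral \<Gamma> \<nu> (\<lambda>x. of_real (G x y - pot \<mu>' x - pot \<mu>' y + energy \<mu>' \<mu>'))"
        using y by (intro signed_integral_cong) (simp add: g_mu_eq s \<mu>'(2))
      also have "\<dots> = of_real (real_integral \<Gamma> \<nu> (\<lambda>x. G x y - pot \<mu>' x - pot \<mu>' y + energy \<mu>' \<mu>'))"
        by (rule signed_integral_of_real)
      also have "real_integral \<Gamma> \<nu> (\<lambda>x. G x y - pot \<mu>' x - pot \<mu>' y + energy \<mu>' \<mu>') = pot \<nu> y - ?k"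
        using y \<nu>(2)
        by (simp add: real_integral_add real_integral_diff real_integral_const \<nu>(1) bounded_borel_G
            bounded_borel_pot s bounded_borel_diff bounded_borel_const pot_def[symmetric])
      finally show ?thesis .
    qed
    have "signed_integral \<Gamma> \<nu> (\<lambda>y. signed_integral \<Gamma> \<nu> (\<lambda>x. g_mu \<Gamma> \<mu>' x y))
       = signed_integral \<Gamma> \<nu> (\<lambda>y. of_real (pot \<nu> y - ?k))"
      by (intro signed_integral_cong inner)
    also have "\<dots> = of_real (real_integral \<Gamma> \<nu> (\<lambda>y. pot \<nu> y - ?k))" by (rule signed_integral_of_real)
    also have "real_integral \<Gamma> \<nu> (\<lambda>y. pot \<nu> y - ?k) = energy \<nu> \<nu>"
      unfolding energy_def
      by (simp add: real_integral_diff real_integral_const \<nu> bounded_borel_pot bounded_borel_const)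
    finally show ?thesis unfolding ci .
  qed
  note common = this
  have "bounded_vector_measure \<Gamma> \<mu>" using \<mu> by (simp add: bounded_vector_measure_def)
  from common[OF this \<mu>(3)] this \<mu>(3) show ?thesis
    unfolding energy_pairing_def by (intro the_equality allI impI common) auto
qed

lemma energy_diff:
  assumes \<mu>: "bounded_signed \<Gamma> \<mu>" and \<nu>: "bounded_signed \<Gamma> \<nu>"
  shows "energy (\<lambda>A. \<nu> A - \<mu> A) (\<lambda>A. \<nu> A - \<mu> A) = energy \<nu> \<nu> - 2 * energy \<mu> \<nu> + energy \<mu> \<mu>"
proof -
  let ?d = "\<lambda>A. \<nu> A - \<mu> A"
  have "energy ?d ?d = real_integral \<Gamma> ?d (\<lambda>y. pot \<nu> y - pot \<mu> y)"
    unfolding energy_def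
    by (rule real_integral_cong) (simp add: pot_def real_integral_measure_diff \<mu> \<nu> bounded_borel_G)
  also have "\<dots> = (energy \<nu> \<nu> - energy \<mu> \<nu>) - (energy \<nu> \<mu> - energy \<mu> \<mu>)"
    unfolding energy_def
    by (simp add: real_integral_measure_diff real_integral_diff \<mu> \<nu> bounded_borel_pot bounded_borel_diff)
  finally show ?thesis using energy_sym[OF \<mu> \<nu>] by simp
qed

text \<open>The trace formula is the expansion of the energy of \<open>dx - \<mu>\<close> by bilinearity, and the rest is the
definiteness of the energy.\<close>

lemma trace_formula:
  assumes len1: "total_length \<Gamma> = 1" and \<mu>: "vector_borel_measure \<Gamma> \<mu>" "total_variation \<Gamma> \<mu> \<Gamma> < \<infinity>" "\<mu> \<Gamma> = 1"
  shows "Tr_phi \<Gamma> \<mu> = Tr_phi \<Gamma> (dx \<Gamma>) +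
           energy_pairing \<Gamma> (\<lambda>A. of_real (dx \<Gamma> A - \<mu> A)) (\<lambda>A. of_real (dx \<Gamma> A - \<mu> A))
         \<and> Tr_phi \<Gamma> \<mu> \<in> \<real> \<and> Tr_phi \<Gamma> (dx \<Gamma>) \<in> \<real>
         \<and> Re (Tr_phi \<Gamma> \<mu>) \<ge> Re (Tr_phi \<Gamma> (dx \<Gamma>))
         \<and> (Tr_phi \<Gamma> \<mu> = Tr_phi \<Gamma> (dx \<Gamma>) \<longleftrightarrow> vector_measure_eq \<Gamma> \<mu> (dx \<Gamma>))"
proof -
  have len1': "dx \<Gamma> \<Gamma> = 1" using len1 by (simp add: total_length_def)
  have b\<mu>: "bounded_signed \<Gamma> \<mu>" using \<mu>(1,2) by (rule bounded_signedI_total_variation)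
  note bdx = bounded_signed_dx
  let ?d = "\<lambda>A. dx \<Gamma> A - \<mu> A"
  have bd: "bounded_signed \<Gamma> ?d" using bdx b\<mu> by (rule bounded_signed_diff)
  have d0: "?d \<Gamma> = 0" using len1' \<mu>(3) by simp
  have T\<mu>: "Tr_phi \<Gamma> \<mu> = of_real (real_integral \<Gamma> (dx \<Gamma>) (\<lambda>x. G x x) - 2 * energy \<mu> (dx \<Gamma>) + energy \<mu> \<mu>)"
    by (rule Tr_phi_eq[OF b\<mu> \<mu>(3) len1'])
  have Tdx: "Tr_phi \<Gamma> (dx \<Gamma>) = of_real (real_integral \<Gamma> (dx \<Gamma>) (\<lambda>x. G x x) - energy (dx \<Gamma>) (dx \<Gamma>))"
    using Tr_phi_eq[OF bdx len1' len1'] by simp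
  have ep: "energy_pairing \<Gamma> (\<lambda>A. of_real (?d A)) (\<lambda>A. of_real (?d A)) = of_real (energy ?d ?d)"
    by (rule energy_pairing_eq[OF bd d0 \<mu>])
  have main: "Tr_phi \<Gamma> \<mu> = Tr_phi \<Gamma> (dx \<Gamma>) + of_real (energy ?d ?d)"
    unfolding T\<mu> Tdx energy_diff[OF b\<mu> bdx] by simp
  have "energy ?d ?d = 0 \<longleftrightarrow> vector_measure_eq \<Gamma> \<mu> (dx \<Gamma>)"
  proof
    assume "energy ?d ?d = 0"
    then have "?d A = 0" if "A \<in> borel_sets_of \<Gamma>" for A by (rule energy_definite[OF bd _ that])
    then show "vector_measure_eq \<Gamma> \<mu> (dx \<Gamma>)" by (simp add: vector_measure_eq_def)
  next
    assume eq: "vector_measure_eq \<Gamma> \<mu> (dx \<Gamma>)"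
    have "pos_part \<Gamma> ?d = pos_part \<Gamma> (\<lambda>A. - ?d A)"
      unfolding pos_part_def using eq
      by (intro arg_cong[of _ _ "measure_of \<Gamma> (borel_sets_of \<Gamma>)"] ext SUP_cong refl)
         (simp add: vector_measure_eq_def)
    then show "energy ?d ?d = 0" by (simp add: energy_def real_integral_def)
  qed
  then show ?thesis unfolding ep main using energy_nonneg[OF bd] by (auto simp: Tdx)
qed

end

theorem corollary14p7:
  fixes \<Gamma> :: "'a::metric_space set" and \<mu> :: "'a set \<Rightarrow> real"
  assumes "metrized_graph \<Gamma>"
    and "total_length \<Gamma> = 1"
    and "vector_borel_measure \<Gamma> \<mu>"
    and "total_variation \<Gamma> \<mu> \<Gamma> < \<infinity>"
    and "\<mu> \<Gamma> = 1"
  shows "Tr_phi \<Gamma> \<mu> = Tr_phi \<Gamma> (dx \<Gamma>) +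
           energy_pairing \<Gamma> (\<lambda>A. of_real (dx \<Gamma> A - \<mu> A)) (\<lambda>A. of_real (dx \<Gamma> A - \<mu> A))
         \<and> Tr_phi \<Gamma> \<mu> \<in> \<real> \<and> Tr_phi \<Gamma> (dx \<Gamma>) \<in> \<real>
         \<and> Re (Tr_phi \<Gamma> \<mu>) \<ge> Re (Tr_phi \<Gamma> (dx \<Gamma>))
         \<and> (Tr_phi \<Gamma> \<mu> = Tr_phi \<Gamma> (dx \<Gamma>) \<longleftrightarrow> vector_measure_eq \<Gamma> \<mu> (dx \<Gamma>))"
proof -
  obtain V and E :: "('a \<times> complex \<times> real \<times> real) set" and len par
    where "network \<Gamma> V E len par" using network_exists[OF assms(1)] by blast
  then interpret network \<Gamma> V E len par .
  obtain p where p: "p \<in> V" using V_nonempty by blast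
  obtain J where "\<And>q r. q \<in> V \<Longrightarrow> r \<in> V \<Longrightarrow> J q r = J r q"
    "\<And>q r. q \<in> V \<Longrightarrow> r \<in> V \<Longrightarrow> (\<Sum>s\<in>V. lap p q s * J s r) = of_bool (q = r)"
    using lap_inverse_exists[OF p] by metis
  then interpret green_network \<Gamma> V E len par p J using p by unfold_locales auto
  show ?thesis by (rule trace_formula[OF assms(2-5)])
qed

end
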